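(* Let $\alpha>-1$, let $\varphi$ be an elliptic automorphism of $\mathbb{D}$ with fixed point $a\in\mathbb{D}$, and let $\psi\in H^\infty(\mathbb{D})$ be not identically zero. Assume that the weighted composition operator $C_{\psi,\varphi}$ on $A_\alpha^2(\mathbb{D})$ is not invertible. (1) If $\varphi'(a)^n=1$ for some positive integer $n$, and $n_0$ is the smallest such integer, then the spectrum of $C_{\psi,\varphi}$ on $A_\alpha^2(\mathbb{D})$ is the closure of the set $$\Big\{\lambda\in\mathbb{C} : \lambda^{n_0}=\prod_{k=0}^{n_0-1}\psi(\varphi_k(z))\ \text{for some } z\in\mathbb{D}\Big\}.$$ (2) If $\varphi'(a)^n\ne 1$ for all positive integers $n$ and $\psi\in A(\mathbb{D})$, then the spectrum of $C_{\psi,\varphi}$ on $A_\alpha^2(\mathbb{D})$ is $$\left\{\lambda\in\mathbb{C}:|\lambda|\leqslant|v(a)|\right\},$$ where $v$ is the outer part of $\psi$.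
   Context: $\mathbb{D}$ is the open unit disk in $\mathbb{C}$. For $\alpha>-1$, the weighted Bergman space $A_\alpha^2(\mathbb{D})$ is the Hilbert space of analytic functions $f$ on $\mathbb{D}$ with $\|f\|^2=\int_{\mathbb{D}}|f(z)|^2\,\frac{1+\alpha}{\pi}(1-|z|^2)^\alpha\,dA(z)<\infty$, where $dA$ is Lebesgue area measure. $H^\infty(\mathbb{D})$ is the space of bounded analytic functions on $\mathbb{D}$, and $A(\mathbb{D})$ (the disk algebra) its subspace of functions continuous on $\overline{\mathbb{D}}$. For an automorphism $\varphi$ of $\mathbb{D}$ and $\psi\in H^\infty(\mathbb{D})$, $C_{\psi,\varphi}$ is the bounded operator $C_{\psi,\varphi}f=\psi\cdot(f\circ\varphi)$. An automorphism of $\mathbb{D}$ is elliptic if it has a unique fixed point in $\mathbb{D}$. $\varphi_k$ denotes the $k$-th iterate of $\varphi$, with $\varphi_0$ the identity. $H^2(\mathbb{D})$ is the Hardy-Hilbert space of the disk. Every nonzero $\psi\in H^2(\mathbb{D})$ factors as $\psi=\tau v$, uniquely up to constants of modulus one, where $\tau$ is inner (i.e. $\tau\in H^2(\mathbb{D})$ and its radial boundary values satisfy $|\tau|=1$ a.e. on $\partial\mathbb{D}$) and $v$ is outer (i.e. $v\in H^2(\mathbb{D})$ and $\frac{1}{2\pi}\int_0^{2\pi}\log|v(e^{i\theta})|\,d\theta=\log|v(0)|$, with $v(0)\ne0$); $v$ is called the outer part of $\psi$. *)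

theory Defs
  imports "HOL-Complex_Analysis.Complex_Analysis"
begin

section \<open>Operators and spectra on a space of complex functions\<close>

text \<open>A normed space of functions is given by its carrier \<open>X\<close> and its norm \<open>N\<close>; the vector space
  operations are the pointwise ones.\<close>

definition bounded_operator ::
  "('a \<Rightarrow> complex) set \<Rightarrow> (('a \<Rightarrow> complex) \<Rightarrow> real) \<Rightarrow> (('a \<Rightarrow> complex) \<Rightarrow> ('a \<Rightarrow> complex)) \<Rightarrow> bool"
  where "bounded_operator X N T \<longleftrightarrow>
    (\<forall>f\<in>X. T f \<in> X) \<and>
    (\<forall>f\<in>X. \<forall>g\<in>X. T (\<lambda>z. f z + g z) = (\<lambda>z. T f z + T g z)) \<and>
    (\<forall>c. \<forall>f\<in>X. T (\<lambda>z. c * f z) = (\<lambda>z. c * T f z)) \<and>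
    (\<exists>K. \<forall>f\<in>X. N (T f) \<le> K * N f)"

definition invertible_operator ::
  "('a \<Rightarrow> complex) set \<Rightarrow> (('a \<Rightarrow> complex) \<Rightarrow> real) \<Rightarrow> (('a \<Rightarrow> complex) \<Rightarrow> ('a \<Rightarrow> complex)) \<Rightarrow> bool"
  where "invertible_operator X N T \<longleftrightarrow>
    bounded_operator X N T \<and>
    (\<exists>S. bounded_operator X N S \<and> (\<forall>f\<in>X. S (T f) = f) \<and> (\<forall>f\<in>X. T (S f) = f))"

definition operator_spectrum ::
  "('a \<Rightarrow> complex) set \<Rightarrow> (('a \<Rightarrow> complex) \<Rightarrow> real) \<Rightarrow> (('a \<Rightarrow> complex) \<Rightarrow> ('a \<Rightarrow> complex)) \<Rightarrow> complex set"
  where "operator_spectrum X N T =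
    {c. \<not> invertible_operator X N (\<lambda>f z. T f z - c * f z)}"


section \<open>Spaces of analytic functions on the unit disk\<close>

definition bergman_weight :: "real \<Rightarrow> complex \<Rightarrow> real"
  where "bergman_weight \<alpha> z = (1 + \<alpha>) / pi * (1 - (norm z)\<^sup>2) powr \<alpha>"

text \<open>Functions on the disk are represented by functions on the whole plane that vanish off the
  disk, so that equality of representatives is equality on the disk.\<close>

definition bergman_space :: "real \<Rightarrow> (complex \<Rightarrow> complex) set"
  where "bergman_space \<alpha> =
    {f. f holomorphic_on ball 0 1 \<and>
        set_integrable lborel (ball 0 1) (\<lambda>z. (norm (f z))\<^sup>2 * bergman_weight \<alpha> z) \<and>
        (\<forall>z. z \<notin> ball 0 1 \<longrightarrow> f z = 0)}"

definition bergman_norm :: "real \<Rightarrow> (complex \<Rightarrow> complex) \<Rightarrow> real"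
  where "bergman_norm \<alpha> f =
    sqrt (set_lebesgue_integral lborel (ball 0 1) (\<lambda>z. (norm (f z))\<^sup>2 * bergman_weight \<alpha> z))"

text \<open>For the remaining spaces, only the values on the open disk matter.\<close>

definition H_infinity :: "(complex \<Rightarrow> complex) set"
  where "H_infinity = {f. f holomorphic_on ball 0 1 \<and> bounded (f ` ball 0 1)}"

definition disk_algebra :: "(complex \<Rightarrow> complex) set"
  where "disk_algebra =
    {f \<in> H_infinity. \<exists>g. continuous_on (cball 0 1) g \<and> (\<forall>z\<in>ball 0 1. g z = f z)}"

definition hardy_H2 :: "(complex \<Rightarrow> complex) set"
  where "hardy_H2 =
    {f. f holomorphic_on ball 0 1 \<and>
        bdd_above ((\<lambda>r. 1 / (2 * pi) * integral {0..2 * pi} (\<lambda>t. (norm (f (of_real r * cis t)))\<^sup>2))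
                    ` {0<..<1})}"


section \<open>Inner and outer functions\<close>

text \<open>By Fatou's theorem a function in \<open>H\<^sup>2\<close> has radial limits at almost every point of the circle;
  \<open>Lim\<close> takes an unspecified value at the other points.\<close>

definition radial_limit :: "(complex \<Rightarrow> complex) \<Rightarrow> real \<Rightarrow> complex"
  where "radial_limit f t = Lim (at_left 1) (\<lambda>r. f (of_real r * cis t))"

definition has_radial_limits :: "(complex \<Rightarrow> complex) \<Rightarrow> bool"
  where "has_radial_limits f \<longleftrightarrow>
    (AE t in lebesgue_on {0..2 * pi}.
       ((\<lambda>r. f (of_real r * cis t)) \<longlongrightarrow> radial_limit f t) (at_left 1))"

definition inner_function :: "(complex \<Rightarrow> complex) \<Rightarrow> bool"
  where "inner_function \<tau> \<longleftrightarrow>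
    \<tau> \<in> hardy_H2 \<and> has_radial_limits \<tau> \<and>
    (AE t in lebesgue_on {0..2 * pi}. norm (radial_limit \<tau> t) = 1)"

text \<open>Integrability of \<open>log |v|\<close> on the circle holds for every nonzero \<open>v\<close> in \<open>H\<^sup>2\<close>. It is stated
  because the integral of a non-integrable function is \<open>0\<close> by convention. The convention \<open>ln 0 = 0\<close>
  is harmless, as the radial limits of such a \<open>v\<close> vanish only on a null set.\<close>

definition outer_function :: "(complex \<Rightarrow> complex) \<Rightarrow> bool"
  where "outer_function v \<longleftrightarrow>
    v \<in> hardy_H2 \<and> has_radial_limits v \<and> v 0 \<noteq> 0 \<and>
    integrable (lebesgue_on {0..2 * pi}) (\<lambda>t. ln (norm (radial_limit v t))) \<and>
    1 / (2 * pi) * integral\<^sup>L (lebesgue_on {0..2 * pi}) (\<lambda>t. ln (norm (radial_limit v t)))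
      = ln (norm (v 0))"

text \<open>The outer part is unique only up to a constant of modulus one, hence a relation.\<close>

definition is_outer_part :: "(complex \<Rightarrow> complex) \<Rightarrow> (complex \<Rightarrow> complex) \<Rightarrow> bool"
  where "is_outer_part v \<psi> \<longleftrightarrow>
    outer_function v \<and> (\<exists>\<tau>. inner_function \<tau> \<and> (\<forall>z\<in>ball 0 1. \<psi> z = \<tau> z * v z))"


section \<open>Automorphisms and weighted composition operators\<close>

definition disk_automorphism :: "(complex \<Rightarrow> complex) \<Rightarrow> bool"
  where "disk_automorphism \<phi> \<longleftrightarrow>
    \<phi> holomorphic_on ball 0 1 \<and> bij_betw \<phi> (ball 0 1) (ball 0 1)"

definition elliptic_automorphism :: "(complex \<Rightarrow> complex) \<Rightarrow> bool"
  where "elliptic_automorphism \<phi> \<longleftrightarrow>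
    disk_automorphism \<phi> \<and> (\<exists>!a. a \<in> ball 0 1 \<and> \<phi> a = a)"

definition weighted_composition ::
  "(complex \<Rightarrow> complex) \<Rightarrow> (complex \<Rightarrow> complex) \<Rightarrow> (complex \<Rightarrow> complex) \<Rightarrow> (complex \<Rightarrow> complex)"
  where "weighted_composition \<psi> \<phi> f = (\<lambda>z. if z \<in> ball 0 1 then \<psi> z * f (\<phi> z) else 0)"

end

theory Submission
  imports Defs
begin

text \<open>Let \<open>s\<close> be the involutive automorphism of the disk that exchanges \<open>0\<close> and the fixed point
  \<open>a\<close>. By the Schwarz lemma \<open>s \<circ> \<phi> \<circ> s\<close> is the rotation \<open>z \<mapsto> l z\<close> with \<open>l = \<phi>'(a)\<close>, and
  composition with \<open>s\<close> is bounded on the Bergman space. So \<open>C\<^sub>\<psi>\<^sub>,\<^sub>\<phi>\<close> is similar to the operator \<open>T\<close>,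
  \<open>T f z = w z * f (l * z)\<close> with \<open>w = \<psi> \<circ> s\<close> (\<open>elliptic_normal_form\<close>, \<open>bergman_swap\<close>,
  \<open>spectrum_conjugate\<close>). The powers of \<open>T\<close> are \<open>T\<^sup>n f z = w\<^sub>n z * f (l\<^sup>n z)\<close>, where \<open>w\<^sub>n\<close> is the
  product of \<open>w\<close> along the first \<open>n\<close> points of the orbit.

  If \<open>l\<close> has order \<open>n\<close>, then \<open>T\<^sup>n\<close> is multiplication by \<open>w\<^sub>n\<close>. The polynomial
  \<open>Q = (T\<^sup>n - c\<^sup>n) / (T - c)\<close> in \<open>T\<close> plays two roles. If \<open>c\<^sup>n\<close> has positive distance from the range
  of \<open>w\<^sub>n\<close>, then \<open>Q\<close> divided by \<open>w\<^sub>n - c\<^sup>n\<close> inverts \<open>T - c\<close>; if \<open>c\<^sup>n = w\<^sub>n z\<close> for some \<open>z \<noteq> 0\<close>, then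
  \<open>f \<mapsto> Q f z\<close> is a combination of evaluations that kills the range of \<open>T - c\<close>
  (\<open>rational_spectrum\<close>).

  If \<open>l\<close> has infinite order, three facts determine the spectrum.

  \<^item> It is a union of circles about \<open>0\<close>: \<open>(T - l c) z = l z (T - c)\<close> as operators, and
    multiplication by \<open>z\<close> is bounded below with range of codimension one, which gives invariance
    under \<open>c \<mapsto> l c\<close> (\<open>spectrum_rotate\<close>); powers of \<open>l\<close> are dense in the circle and the spectrum is
    closed.

  \<^item> Its radius is \<open>\<bar>v a\<bar>\<close>. On the circle \<open>log \<bar>\<psi>\<bar>\<close> is approximated from above by real parts of
    holomorphic \<open>p\<close>, and \<open>\<bar>v\<bar> \<le> \<bar>exp p\<bar>\<close> in the disk with near equality at \<open>a\<close>
    (\<open>outer_part_le_majorant\<close>, \<open>majorant_limit\<close>). As \<open>p \<circ> s\<close> can be chosen to be a polynomial, its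
    averages along orbits of the rotation converge uniformly to \<open>p a\<close>, so \<open>w\<^sub>n\<close> grows like
    \<open>\<bar>v a\<bar>\<^sup>n\<close>.

  \<^item> It has no gaps. Suppose that a circle of radius \<open>\<rho>\<close> is disjoint from the spectrum. The Riesz
    projection for that circle commutes with multiplication by \<open>z\<close>, hence is multiplication by an
    idempotent holomorphic function: it is \<open>0\<close> or \<open>1\<close>. In place of contour integrals, the proof
    averages solutions of \<open>(T - c) u = g\<close> over \<open>c = \<rho> \<omega>\<^sup>j\<close>, with \<open>\<omega>\<close> a primitive root of unity of
    growing order, and determines the limit near \<open>0\<close>, where \<open>\<bar>w\<bar>\<close> stays close to \<open>\<bar>w 0\<bar>\<close>. If
    \<open>\<bar>w 0\<bar> < \<rho>\<close>, the powers of \<open>T\<close> are at most of order \<open>\<rho>\<^sup>n\<close>, so \<open>\<rho> \<ge> \<bar>v a\<bar>\<close>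
    (\<open>power_bound_of_small_diagonal\<close>). If \<open>\<rho> < \<bar>w 0\<bar>\<close>, then \<open>T\<close> is invertible, against the
    hypothesis (\<open>invertible_of_large_diagonal\<close>). And \<open>\<bar>w 0\<bar> = \<rho>\<close> is impossible, because \<open>w 0\<close> lies
    in the spectrum.\<close>

section \<open>Operators on spaces with bounded point evaluations\<close>

text \<open>The last assumption takes the place of completeness. It suits spaces of analytic functions,
  where it is Montel's theorem followed by Fatou's lemma, and it supplies limits together with
  their norm bounds.\<close>

locale evaluation_space =
  fixes X :: "('a \<Rightarrow> complex) set" and N :: "('a \<Rightarrow> complex) \<Rightarrow> real"
  assumes zero_mem: "(\<lambda>z. 0) \<in> X"
    and add_mem: "\<And>f g. f \<in> X \<Longrightarrow> g \<in> X \<Longrightarrow> (\<lambda>z. f z + g z) \<in> X"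
    and scale_mem: "\<And>f c. f \<in> X \<Longrightarrow> (\<lambda>z. c * f z) \<in> X"
    and norm_nonneg: "\<And>f. 0 \<le> N f"
    and norm_add: "\<And>f g. f \<in> X \<Longrightarrow> g \<in> X \<Longrightarrow> N (\<lambda>z. f z + g z) \<le> N f + N g"
    and norm_scale: "\<And>f c. f \<in> X \<Longrightarrow> N (\<lambda>z. c * f z) = norm c * N f"
    and evaluation: "\<And>z. \<exists>C. \<forall>f\<in>X. norm (f z) \<le> C * N f"
    and weakly_compact: "\<And>F B. (\<And>n::nat. F n \<in> X) \<Longrightarrow> (\<And>n. N (F n) \<le> B) \<Longrightarrow>
      \<exists>f\<in>X. \<exists>r. strict_mono r \<and> N f \<le> B \<and> (\<forall>z. (\<lambda>n. F (r n) z) \<longlonglongrightarrow> f z)"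
begin

lemma diff_mem: "f \<in> X \<Longrightarrow> g \<in> X \<Longrightarrow> (\<lambda>z. f z - g z) \<in> X"
  using add_mem[of f "\<lambda>z. -1 * g z"] scale_mem[of g "-1"] by simp

lemma norm_diff: "f \<in> X \<Longrightarrow> g \<in> X \<Longrightarrow> N (\<lambda>z. f z - g z) \<le> N f + N g"
  using norm_add[of f "\<lambda>z. -1 * g z"] scale_mem[of g "-1"] norm_scale[of g "-1"] by simp

lemma norm_zero: "N (\<lambda>z. 0) = 0"
  using norm_scale[OF zero_mem, of 0] by simp

lemma norm_eq_zero_imp: "f \<in> X \<Longrightarrow> N f = 0 \<Longrightarrow> f = (\<lambda>z. 0)"
proof
  fix z assume f: "f \<in> X" "N f = 0"
  obtain C where "\<forall>f\<in>X. norm (f z) \<le> C * N f" using evaluation by blast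
  with f show "f z = 0" by fastforce
qed

lemma sum_mem:
  assumes "\<And>i. i \<in> I \<Longrightarrow> F i \<in> X"
  shows "(\<lambda>z. \<Sum>i\<in>I. F i z) \<in> X"
  using assms by (induction I rule: infinite_finite_induct) (auto simp: zero_mem add_mem)

lemma norm_sum_le:
  assumes "\<And>i. i \<in> I \<Longrightarrow> F i \<in> X"
  shows "N (\<lambda>z. \<Sum>i\<in>I. F i z) \<le> (\<Sum>i\<in>I. N (F i))"
  using assms
proof (induction I rule: infinite_finite_induct)
  case (insert x A)
  have "N (\<lambda>z. \<Sum>i\<in>insert x A. F i z) = N (\<lambda>z. F x z + (\<Sum>i\<in>A. F i z))"
    using insert by simp
  also have "\<dots> \<le> N (F x) + N (\<lambda>z. \<Sum>i\<in>A. F i z)"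
    by (intro norm_add sum_mem) (use insert in auto)
  also have "\<dots> \<le> N (F x) + (\<Sum>i\<in>A. N (F i))" using insert by auto
  finally show ?case using insert by simp
qed (auto simp: norm_zero)

lemma pointwise_limit:
  assumes "\<And>n::nat. F n \<in> X" "\<And>n. N (F n) \<le> B" "\<And>z. (\<lambda>n. F n z) \<longlonglongrightarrow> f z"
  shows "f \<in> X \<and> N f \<le> B"
proof -
  obtain h r where h: "h \<in> X" "strict_mono r" "N h \<le> B" "\<forall>z. (\<lambda>n. F (r n) z) \<longlonglongrightarrow> h z"
    using weakly_compact[of F B] assms by blast
  have "h = f"
  proof
    fix z
    have "(\<lambda>n. F (r n) z) \<longlonglongrightarrow> f z"
      using LIMSEQ_subseq_LIMSEQ[OF assms(3) h(2)] by (simp add: o_def)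
    with h(4) show "h z = f z" using LIMSEQ_unique by blast
  qed
  with h show ?thesis by simp
qed

text \<open>Invertibility in quantitative form, for operators on the space: onto, and with inverse of
  norm at most \<open>K\<close>. This is stable under perturbation and needs no inverse operator to be named.\<close>

definition inverse_bound :: "(('a \<Rightarrow> complex) \<Rightarrow> ('a \<Rightarrow> complex)) \<Rightarrow> real \<Rightarrow> bool"
  where "inverse_bound T K \<longleftrightarrow>
    (\<forall>g\<in>X. \<exists>f\<in>X. T f = g) \<and> (\<forall>f\<in>X. N f \<le> K * N (T f))"

lemma inverse_boundI:
  "(\<And>g. g \<in> X \<Longrightarrow> \<exists>f\<in>X. T f = g) \<Longrightarrow> (\<And>f. f \<in> X \<Longrightarrow> N f \<le> K * N (T f)) \<Longrightarrow> inverse_bound T K"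
  by (simp add: inverse_bound_def)

lemma inverse_bound_surj: "inverse_bound T K \<Longrightarrow> g \<in> X \<Longrightarrow> \<exists>f\<in>X. T f = g"
  by (simp add: inverse_bound_def)

lemma inverse_bound_lower: "inverse_bound T K \<Longrightarrow> f \<in> X \<Longrightarrow> N f \<le> K * N (T f)"
  by (simp add: inverse_bound_def)

lemma inverse_bound_mono: "inverse_bound T K \<Longrightarrow> K \<le> L \<Longrightarrow> inverse_bound T L"
  unfolding inverse_bound_def by (meson mult_right_mono norm_nonneg order_trans)

lemma bounded_operatorD:
  assumes "bounded_operator X N T"
  shows "\<And>f. f \<in> X \<Longrightarrow> T f \<in> X"
    and "\<And>f g. f \<in> X \<Longrightarrow> g \<in> X \<Longrightarrow> T (\<lambda>z. f z + g z) = (\<lambda>z. T f z + T g z)"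
    and "\<And>f c. f \<in> X \<Longrightarrow> T (\<lambda>z. c * f z) = (\<lambda>z. c * T f z)"
    and "\<And>f g. f \<in> X \<Longrightarrow> g \<in> X \<Longrightarrow> T (\<lambda>z. f z - g z) = (\<lambda>z. T f z - T g z)"
    and "\<exists>K>0. \<forall>f\<in>X. N (T f) \<le> K * N f"
proof -
  show 1: "\<And>f. f \<in> X \<Longrightarrow> T f \<in> X"
    and 2: "\<And>f g. f \<in> X \<Longrightarrow> g \<in> X \<Longrightarrow> T (\<lambda>z. f z + g z) = (\<lambda>z. T f z + T g z)"
    and 3: "\<And>f c. f \<in> X \<Longrightarrow> T (\<lambda>z. c * f z) = (\<lambda>z. c * T f z)"
    using assms unfolding bounded_operator_def by blast+
  show "T (\<lambda>z. f z - g z) = (\<lambda>z. T f z - T g z)" if "f \<in> X" "g \<in> X" for f g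
    using 2[OF that(1) scale_mem[OF that(2), of "-1"]] 3[OF that(2), of "-1"] by simp
  obtain K where K: "\<forall>f\<in>X. N (T f) \<le> K * N f"
    using assms unfolding bounded_operator_def by blast
  have "N (T f) \<le> max K 1 * N f" if "f \<in> X" for f
    using K that norm_nonneg[of f] by (meson max.cobounded1 mult_right_mono order_trans)
  then show "\<exists>K>0. \<forall>f\<in>X. N (T f) \<le> K * N f"
    by (intro exI[of _ "max K 1"]) auto
qed

lemma bounded_operator_diff_scalar:
  assumes T: "bounded_operator X N T"
  shows "bounded_operator X N (\<lambda>f z. T f z - c * f z)"
proof -
  note D = bounded_operatorD[OF T]
  obtain K where K: "\<forall>f\<in>X. N (T f) \<le> K * N f" using D(5) by blast
  have "N (\<lambda>z. T f z - c * f z) \<le> (K + norm c) * N f" if "f \<in> X" for f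
  proof -
    have "N (\<lambda>z. T f z - c * f z) \<le> N (T f) + N (\<lambda>z. c * f z)"
      by (intro norm_diff scale_mem D that)
    also have "\<dots> \<le> K * N f + norm c * N f" using K that norm_scale by auto
    finally show ?thesis by (simp add: algebra_simps)
  qed
  then show ?thesis unfolding bounded_operator_def
    by (intro conjI ballI allI exI[of _ "K + norm c"]) (auto simp: D diff_mem scale_mem algebra_simps)
qed

text \<open>An operator that is onto and bounded below is injective, and its inverse inherits
  linearity.\<close>

lemma invertible_iff_inverse_bound:
  "invertible_operator X N T \<longleftrightarrow> bounded_operator X N T \<and> (\<exists>K>0. inverse_bound T K)"
proof
  assume "invertible_operator X N T"
  then obtain S where T: "bounded_operator X N T" and S: "bounded_operator X N S"
    and ST: "\<forall>f\<in>X. S (T f) = f" and TS: "\<forall>f\<in>X. T (S f) = f"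
    unfolding invertible_operator_def by blast
  obtain K where K: "K > 0" "\<forall>f\<in>X. N (S f) \<le> K * N f" using bounded_operatorD(5)[OF S] by blast
  have "inverse_bound T K"
    unfolding inverse_bound_def
    using K ST TS bounded_operatorD(1)[OF T] bounded_operatorD(1)[OF S] by metis
  with T K show "bounded_operator X N T \<and> (\<exists>K>0. inverse_bound T K)" by blast
next
  assume "bounded_operator X N T \<and> (\<exists>K>0. inverse_bound T K)"
  then obtain K where T: "bounded_operator X N T" and K: "inverse_bound T K" by blast
  note D = bounded_operatorD[OF T]
  have inj: "f = g" if "f \<in> X" "g \<in> X" "T f = T g" for f g
  proof -
    have "N (\<lambda>z. f z - g z) \<le> K * N (T (\<lambda>z. f z - g z))"
      using K diff_mem that unfolding inverse_bound_def by blast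
    also have "\<dots> = 0" using D(4) that norm_zero by simp
    finally have "(\<lambda>z. f z - g z) = (\<lambda>z. 0)"
      using norm_eq_zero_imp[OF diff_mem[OF that(1,2)]] norm_nonneg[of "\<lambda>z. f z - g z"] by simp
    then show ?thesis by (metis eq_iff_diff_eq_0 ext)
  qed
  define S where "S g = (SOME f. f \<in> X \<and> T f = g)" for g
  have S: "S g \<in> X" "T (S g) = g" if "g \<in> X" for g
    using someI_ex[of "\<lambda>f. f \<in> X \<and> T f = g"] K that unfolding inverse_bound_def S_def by blast+
  have eqS: "S g = f" if "f \<in> X" "T f = g" for f g
    using inj S D(1) that by metis
  have "bounded_operator X N S"
    unfolding bounded_operator_def
  proof (intro conjI ballI allI exI[of _ K])
    fix f g assume "f \<in> X" "g \<in> X"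
    then show "S (\<lambda>z. f z + g z) = (\<lambda>z. S f z + S g z)"
      by (intro eqS) (auto simp: add_mem S D)
  next
    fix f c assume "f \<in> X"
    then show "S (\<lambda>z. c * f z) = (\<lambda>z. c * S f z)"
      by (intro eqS) (auto simp: scale_mem S D)
  next
    fix f assume "f \<in> X"
    then show "S f \<in> X" "N (S f) \<le> K * N f"
      using S K unfolding inverse_bound_def by metis+
  qed
  then show "invertible_operator X N T"
    unfolding invertible_operator_def using T S eqS by blast
qed

lemma spectrum_iff:
  assumes "bounded_operator X N T"
  shows "c \<notin> operator_spectrum X N T \<longleftrightarrow> (\<exists>K>0. inverse_bound (\<lambda>f z. T f z - c * f z) K)"
  unfolding operator_spectrum_def
  using invertible_iff_inverse_bound bounded_operator_diff_scalar[OF assms] by simp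

lemma funpow_mem:
  assumes "bounded_operator X N A" "f \<in> X"
  shows "(A ^^ n) f \<in> X"
  by (induction n) (use bounded_operatorD(1)[OF assms(1)] assms(2) in auto)

lemma funpow_diff:
  assumes A: "bounded_operator X N A" and f: "f \<in> X" "g \<in> X"
  shows "(A ^^ n) (\<lambda>z. f z - g z) = (\<lambda>z. (A ^^ n) f z - (A ^^ n) g z)"
  by (induction n) (auto simp: bounded_operatorD(4)[OF A] funpow_mem[OF A] f)

lemma operator_sum:
  assumes A: "bounded_operator X N A" and F: "\<And>i. i \<in> I \<Longrightarrow> F i \<in> X"
  shows "A (\<lambda>z. \<Sum>i\<in>I. F i z) = (\<lambda>z. \<Sum>i\<in>I. A (F i) z)"
proof -
  have 0: "A (\<lambda>z. 0) = (\<lambda>z. 0)"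
    using bounded_operatorD(3)[OF A zero_mem, of 0] by simp
  show ?thesis using F
  proof (induction I rule: infinite_finite_induct)
    case (insert x B)
    then have "A (\<lambda>z. F x z + (\<Sum>i\<in>B. F i z)) = (\<lambda>z. A (F x) z + A (\<lambda>z. \<Sum>i\<in>B. F i z) z)"
      by (intro bounded_operatorD(2)[OF A]) (auto intro: sum_mem)
    with insert show ?case by simp
  qed (auto simp: 0)
qed

text \<open>The hypothesis bounds powers, not the norm of \<open>A\<close>, because it is applied to operators whose
  spectral radius is smaller than their norm. Weak compactness gives a pointwise limit of the
  partial sums; since it also bounds the norm of the limit of the tails, the convergence is in
  norm.\<close>

lemma neumann:
  assumes A: "bounded_operator X N A" and q: "0 \<le> q" "q < 1" and C: "0 \<le> C"
    and bd: "\<And>n f. f \<in> X \<Longrightarrow> N ((A ^^ n) f) \<le> C * q ^ n * N f"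
  shows "inverse_bound (\<lambda>f z. f z - A f z) (C / (1 - q))"
proof -
  note D = bounded_operatorD[OF A]
  have geo: "(\<Sum>i=m..<n. C * q ^ i * b) \<le> C / (1 - q) * q ^ m * b" if "0 \<le> b" for m n b
  proof (cases "m \<le> n")
    case True
    have "(\<Sum>i=m..<n. q ^ i) = (q ^ m - q ^ n) / (1 - q)"
    proof -
      have "(\<Sum>i=m..<n. q ^ i) = (\<Sum>i<n. q ^ i) - (\<Sum>i<m. q ^ i)"
        using sum_diff_nat_ivl[of 0 m n "\<lambda>i. q ^ i"] True by (simp add: lessThan_atLeast0)
      also have "\<dots> = (q ^ m - q ^ n) / (1 - q)"
        using q unfolding sum_gp_strict by (simp add: diff_divide_distrib)
      finally show ?thesis .
    qed
    also have "\<dots> \<le> q ^ m / (1 - q)" using q by (intro divide_right_mono) auto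
    finally have "(\<Sum>i=m..<n. q ^ i) * (C * b) \<le> q ^ m / (1 - q) * (C * b)"
      using that C by (intro mult_right_mono) auto
    then show ?thesis by (simp add: sum_distrib_left sum_distrib_right mult_ac)
  qed (use C q that in auto)
  have surj: "\<exists>f\<in>X. (\<lambda>z. f z - A f z) = g" if g: "g \<in> X" for g
  proof -
    define F where "F n = (\<lambda>z. \<Sum>i<n. (A ^^ i) g z)" for n
    have FX: "F n \<in> X" for n unfolding F_def by (intro sum_mem funpow_mem A g)
    have FF: "N (\<lambda>z. F n z - F m z) \<le> C / (1 - q) * q ^ m * N g" if "m \<le> n" for m n
    proof -
      have "(\<lambda>z. F n z - F m z) = (\<lambda>z. \<Sum>i=m..<n. (A ^^ i) g z)"
        unfolding F_def lessThan_atLeast0 using that by (simp add: sum_diff_nat_ivl)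
      then have "N (\<lambda>z. F n z - F m z) \<le> (\<Sum>i=m..<n. N ((A ^^ i) g))"
        using norm_sum_le[of "{m..<n}" "\<lambda>i. (A ^^ i) g"] funpow_mem[OF A g] by simp
      also have "\<dots> \<le> (\<Sum>i=m..<n. C * q ^ i * N g)" by (intro sum_mono bd g)
      also have "\<dots> \<le> C / (1 - q) * q ^ m * N g" by (intro geo norm_nonneg)
      finally show ?thesis .
    qed
    have "N (F n) \<le> C / (1 - q) * N g" for n
      using FF[of 0 n] by (simp add: F_def)
    then obtain f r where f: "f \<in> X" "strict_mono r" "\<forall>z. (\<lambda>n. F (r n) z) \<longlonglongrightarrow> f z"
      using weakly_compact[of F] FX by blast
    \<comment> \<open>The differences along the subsequence converge pointwise to the tail and inherit its
      bound.\<close>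
    have tail: "(\<lambda>z. f z - F m z) \<in> X \<and> N (\<lambda>z. f z - F m z) \<le> C / (1 - q) * q ^ m * N g" for m
    proof (rule pointwise_limit[where F = "\<lambda>n z. F (r (n + m)) z - F m z"])
      fix n
      show "(\<lambda>z. F (r (n + m)) z - F m z) \<in> X" by (intro diff_mem FX)
      have "m \<le> r (n + m)" using seq_suble[OF f(2), of "n + m"] by simp
      then show "N (\<lambda>z. F (r (n + m)) z - F m z) \<le> C / (1 - q) * q ^ m * N g" by (rule FF)
    next
      fix z
      show "(\<lambda>n. F (r (n + m)) z - F m z) \<longlonglongrightarrow> f z - F m z"
        by (intro tendsto_diff LIMSEQ_ignore_initial_segment[where f = "\<lambda>n. F (r n) z"]) (use f in auto)
    qed
    have AF: "A (F m) = (\<lambda>z. F (Suc m) z - g z)" for m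
    proof -
      have "A (F m) = (\<lambda>z. \<Sum>i<m. A ((A ^^ i) g) z)"
        unfolding F_def by (intro operator_sum A funpow_mem g)
      moreover have "F (Suc m) = (\<lambda>z. g z + (\<Sum>i<m. A ((A ^^ i) g) z))"
        unfolding F_def sum.lessThan_Suc_shift by simp
      ultimately show ?thesis by simp
    qed
    obtain K where K: "K > 0" "\<forall>f\<in>X. N (A f) \<le> K * N f" using D(5) by blast
    let ?h = "\<lambda>z. f z - A f z - g z"
    have hX: "?h \<in> X" by (intro diff_mem D f g)
    have small: "N ?h \<le> C / (1 - q) * N g * q ^ Suc m + K * (C / (1 - q) * N g) * q ^ m" for m
    proof -
      have "?h = (\<lambda>z. (f z - F (Suc m) z) - A (\<lambda>z. f z - F m z) z)"
        using D(4)[OF f(1) FX, of m] AF[of m] by (simp add: algebra_simps)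
      then have "N ?h \<le> N (\<lambda>z. f z - F (Suc m) z) + N (A (\<lambda>z. f z - F m z))"
        using norm_diff[OF conjunct1[OF tail[of "Suc m"]] D(1)[OF conjunct1[OF tail[of m]]]] by simp
      also have "\<dots> \<le> C / (1 - q) * q ^ Suc m * N g + K * (C / (1 - q) * q ^ m * N g)"
      proof (intro add_mono)
        have "N (A (\<lambda>z. f z - F m z)) \<le> K * N (\<lambda>z. f z - F m z)" using K(2) tail by blast
        also have "\<dots> \<le> K * (C / (1 - q) * q ^ m * N g)"
          using tail[of m] K(1) by (intro mult_left_mono) auto
        finally show "N (A (\<lambda>z. f z - F m z)) \<le> K * (C / (1 - q) * q ^ m * N g)" .
      qed (use tail[of "Suc m"] in auto)
      finally show ?thesis by (simp add: mult_ac)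
    qed
    have "(\<lambda>m. C / (1 - q) * N g * q ^ Suc m + K * (C / (1 - q) * N g) * q ^ m) \<longlonglongrightarrow> 
        C / (1 - q) * N g * 0 + K * (C / (1 - q) * N g) * 0"
      using LIMSEQ_realpow_zero[OF q]
      by (intro tendsto_add tendsto_mult_left LIMSEQ_Suc)
    then have "N ?h \<le> 0" using small by (intro LIMSEQ_le_const[of _ 0]) auto
    then have "?h = (\<lambda>z. 0)" using norm_eq_zero_imp[OF hX] norm_nonneg[of ?h] by linarith
    then have "(\<lambda>z. f z - A f z) = g" by (metis eq_iff_diff_eq_0 ext)
    with f show ?thesis by blast
  qed
  moreover have "N f \<le> C / (1 - q) * N (\<lambda>z. f z - A f z)" if f: "f \<in> X" for f
  proof -
    let ?h = "\<lambda>z. f z - A f z"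
    have h: "?h \<in> X" by (intro diff_mem D f)
    have "N f \<le> C / (1 - q) * N ?h + C * q ^ n * N f" for n
    proof -
      have "(A ^^ i) ?h = (\<lambda>z. (A ^^ i) f z - (A ^^ Suc i) f z)" for i
        using funpow_diff[OF A f D(1)[OF f], of i] by (simp add: funpow_swap1)
      then have "f = (\<lambda>z. (\<Sum>i<n. (A ^^ i) ?h z) + (A ^^ n) f z)"
        using sum_lessThan_telescope'[of "\<lambda>i. (A ^^ i) f _" n] by simp
      then have "N f \<le> N (\<lambda>z. \<Sum>i<n. (A ^^ i) ?h z) + N ((A ^^ n) f)"
        using norm_add[OF sum_mem[of "{..<n}" "\<lambda>i. (A ^^ i) ?h"] funpow_mem[OF A f, of n]]
          funpow_mem[OF A h] by metis
      also have "N (\<lambda>z. \<Sum>i<n. (A ^^ i) ?h z) \<le> (\<Sum>i<n. N ((A ^^ i) ?h))"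
        by (intro norm_sum_le funpow_mem A h)
      also have "\<dots> \<le> (\<Sum>i<n. C * q ^ i * N ?h)" by (intro sum_mono bd h)
      also have "\<dots> \<le> C / (1 - q) * N ?h"
        using geo[of "N ?h" 0 n] norm_nonneg by (simp add: lessThan_atLeast0)
      finally show ?thesis using bd[OF f, of n] by simp
    qed
    moreover have "(\<lambda>n. C / (1 - q) * N ?h + C * q ^ n * N f) \<longlonglongrightarrow> C / (1 - q) * N ?h + C * 0 * N f"
      by (intro tendsto_intros LIMSEQ_realpow_zero q)
    ultimately show ?thesis by (intro LIMSEQ_le_const[where X = "\<lambda>n. C /
        (1 - q) * N ?h + C * q ^ n * N f"]) auto
  qed
  ultimately show ?thesis by (intro inverse_boundI)
qed

text \<open>If \<open>S\<close> inverts \<open>T - c\<close>, then \<open>T - d = (T - c) (1 - (d - c) S)\<close>, and the second factor is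
  inverted by its Neumann series.\<close>

lemma resolvent_perturbation:
  assumes T: "bounded_operator X N T" and K: "K > 0" "inverse_bound (\<lambda>f z. T f z - c * f z) K"
    and d: "norm (d - c) * K \<le> 1 / 2"
  shows "inverse_bound (\<lambda>f z. T f z - d * f z) (2 * K)"
proof -
  note D = bounded_operatorD[OF T]
  have lower: "N f \<le> 2 * K * N (\<lambda>z. T f z - d * f z)" if f: "f \<in> X" for f
  proof -
    let ?g = "\<lambda>z. T f z - d * f z"
    have "N f \<le> K * N (\<lambda>z. T f z - c * f z)" using inverse_bound_lower[OF K(2) f] .
    also have "(\<lambda>z. T f z - c * f z) = (\<lambda>z. ?g z + (d - c) * f z)" by (simp add: algebra_simps)
    also have "N \<dots> \<le> N ?g + N (\<lambda>z. (d - c) * f z)"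
      by (intro norm_add scale_mem diff_mem D f)
    also have "\<dots> = N ?g + norm (d - c) * N f" by (simp add: norm_scale f)
    finally have "N f \<le> K * N ?g + norm (d - c) * K * N f" using K(1) by (simp add: algebra_simps)
    also have "\<dots> \<le> K * N ?g + 1 / 2 * N f" using d norm_nonneg by (intro add_left_mono mult_right_mono)
    finally show ?thesis by simp
  qed
  have "invertible_operator X N (\<lambda>f z. T f z - c * f z)"
    using invertible_iff_inverse_bound bounded_operator_diff_scalar[OF T] K by blast
  then obtain S where S: "bounded_operator X N S"
    and TS: "\<forall>f\<in>X. (\<lambda>z. T (S f) z - c * S f z) = f" unfolding invertible_operator_def by blast
  have SK: "N (S f) \<le> K * N f" if "f \<in> X" for f
    using K(2) TS bounded_operatorD(1)[OF S] that unfolding inverse_bound_def by metis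
  define A where "A f = (\<lambda>z. (d - c) * S f z)" for f
  have AK: "N (A f) \<le> 1 / 2 * N f" if "f \<in> X" for f
  proof -
    have "N (A f) = norm (d - c) * N (S f)" unfolding A_def by
        (simp add: norm_scale bounded_operatorD(1)[OF S] that)
    also have "\<dots> \<le> norm (d - c) * (K * N f)" by (intro mult_left_mono SK that) auto
    also have "\<dots> \<le> 1 / 2 * N f" using mult_right_mono[OF d norm_nonneg[of f]] by (simp add: mult_ac)
    finally show ?thesis .
  qed
  have A: "bounded_operator X N A"
    unfolding bounded_operator_def
  proof (intro conjI ballI allI exI[of _ "1 / 2"])
    show "A f \<in> X" if "f \<in> X" for f
      unfolding A_def by (intro scale_mem bounded_operatorD(1)[OF S] that)
    show "N (A f) \<le> 1 / 2 * N f" if "f \<in> X" for f by (rule AK[OF that])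
  qed (auto simp: A_def bounded_operatorD[OF S] algebra_simps)
  have pow: "N ((A ^^ n) f) \<le> 1 * (1 / 2) ^ n * N f" if "f \<in> X" for n f
  proof (induction n)
    case (Suc n)
    have "N ((A ^^ Suc n) f) \<le> 1 / 2 * N ((A ^^ n) f)" using AK funpow_mem[OF A that] by simp
    with Suc show ?case by simp
  qed auto
  have IA: "inverse_bound (\<lambda>f z. f z - A f z) (1 / (1 - 1 / 2))"
  proof (rule neumann[OF A])
    show "N ((A ^^ n) f) \<le> 1 * (1 / 2) ^ n * N f" if "f \<in> X" for n f by (rule pow[OF that])
  qed simp_all
  have "\<exists>f\<in>X. (\<lambda>z. T f z - d * f z) = g" if g: "g \<in> X" for g
  proof -
    obtain h where h: "h \<in> X" "(\<lambda>z. h z - A h z) = g"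
      using inverse_bound_surj[OF IA g] by blast
    have "T (S h) z - d * S h z = g z" for z
      using fun_cong[OF bspec[OF TS h(1)], of z] fun_cong[OF h(2), of z]
      by (simp add: A_def algebra_simps)
    then show ?thesis using bounded_operatorD(1)[OF S h(1)] by blast
  qed
  with lower show ?thesis by (intro inverse_boundI)
qed

lemma spectrum_closed:
  assumes T: "bounded_operator X N T"
  shows "closed (operator_spectrum X N T)"
proof -
  have "open (- operator_spectrum X N T)"
    unfolding open_dist
  proof
    fix c assume "c \<in> - operator_spectrum X N T"
    then obtain K where K: "K > 0" "inverse_bound (\<lambda>f z. T f z - c * f z) K"
      using spectrum_iff[OF T] by auto
    have "d \<in> - operator_spectrum X N T" if "dist d c < 1 / (2 * K)" for d
    proof -
      have "norm (d - c) * K \<le> 1 / 2" using that K(1) by (simp add: dist_norm field_simps)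
      then have "inverse_bound (\<lambda>f z. T f z - d * f z) (2 * K)"
        by (rule resolvent_perturbation[OF T K])
      then show ?thesis using spectrum_iff[OF T, of d] K(1) by
          (metis ComplI mult_pos_pos zero_less_numeral)
    qed
    then show "\<exists>e>0. \<forall>d. dist d c < e \<longrightarrow> d \<in> - operator_spectrum X N T"
      using K(1) by (intro exI[of _ "1 / (2 * K)"]) auto
  qed
  then show ?thesis by (simp add: closed_def)
qed

text \<open>By \<open>resolvent_perturbation\<close> a bound at one point serves, doubled, on a ball around it;
  finitely many such balls cover the compact set.\<close>

lemma uniform_resolvent_bound:
  assumes T: "bounded_operator X N T" and Q: "compact Q" "Q \<inter> operator_spectrum X N T = {}"
  shows "\<exists>K>0. \<forall>c\<in>Q. inverse_bound (\<lambda>f z. T f z - c * f z) K"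
proof -
  have "\<exists>K>0. inverse_bound (\<lambda>f z. T f z - c * f z) K" if "c \<in> Q" for c
  proof -
    have "c \<notin> operator_spectrum X N T" using that Q(2) by blast
    then show ?thesis by (simp only: spectrum_iff[OF T] not_False_eq_True)
  qed
  then obtain K where K: "\<And>c. c \<in> Q \<Longrightarrow> K c > 0" "\<And>c. c \<in> Q \<Longrightarrow> inverse_bound (\<lambda>f z. T f z - c * f z) (K c)"
    by metis
  obtain D where D: "D \<subseteq> Q" "finite D" "Q \<subseteq> (\<Union>c\<in>D. ball c (1 / (2 * K c)))"
  proof (rule compactE_image[OF Q(1), of Q "\<lambda>c. ball c (1 / (2 * K c))"])
    show "Q \<subseteq> (\<Union>c\<in>Q. ball c (1 / (2 * K c)))"
    proof
      fix c assume "c \<in> Q"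
      then show "c \<in> (\<Union>c\<in>Q. ball c (1 / (2 * K c)))"
        using K(1)[of c] by (intro UN_I[of c]) auto
    qed
  qed auto
  define L where "L = 1 + (\<Sum>c\<in>D. 2 * K c)"
  have nonneg: "0 \<le> (\<Sum>c\<in>D. 2 * K c)" using K(1) D(1) by (intro sum_nonneg)
      (auto simp: less_imp_le subset_iff)
  have "inverse_bound (\<lambda>f z. T f z - d * f z) L" if "d \<in> Q" for d
  proof -
    have "d \<in> (\<Union>c\<in>D. ball c (1 / (2 * K c)))" using D(3) that by blast
    then obtain c where c: "c \<in> D" "dist c d < 1 / (2 * K c)" by (elim UN_E) (simp add: mem_ball)
    then have cQ: "c \<in> Q" using D(1) by auto
    have "norm (d - c) * K c \<le> 1 / 2"
      using c(2) K(1)[OF cQ] by (simp add: dist_norm norm_minus_commute field_simps)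
    then have "inverse_bound (\<lambda>f z. T f z - d * f z) (2 * K c)"
      by (rule resolvent_perturbation[OF T K(1)[OF cQ] K(2)[OF cQ]])
    moreover have "2 * K c \<le> L"
      unfolding L_def using member_le_sum[OF c(1), of "\<lambda>c. 2 * K c"] K(1) D
      by (smt (verit) DiffE subsetD)
    ultimately show ?thesis by (rule inverse_bound_mono)
  qed
  then show ?thesis using nonneg by (intro exI[of _ L]) (auto simp: L_def)
qed

end


section \<open>Holomorphic change of variables in the plane\<close>

definition plane_to_complex :: "real ^ 2 \<Rightarrow> complex"
  where "plane_to_complex x = Complex (x $ 1) (x $ 2)"

definition complex_to_plane :: "complex \<Rightarrow> real ^ 2"
  where "complex_to_plane z = vector [Re z, Im z]"

lemma plane_inverse [simp]:
  "plane_to_complex (complex_to_plane z) = z" "complex_to_plane (plane_to_complex x) = x"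
  by (simp_all add: plane_to_complex_def complex_to_plane_def vec_eq_iff forall_2)

lemma bounded_linear_plane_to_complex: "bounded_linear plane_to_complex"
  unfolding linear_conv_bounded_linear[symmetric]
  by (rule linearI) (simp_all add: plane_to_complex_def complex_eq_iff)

lemma bounded_linear_complex_to_plane: "bounded_linear complex_to_plane"
  unfolding linear_conv_bounded_linear[symmetric]
  by (rule linearI) (simp_all add: complex_to_plane_def vec_eq_iff forall_2)

lemma borel_measurable_plane_to_complex [measurable]: "plane_to_complex \<in> borel_measurable borel"
  by (intro borel_measurable_continuous_onI linear_continuous_on bounded_linear_plane_to_complex)

lemma Basis_plane: "(Basis :: (real ^ 2) set) = {axis 1 1, axis 2 1}"
  by (auto simp: Basis_vec_def UNIV_2)

text \<open>The change of variables theorem concerns maps of \<open>\<real>\<^sup>n\<close>; this transports it to the complex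
  plane.\<close>

lemma lborel_plane: "lborel = distr lborel borel plane_to_complex"
proof (rule lborel_eqI)
  fix l u :: complex assume lu: "\<And>b. b \<in> Basis \<Longrightarrow> l \<bullet> b \<le> u \<bullet> b"
  have ne: "axis 1 (1::real) \<noteq> (axis 2 1 :: real ^ 2)" by (simp add: axis_eq_axis)
  have "plane_to_complex -` box l u = box (complex_to_plane l) (complex_to_plane u)"
    by (auto simp: box_def Basis_plane Basis_complex_def inner_axis plane_to_complex_def
        complex_to_plane_def inner_complex_def)
  moreover have "complex_to_plane l \<bullet> b \<le> complex_to_plane u \<bullet> b" if "b \<in> Basis" for b
    using that lu[of 1] lu[of \<i>] by (auto simp: Basis_plane complex_to_plane_def inner_axis
        Basis_complex_def)
  ultimately have "emeasure (distr lborel borel plane_to_complex) (box l u)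
      = (\<Prod>b\<in>Basis. (complex_to_plane u - complex_to_plane l) \<bullet> b)"
    by (subst emeasure_distr) auto
  also have "\<dots> = (\<Prod>b\<in>Basis. (u - l) \<bullet> b)"
    using ne by (simp add: Basis_plane Basis_complex_def complex_to_plane_def inner_axis)
  finally show "emeasure (distr lborel borel plane_to_complex) (box l u) = (\<Prod>b\<in>Basis. (u - l) \<bullet> b)" .
qed simp

lemma set_integral_plane:
  fixes f :: "complex \<Rightarrow> real"
  assumes A: "A \<in> sets borel" and f: "continuous_on A f"
  shows "set_integrable lborel A f \<longleftrightarrow> (\<lambda>x. f (plane_to_complex x)) absolutely_integrable_on
      (plane_to_complex -` A)"
    and "set_lebesgue_integral lborel A f = set_lebesgue_integral lebesgue (plane_to_complex -` A)
        (\<lambda>x. f (plane_to_complex x))"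
proof -
  let ?F = "\<lambda>z. indicat_real A z *\<^sub>R f z"
  have F: "?F \<in> borel_measurable borel" by (rule borel_measurable_continuous_on_indicator[OF A f])
  then have F': "(\<lambda>x. ?F (plane_to_complex x)) \<in> borel_measurable lborel" by simp
  have eq: "?F (plane_to_complex x) = indicat_real (plane_to_complex -` A) x *\<^sub>R f (plane_to_complex x)"
      for x
    by (simp add: indicator_def)
  have "integrable lborel ?F \<longleftrightarrow> integrable lborel (\<lambda>x. ?F (plane_to_complex x))"
    by (subst lborel_plane) (rule integrable_distr_eq, use F in auto)
  then show "set_integrable lborel A f \<longleftrightarrow> (\<lambda>x. f (plane_to_complex x)) absolutely_integrable_on
      (plane_to_complex -` A)"
    unfolding set_integrable_def eq[symmetric] integrable_completion[OF F'] .
  have "integral\<^sup>L lborel ?F = integral\<^sup>L lborel (\<lambda>x. ?F (plane_to_complex x))"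
    by (subst lborel_plane) (rule integral_distr, use F in auto)
  then show "set_lebesgue_integral lborel A f = set_lebesgue_integral lebesgue (plane_to_complex -` A)
      (\<lambda>x. f (plane_to_complex x))"
    unfolding set_lebesgue_integral_def eq[symmetric] integral_completion[OF F'] .
qed

text \<open>The real Jacobian determinant of a holomorphic map is the squared modulus of its
  derivative.\<close>

lemma holomorphic_change_of_variables:
  fixes f :: "complex \<Rightarrow> real"
  assumes S: "open S" and \<sigma>: "\<And>z. z \<in> S \<Longrightarrow> (\<sigma> has_field_derivative \<sigma>' z) (at z)" "inj_on \<sigma> S"
    and \<sigma>'c: "continuous_on S \<sigma>'" and f: "continuous_on (\<sigma> ` S) f" and \<sigma>S: "\<sigma> ` S \<in> sets borel"
  shows "set_integrable lborel S (\<lambda>z. (norm (\<sigma>' z))\<^sup>2 * f (\<sigma> z)) \<longleftrightarrow> set_integrable lborel (\<sigma> ` S) f"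
    and "set_lebesgue_integral lborel S (\<lambda>z. (norm (\<sigma>' z))\<^sup>2 * f (\<sigma> z)) = set_lebesgue_integral lborel
        (\<sigma> ` S) f"
proof -
  let ?\<iota> = plane_to_complex and ?\<kappa> = complex_to_plane
  define g where "g = (\<lambda>x. ?\<kappa> (\<sigma> (?\<iota> x)))"
  define g' where "g' = (\<lambda>x h. ?\<kappa> (\<sigma>' (?\<iota> x) * ?\<iota> h))"
  define T where "T = ?\<iota> -` S"
  define F where "F = (\<lambda>x. vec (f (?\<iota> x)) :: real ^ 1)"
  have \<sigma>c: "continuous_on S \<sigma>"
    using \<sigma>(1) by (meson DERIV_isCont continuous_at_imp_continuous_on)
  have det: "\<bar>det (matrix (g' x))\<bar> = (norm (\<sigma>' (?\<iota> x)))\<^sup>2" for x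
  proof -
    have "det (matrix (g' x)) = (norm (\<sigma>' (?\<iota> x)))\<^sup>2"
      by (simp add: det_2 matrix_def g'_def axis_def plane_to_complex_def complex_to_plane_def
          cmod_power2)
        (simp add: power2_eq_square)
    then show ?thesis by simp
  qed
  have "open T" unfolding T_def
    by (intro open_vimage S linear_continuous_on bounded_linear_plane_to_complex)
  then have Tsets: "T \<in> sets lebesgue" by auto
  have gder: "(g has_derivative g' x) (at x within T)" if "x \<in> T" for x
  proof -
    have 1: "(?\<iota> has_derivative ?\<iota>) (at x within T)"
      by (rule bounded_linear_imp_has_derivative[OF bounded_linear_plane_to_complex])
    have "(\<sigma> has_derivative (*) (\<sigma>' (?\<iota> x))) (at (?\<iota> x))"
      using \<sigma>(1)[of "?\<iota> x"] that unfolding T_def has_field_derivative_def by simp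
    from has_derivative_compose[OF 1 this]
    have "((\<lambda>x. \<sigma> (?\<iota> x)) has_derivative (\<lambda>h. \<sigma>' (?\<iota> x) * ?\<iota> h)) (at x within T)" .
    from bounded_linear.has_derivative[OF bounded_linear_complex_to_plane this]
    show ?thesis unfolding g_def g'_def .
  qed
  have ginj: "inj_on g T"
    using \<sigma>(2) unfolding g_def T_def inj_on_def by (metis plane_inverse vimage_eq)
  have gT: "g ` T = ?\<iota> -` (\<sigma> ` S)"
  proof (intro equalityI subsetI)
    fix x assume "x \<in> ?\<iota> -` (\<sigma> ` S)"
    then obtain z where "z \<in> S" "?\<iota> x = \<sigma> z" by auto
    then have "x = ?\<kappa> (\<sigma> z)" using plane_inverse(2)[of x] by simp
    then have "x = g (?\<kappa> z)" by (simp add: g_def)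
    moreover have "?\<kappa> z \<in> T" using \<open>z \<in> S\<close> by (simp add: T_def)
    ultimately show "x \<in> g ` T" by blast
  qed (auto simp: g_def T_def)
  have Fc: "F x $ 1 = f (?\<iota> x)" for x by (simp add: F_def)
  have fg: "f (?\<iota> (g x)) = f (\<sigma> (?\<iota> x))" for x by (simp add: g_def)
  have key: "((\<lambda>x. (norm (\<sigma>' (?\<iota> x)))\<^sup>2 * f (\<sigma> (?\<iota> x))) absolutely_integrable_on T \<and>
       integral T (\<lambda>x. (norm (\<sigma>' (?\<iota> x)))\<^sup>2 * f (\<sigma> (?\<iota> x))) = b) \<longleftrightarrow>
     ((\<lambda>x. f (?\<iota> x)) absolutely_integrable_on (g ` T) \<and> integral (g ` T) (\<lambda>x. f (?\<iota> x)) = b)" for b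
    using has_absolute_integral_change_of_variables[OF Tsets gder ginj, of F "vec b"]
    by (simp add: absolutely_integrable_on_1_iff integral_on_1_eq Fc fg det vec_eq_iff)
  have c1: "continuous_on S (\<lambda>z. (norm (\<sigma>' z))\<^sup>2 * f (\<sigma> z))"
    by (intro continuous_intros \<sigma>'c continuous_on_compose2[OF f \<sigma>c]) auto
  have Sb: "S \<in> sets borel" using S by simp
  note P1 = set_integral_plane[OF Sb c1, folded T_def]
  note P2 = set_integral_plane[OF \<sigma>S f, folded gT]
  show iff: "set_integrable lborel S (\<lambda>z. (norm (\<sigma>' z))\<^sup>2 * f (\<sigma> z)) \<longleftrightarrow> set_integrable lborel (\<sigma> ` S) f"
    unfolding P1(1) P2(1) using key by blast
  show "set_lebesgue_integral lborel S (\<lambda>z. (norm (\<sigma>' z))\<^sup>2 * f (\<sigma> z)) = set_lebesgue_integral lborel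
      (\<sigma> ` S) f"
  proof (cases "set_integrable lborel (\<sigma> ` S) f")
    case True
    then have "set_integrable lborel S (\<lambda>z. (norm (\<sigma>' z))\<^sup>2 * f (\<sigma> z))" by (simp only: iff)
    with True show ?thesis
      unfolding P1 P2 using key
      by (simp add: set_lebesgue_integral_eq_integral(2))
  next
    case False
    with iff show ?thesis
      unfolding set_integrable_def set_lebesgue_integral_def
      by (simp add: not_integrable_integral_eq)
  qed
qed


section \<open>Weighted Bergman spaces\<close>

text \<open>The set \<open>1 - \<bar>z\<bar>\<^sup>2 \<le> 2\<^sup>-\<^sup>k\<close> has area \<open>\<pi> 2\<^sup>-\<^sup>k\<close>, and the weight is comparable to \<open>2\<^sup>-\<^sup>k\<^sup>\<alpha>\<close> where
  \<open>1 - \<bar>z\<bar>\<^sup>2\<close> is comparable to \<open>2\<^sup>-\<^sup>k\<close>. So the integral is dominated by a geometric series of ratio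
  \<open>2\<^sup>-\<^sup>(\<^sup>1\<^sup>+\<^sup>\<alpha>\<^sup>) < 1\<close>.\<close>

lemma nn_integral_power_weight:
  fixes \<alpha> :: real
  assumes "\<alpha> > -1"
  shows "(\<integral>\<^sup>+z\<in>ball 0 1. ennreal ((1 - (norm (z::complex))\<^sup>2) powr \<alpha>) \<partial>lborel) < \<infinity>"
proof -
  define A where "A k = {z::complex. norm z < 1 \<and> 1 - (norm z)\<^sup>2 \<le> (1/2) ^ k}" for k :: nat
  have Ameas: "A k \<in> sets borel" for k
  proof -
    have "A k = ball 0 1 \<inter> (\<lambda>z. 1 - (norm z)\<^sup>2) -` {..(1/2) ^ k}" unfolding A_def by auto
    moreover have "closed ((\<lambda>z::complex. 1 - (norm z)\<^sup>2) -` {..(1/2) ^ k})"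
      by (intro closed_vimage continuous_intros closed_atMost)
    ultimately show ?thesis by simp
  qed
  have area: "emeasure lborel (A k) \<le> ennreal (pi * (1/2) ^ k)" for k
  proof -
    define s where "s = sqrt (1 - (1/2) ^ k)"
    have s: "0 \<le> s" "s\<^sup>2 = 1 - (1/2) ^ k" "s \<le> 1" unfolding s_def by (auto simp: power_le_one)
    have "A k \<subseteq> ball 0 1 - ball 0 s"
    proof safe
      fix z assume z: "z \<in> A k" 
      then show "z \<in> ball 0 1" by (simp add: A_def)
      assume "z \<in> ball 0 s"
      then have "(norm z)\<^sup>2 < s\<^sup>2" by (intro power_strict_mono) auto
      with z s show False by (simp add: A_def)
    qed
    then have "emeasure lborel (A k) \<le> emeasure lborel (ball (0::complex) 1 - ball 0 s)"
      by (intro emeasure_mono) auto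
    also have "\<dots> = emeasure lborel (ball (0::complex) 1) - emeasure lborel (ball (0::complex) s)"
      using s by (intro emeasure_Diff) (auto simp: emeasure_ball)
    also have "\<dots> = ennreal (pi * 1) - ennreal (pi * s\<^sup>2)"
      using s by (simp add: emeasure_ball unit_ball_vol_2)
    also have "\<dots> = ennreal (pi * (1/2) ^ k)"
    proof -
      have "pi * 1 - pi * s\<^sup>2 = pi * (1/2) ^ k" unfolding s(2) by (simp add: algebra_simps)
      then show ?thesis by (simp only: ennreal_minus[of "pi * s\<^sup>2" "pi * 1"] zero_le_power2 pi_ge_zero
          mult_nonneg_nonneg)
    qed
    finally show ?thesis .
  qed
  define q where "q = (1/2) powr (1 + \<alpha>)"
  have q: "0 < q" "q < 1" unfolding q_def using assms powr_less_mono'[of "1/2" 0 "1 + \<alpha>"] by simp_all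
  define C where "C = 2 powr \<bar>\<alpha>\<bar>"
  have C: "C > 0" by (simp add: C_def)
  have wle: "ennreal ((1 - (norm z)\<^sup>2) powr \<alpha>) * indicator (ball 0 1) z
      \<le> (\<Sum>k. ennreal (C * ((1/2) ^ k) powr \<alpha>) * indicator (A k) z)" for z :: complex
  proof (cases "norm z < 1")
    case True
    define x where "x = 1 - (norm z)\<^sup>2"
    have x: "0 < x" "x \<le> 1" unfolding x_def using True by
        (auto simp: power_less_one_iff abs_square_less_1)
    \<comment> \<open>This is the dyadic scale of the point: \<open>2\<^sup>-\<^sup>k\<^sup>-\<^sup>1 < x \<le> 2\<^sup>-\<^sup>k\<close>.\<close>
    define k where "k = nat \<lfloor>log (1/2) x\<rfloor>"
    have lx: "0 \<le> log (1/2) x" using x by (simp add: log_def divide_nonpos_neg)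
    have k: "real k \<le> log (1/2) x" "log (1/2) x < real k + 1" unfolding k_def using lx by linarith+
    have xeq: "x = (1/2) powr (log (1/2) x)" using x by simp
    have up: "x \<le> (1/2) ^ k"
      using k(1) by (subst xeq) (simp add: powr_realpow[symmetric] powr_mono_both' powr_mono')
    have lo: "(1/2) ^ k \<le> 2 * x"
    proof -
      have "(1/2) powr (real k + 1) \<le> (1/2) powr (log (1/2) x)" using k(2) by (intro powr_mono') auto
      then have "(1/2) powr (real k) * (1/2) \<le> x" using xeq by (simp add: powr_add)
      then show ?thesis by (simp add: powr_realpow)
    qed
    have bound: "x powr \<alpha> \<le> C * ((1/2) ^ k) powr \<alpha>"
    proof (cases "\<alpha> \<ge> 0")
      case True
      have "x powr \<alpha> \<le> ((1/2) ^ k) powr \<alpha>" using up x True by (intro powr_mono2) auto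
      also have "\<dots> \<le> C * ((1/2) ^ k) powr \<alpha>"
        using True by (simp add: C_def ge_one_powr_ge_zero)
      finally show ?thesis .
    next
      case False
      have "x powr \<alpha> \<le> ((1/2) ^ k / 2) powr \<alpha>" using lo x False by (intro powr_mono2') auto
      also have "\<dots> = C * ((1/2) ^ k) powr \<alpha>"
        using False by (simp add: C_def powr_divide powr_minus_divide)
      finally show ?thesis .
    qed
    have zA: "z \<in> A k" using up True by (simp add: A_def x_def)
    have "ennreal (x powr \<alpha>) \<le> ennreal (C * ((1/2) ^ k) powr \<alpha>) * indicator (A k) z"
      using bound zA by (simp add: ennreal_leI)
    also have "\<dots> = (\<Sum>j. if j = k then ennreal (C * ((1/2) ^ j) powr \<alpha>) * indicator (A j) z else 0)"
      using sums_single[of k "\<lambda>j. ennreal (C * ((1/2) ^ j) powr \<alpha>) * indicator (A j) z"] by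
          (simp add: sums_iff)
    also have "\<dots> \<le> (\<Sum>k. ennreal (C * ((1/2) ^ k) powr \<alpha>) * indicator (A k) z)"
      by (intro suminf_le) auto
    finally show ?thesis using True by (simp add: x_def)
  qed auto
  have "(\<integral>\<^sup>+z\<in>ball 0 1. ennreal ((1 - (norm (z::complex))\<^sup>2) powr \<alpha>) \<partial>lborel)
      \<le> (\<integral>\<^sup>+z. (\<Sum>k. ennreal (C * ((1/2) ^ k) powr \<alpha>) * indicator (A k) z) \<partial>lborel)"
    using wle by (intro nn_integral_mono) auto
  also have "\<dots> = (\<Sum>k. ennreal (C * ((1/2) ^ k) powr \<alpha>) * emeasure lborel (A k))"
    using Ameas by (simp add: nn_integral_suminf nn_integral_cmult_indicator)
  also have "\<dots> \<le> (\<Sum>k. ennreal (C * pi * q ^ k))"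
  proof (intro suminf_le)
    fix k
    have "ennreal (C * ((1/2) ^ k) powr \<alpha>) * emeasure lborel (A k)
        \<le> ennreal (C * ((1/2) ^ k) powr \<alpha>) * ennreal (pi * (1/2) ^ k)"
      by (intro mult_left_mono area) auto
    also have "\<dots> = ennreal (C * pi * (((1/2) ^ k) powr \<alpha> * (1/2) ^ k))"
      using C by (simp add: ennreal_mult[symmetric] mult_ac)
    also have "((1/2) ^ k) powr \<alpha> * (1/2) ^ k = q ^ k"
    proof -
      have "((1/2::real) ^ k) powr \<alpha> * (1/2) ^ k = (1/2) powr (real k * \<alpha>) * (1/2) powr real k"
        by (simp add: powr_realpow[symmetric] powr_powr)
      also have "\<dots> = (1/2) powr ((1 + \<alpha>) * real k)" by (simp add: powr_add[symmetric] algebra_simps)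
      also have "\<dots> = q ^ k" by (simp add: q_def powr_powr[symmetric] powr_realpow)
      finally show ?thesis .
    qed
    finally show "ennreal (C * ((1/2) ^ k) powr \<alpha>) * emeasure lborel (A k) \<le> ennreal (C * pi * q ^ k)" .
  qed auto
  also have "\<dots> = ennreal (\<Sum>k. C * pi * q ^ k)"
    using q C by (intro suminf_ennreal2 summable_mult summable_geometric) auto
  also have "\<dots> < \<infinity>" by simp
  finally show ?thesis .
qed

text \<open>The squared Bergman norm as an extended real, which can be estimated before integrability is
  known.\<close>

definition disk_energy :: "real \<Rightarrow> (complex \<Rightarrow> complex) \<Rightarrow> ennreal"
  where "disk_energy \<alpha> f = (\<integral>\<^sup>+z\<in>ball 0 1. ennreal ((norm (f z))\<^sup>2 * bergman_weight \<alpha> z) \<partial>lborel)"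

lemma bergman_weight_pos: "\<alpha> > -1 \<Longrightarrow> z \<in> ball 0 1 \<Longrightarrow> 0 < bergman_weight \<alpha> z"
proof -
  assume "\<alpha> > -1" "z \<in> ball 0 1"
  then have "0 < 1 - (norm z)\<^sup>2" by (simp add: abs_square_less_1)
  then have "0 < (1 - (norm z)\<^sup>2) powr \<alpha>" by (simp only: powr_gt_zero)
  with \<open>\<alpha> > -1\<close> show ?thesis unfolding bergman_weight_def by (intro mult_pos_pos divide_pos_pos) auto
qed

lemma continuous_on_bergman_weight: "continuous_on (ball 0 1) (bergman_weight \<alpha>)"
  unfolding bergman_weight_def by (intro continuous_intros) (auto simp: abs_square_eq_1)

lemma measurable_on_disk:
  fixes f :: "complex \<Rightarrow> real"
  shows "continuous_on (ball 0 1) f \<Longrightarrow> (\<lambda>z. indicator (ball 0 1) z * f z) \<in> borel_measurable borel"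
  using borel_measurable_continuous_on_indicator[of "ball 0 1" f] by simp

lemma continuous_on_energy_density:
  "f holomorphic_on ball 0 1 \<Longrightarrow> continuous_on (ball 0 1) (\<lambda>z. (norm (f z))\<^sup>2 * bergman_weight \<alpha> z)"
  by (intro continuous_intros holomorphic_on_imp_continuous_on continuous_on_bergman_weight)

context
  fixes \<alpha> :: real
  assumes \<alpha>: "\<alpha> > -1"
begin

lemma energy_as_nn_integral:
  "disk_energy \<alpha> f = (\<integral>\<^sup>+z. ennreal (indicator (ball 0 1) z * ((norm
      (f z))\<^sup>2 * bergman_weight \<alpha> z)) \<partial>lborel)"
  unfolding disk_energy_def
  by (intro nn_integral_cong) (auto simp: indicator_def)

lemma bergman_space_iff:
  "f \<in> bergman_space \<alpha> \<longleftrightarrow>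
    f holomorphic_on ball 0 1 \<and> disk_energy \<alpha> f < \<infinity> \<and> (\<forall>z. z \<notin> ball 0 1 \<longrightarrow> f z = 0)"
proof -
  have "set_integrable lborel (ball 0 1) (\<lambda>z. (norm (f z))\<^sup>2 * bergman_weight \<alpha> z) \<longleftrightarrow> disk_energy \<alpha> f < \<infinity>"
    if "f holomorphic_on ball 0 1"
    unfolding set_integrable_def energy_as_nn_integral integrable_iff_bounded
    using measurable_on_disk[OF continuous_on_energy_density[OF that, of \<alpha>]] bergman_weight_pos[OF \<alpha>]
    by (auto simp: indicator_def less_imp_le intro!: nn_integral_cong arg_cong2[where f = "(<)"])
  then show ?thesis unfolding bergman_space_def by auto
qed

lemma bergman_norm_nonneg: "0 \<le> bergman_norm \<alpha> f"
  unfolding bergman_norm_def set_lebesgue_integral_def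
  using bergman_weight_pos[OF \<alpha>]
  by (intro real_sqrt_ge_zero Bochner_Integration.integral_nonneg) (auto simp: indicator_def less_imp_le)

lemma energy_eq_norm:
  assumes "f \<in> bergman_space \<alpha>"
  shows "disk_energy \<alpha> f = ennreal ((bergman_norm \<alpha> f)\<^sup>2)"
proof -
  let ?F = "\<lambda>z. indicator (ball 0 1) z * ((norm (f z))\<^sup>2 * bergman_weight \<alpha> z)"
  have int: "integrable lborel ?F"
    using assms unfolding bergman_space_def set_integrable_def by simp
  have nonneg: "0 \<le> ?F z" for z using bergman_weight_pos[OF \<alpha>, of z] by (auto simp: indicator_def)
  have "disk_energy \<alpha> f = ennreal (integral\<^sup>L lborel ?F)"
    unfolding energy_as_nn_integral using nonneg by (intro nn_integral_eq_integral int) auto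
  also have "integral\<^sup>L lborel ?F = (bergman_norm \<alpha> f)\<^sup>2"
    unfolding bergman_norm_def set_lebesgue_integral_def
    using Bochner_Integration.integral_nonneg[of lborel ?F] nonneg by simp
  finally show ?thesis .
qed

lemma bergmanI:
  assumes "f holomorphic_on ball 0 1" "\<And>z. z \<notin> ball 0 1 \<Longrightarrow> f z = 0" "disk_energy \<alpha> f \<le> ennreal (B\<^sup>2)" "0
      \<le> B"
  shows "f \<in> bergman_space \<alpha> \<and> bergman_norm \<alpha> f \<le> B"
proof -
  have f: "f \<in> bergman_space \<alpha>"
    unfolding bergman_space_iff using assms by (auto intro: le_less_trans)
  have "(bergman_norm \<alpha> f)\<^sup>2 \<le> B\<^sup>2"
    using assms(3) unfolding energy_eq_norm[OF f] by simp
  with f assms(4) show ?thesis by (auto intro: power2_le_imp_le)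
qed

lemma energy_const: "disk_energy \<alpha> (\<lambda>z. 1) < \<infinity>" "0 < disk_energy \<alpha> (\<lambda>z. 1)"
proof -
  have m: "(\<lambda>z. ennreal ((1 - (norm (z::complex))\<^sup>2) powr \<alpha>) * indicator (ball 0 1) z)
      \<in> borel_measurable lborel"
  proof -
    have "continuous_on (ball 0 1) (\<lambda>z::complex. (1 - (norm z)\<^sup>2) powr \<alpha>)"
      by (intro continuous_intros) (auto simp: abs_square_eq_1)
    from measurable_on_disk[OF this]
    have "(\<lambda>z::complex. ennreal (indicator (ball 0 1) z * (1 - (norm z)\<^sup>2) powr \<alpha>))
        \<in> borel_measurable lborel"
      by simp
    also have "(\<lambda>z::complex. ennreal (indicator (ball 0 1) z * (1 - (norm z)\<^sup>2) powr \<alpha>)) =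
        (\<lambda>z. ennreal ((1 - (norm (z::complex))\<^sup>2) powr \<alpha>) * indicator (ball 0 1) z)"
      by (auto simp: indicator_def)
    finally show ?thesis .
  qed
  have "disk_energy \<alpha> (\<lambda>z. 1) = ennreal ((1 + \<alpha>) / pi) *
      (\<integral>\<^sup>+z\<in>ball 0 1. ennreal ((1 - (norm (z::complex))\<^sup>2) powr \<alpha>) \<partial>lborel)"
    unfolding disk_energy_def bergman_weight_def nn_integral_cmult[OF m, symmetric]
  proof (intro nn_integral_cong)
    fix z :: complex
    have "ennreal ((1 + \<alpha>) / pi * (1 - (norm z)\<^sup>2) powr \<alpha>) = ennreal ((1 + \<alpha>) / pi) * ennreal ((1 -
        (norm z)\<^sup>2) powr \<alpha>)"
      using \<alpha> by (intro ennreal_mult) auto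
    then show "ennreal ((norm (1::complex))\<^sup>2 * ((1 + \<alpha>) / pi * (1 - (norm z)\<^sup>2) powr \<alpha>)) * indicator
        (ball 0 1) z =
        ennreal ((1 + \<alpha>) / pi) * (ennreal ((1 - (norm z)\<^sup>2) powr \<alpha>) * indicator (ball 0 1) z)"
      by (simp only: norm_one power_one mult_1 mult.assoc)
  qed
  also have "\<dots> < \<infinity>"
    using nn_integral_power_weight[OF \<alpha>] by (simp add: ennreal_mult_less_top)
  finally show "disk_energy \<alpha> (\<lambda>z. 1) < \<infinity>" .
  show "0 < disk_energy \<alpha> (\<lambda>z. 1)"
  proof (rule ccontr)
    assume "\<not> 0 < disk_energy \<alpha> (\<lambda>z. 1)"
    then have "disk_energy \<alpha> (\<lambda>z. 1) = 0" by simp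
    then have "AE z in lborel. ennreal (indicator (ball 0 1) z * ((norm
        (1::complex))\<^sup>2 * bergman_weight \<alpha> z)) = 0"
      unfolding energy_as_nn_integral
      using measurable_on_disk[OF continuous_on_energy_density[of "\<lambda>_. 1" \<alpha>]]
      by (subst (asm) nn_integral_0_iff_AE) auto
    then have "AE z in lborel. z \<notin> ball (0::complex) 1"
    proof eventually_elim
      case (elim z)
      then show ?case using bergman_weight_pos[OF \<alpha>, of z] by (auto simp: indicator_def split: if_splits)
    qed
    then have "emeasure lborel (ball (0::complex) 1) = 0"
      by (subst (asm) AE_iff_measurable[of "ball 0 1"]) auto
    then show False by (simp add: emeasure_ball unit_ball_vol_2)
  qed
qed

end

text \<open>For \<open>t = b / a\<close> the right-hand side is \<open>(a + b)\<^sup>2\<close>. With \<open>norm_add_squared_le\<close> this gives the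
  triangle inequality of the Bergman norm by integrating a pointwise estimate.\<close>

lemma add_bound_from_weighted_squares:
  fixes x a b :: real
  assumes "0 \<le> a" "0 \<le> b" and le: "\<And>t. t > 0 \<Longrightarrow> x\<^sup>2 \<le> (1 + t) * a\<^sup>2 + (1 + 1 / t) * b\<^sup>2"
  shows "x \<le> a + b"
proof (rule field_le_epsilon)
  fix e :: real assume e: "0 < e"
  define d where "d = e / 2"
  have d: "0 < a + d" "0 < b + d" using assms(1,2) e by (auto simp: d_def)
  \<comment> \<open>Adding \<open>d > 0\<close> allows \<open>a\<close> or \<open>b\<close> to be zero.\<close>
  define t where "t = (b + d) / (a + d)"
  have t: "t > 0" unfolding t_def using d by simp
  have "x\<^sup>2 \<le> (1 + t) * a\<^sup>2 + (1 + 1 / t) * b\<^sup>2" by (rule le[OF t])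
  also have "\<dots> \<le> (1 + t) * (a + d)\<^sup>2 + (1 + 1 / t) * (b + d)\<^sup>2"
    using assms(1,2) t d e by (intro add_mono mult_left_mono power_mono) (auto simp: d_def)
  also have "\<dots> = (a + b + 2 * d)\<^sup>2"
  proof -
    have *: "(1 + y / x) * x\<^sup>2 = x\<^sup>2 + x * y" if "x > 0" for x y :: real
      using that by (simp add: field_simps power2_eq_square)
    have "1 / t = (a + d) / (b + d)" by (simp add: t_def)
    then show ?thesis
      unfolding t_def using *[OF d(1), of "b + d"] *[OF d(2), of "a + d"]
      by (simp add: power2_eq_square algebra_simps)
  qed
  finally have "x \<le> a + b + 2 * d"
    by (rule power2_le_imp_le) (use assms(1,2) e in \<open>simp add: d_def\<close>)
  then show "x \<le> a + b + e" by (simp add: d_def)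
qed

lemma norm_add_squared_le:
  fixes u v :: complex
  assumes "t > 0"
  shows "(norm (u + v))\<^sup>2 \<le> (1 + t) * (norm u)\<^sup>2 + (1 + 1 / t) * (norm v)\<^sup>2"
proof -
  have "(norm (u + v))\<^sup>2 \<le> (norm u + norm v)\<^sup>2" by (intro power_mono norm_triangle_ineq) auto
  also have "\<dots> \<le> (1 + t) * (norm u)\<^sup>2 + (1 + 1 / t) * (norm v)\<^sup>2"
  proof -
    have "0 \<le> (t * norm u - norm v)\<^sup>2 / t" using assms by simp
    also have "\<dots> = t * (norm u)\<^sup>2 - 2 * norm u * norm v + (norm v)\<^sup>2 / t"
      using assms by (simp add: power2_eq_square field_simps)
    finally show ?thesis by (simp add: power2_eq_square algebra_simps)
  qed
  finally show ?thesis .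
qed

lemma root_of_unity_sum:
  assumes "n > 0"
  shows "(\<Sum>j<n. (cis (2 * pi / real n) ^ j) ^ k) = (if n dvd k then of_nat n else 0)"
proof -
  define w where "w = cis (2 * pi / real n) ^ k"
  have w: "w = cis (real k * (2 * pi / real n))" unfolding w_def by (rule Complex.DeMoivre)
  have sum: "(\<Sum>j<n. (cis (2 * pi / real n) ^ j) ^ k) = (\<Sum>j<n. w ^ j)"
    unfolding w_def by (simp add: power_mult[symmetric] mult.commute)
  have wn: "w ^ n = 1"
  proof -
    have "real n * (real k * (2 * pi / real n)) = 2 * pi * real k" using assms by simp
    then show ?thesis unfolding w Complex.DeMoivre using cis_multiple_2pi[of "real k"] by simp
  qed
  have "w = 1 \<longleftrightarrow> n dvd k"
  proof
    assume "n dvd k"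
    then obtain m where "k = n * m" by auto
    then have "real k * (2 * pi / real n) = 2 * pi * real m" using assms by simp
    then show "w = 1" unfolding w using cis_multiple_2pi[of "real m"] by simp
  next
    assume "w = 1"
    then have "cos (real k * (2 * pi / real n)) = 1" unfolding w by (simp add: cis.ctr complex_eq_iff)
    then obtain m :: int where "real k * (2 * pi / real n) = of_int m * 2 * pi"
      using cos_one_2pi_int by auto
    then have "real k = of_int m * real n" using assms by (simp add: field_simps)
    then have "int k = m * int n" by (metis of_int_eq_iff of_int_mult of_int_of_nat_eq)
    then show "n dvd k" by (metis dvd_triv_right int_dvd_int_iff)
  qed
  then show ?thesis
    unfolding sum using geometric_sum[of w n] wn by auto
qed

text \<open>Averaging over the \<open>n\<close>-th roots of unity keeps only the Taylor coefficients whose index is a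
  multiple of \<open>n\<close>, and those beyond the constant term lie in the tail of a convergent series.\<close>

lemma tendsto_average_over_roots:
  assumes f: "f holomorphic_on ball 0 1" and z: "z \<in> ball 0 1"
  shows "(\<lambda>n. (\<Sum>j<Suc n. f (cis (2 * pi / real (Suc n)) ^ j * z)) / of_nat (Suc n)) \<longlonglongrightarrow> f 0"
proof -
  define c where "c k = (deriv ^^ k) f 0 / fact k" for k
  have c: "(\<lambda>k. c k * w ^ k) sums f w" if "w \<in> ball 0 1" for w
    using holomorphic_power_series[OF f that] by (simp add: c_def)
  define a where "a k = c k * z ^ k" for k
  have c0: "a 0 = f 0" by (simp add: a_def c_def)
  have abs: "summable (\<lambda>k. norm (a k))"
  proof -
    obtain r where r: "norm z < r" "r < 1" using dense[of "norm z" 1] z by auto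
    have "summable (\<lambda>k. c k * (of_real r) ^ k)"
      using c[of "of_real r"] r norm_ge_zero[of z] by (auto simp: sums_iff)
    then show ?thesis unfolding a_def
      by (rule powser_insidea) (use r norm_ge_zero[of z] in auto)
  qed
  have tail: "(\<lambda>n. \<Sum>k. norm (a (k + Suc n))) \<longlonglongrightarrow> 0"
  proof -
    have "(\<lambda>n. (\<Sum>k. norm (a k)) - (\<Sum>k<n. norm (a k))) \<longlonglongrightarrow> (\<Sum>k. norm (a k)) - (\<Sum>k. norm (a k))"
      by (intro tendsto_diff tendsto_const summable_LIMSEQ abs)
    then have "(\<lambda>n. \<Sum>k. norm (a (k + n))) \<longlonglongrightarrow> 0"
      using suminf_minus_initial_segment[OF abs] by simp
    then show ?thesis by (rule LIMSEQ_Suc)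
  qed
  show ?thesis
  proof (rule LIM_zero_cancel, rule Lim_null_comparison[OF always_eventually tail], intro allI)
    fix n
    let ?N = "Suc n" and ?w = "cis (2 * pi / real (Suc n))"
    have "(\<lambda>k. c k * (?w ^ j * z) ^ k) sums f (?w ^ j * z)" for j
      using z by (intro c) (simp add: norm_mult norm_power)
    then have "(\<lambda>k. \<Sum>j<?N. c k * (?w ^ j * z) ^ k) sums (\<Sum>j<?N. f (?w ^ j * z))"
      by (intro sums_sum)
    moreover have "(\<Sum>j<?N. c k * (?w ^ j * z) ^ k) = (if ?N dvd k then of_nat ?N * a k else 0)" for k
    proof -
      have "(\<Sum>j<?N. c k * (?w ^ j * z) ^ k) = (\<Sum>j<?N. (?w ^ j) ^ k) * a k"
        unfolding a_def sum_distrib_right by (intro sum.cong) (auto simp: power_mult_distrib mult_ac)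
      then show ?thesis unfolding root_of_unity_sum[OF zero_less_Suc] by simp
    qed
    ultimately have "(\<lambda>k. if ?N dvd k then of_nat ?N * a k else 0) sums (\<Sum>j<?N. f (?w ^ j * z))"
      by simp
    then have "(\<lambda>k. (if ?N dvd k then of_nat ?N * a k else 0) / of_nat ?N) sums ((\<Sum>j<?N. f
        (?w ^ j * z)) / of_nat ?N)"
      by (rule sums_divide)
    moreover have "(if ?N dvd k then of_nat ?N * a k else 0) / of_nat ?N = (if ?N dvd k then a k else 0)"
        for k
      by (simp del: of_nat_Suc)
    ultimately have s: "(\<lambda>k. if ?N dvd k then a k else 0) sums ((\<Sum>j<?N. f (?w ^ j * z)) / of_nat ?N)"
      by simp
    have head: "(\<Sum>k<?N. if ?N dvd k then a k else 0) = f 0"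
    proof -
      have "(\<Sum>k<?N. if ?N dvd k then a k else 0) = (\<Sum>k<?N. if k = 0 then a k else 0)"
        by (intro sum.cong) (auto dest: dvd_imp_le)
      then show ?thesis by (simp add: c0)
    qed
    have "(\<lambda>k. if ?N dvd (k + ?N) then a (k + ?N) else 0) sums ((\<Sum>j<?N. f
        (?w ^ j * z)) / of_nat ?N - f 0)"
      using sums_split_initial_segment[OF s, of ?N] head by simp
    then have "(\<Sum>j<?N. f (?w ^ j * z)) / of_nat ?N - f 0 = (\<Sum>k. if ?N dvd (k + ?N) then a
        (k + ?N) else 0)"
      by (simp only: sums_iff)
    also have "norm \<dots> \<le> (\<Sum>k. norm (a (k + ?N)))"
      by (intro norm_suminf_le summable_ignore_initial_segment abs) auto
    finally show "norm ((\<Sum>j<?N. f (?w ^ j * z)) / of_nat ?N - f 0) \<le> (\<Sum>k. norm (a (k + ?N)))" .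
  qed
qed

context
  fixes \<alpha> :: real
  assumes \<alpha>: "\<alpha> > -1"
begin

lemma bergman_zero: "(\<lambda>z. 0) \<in> bergman_space \<alpha>"
  unfolding bergman_space_iff[OF \<alpha>] disk_energy_def by simp

lemma energy_measurable:
  "f holomorphic_on ball 0 1 \<Longrightarrow>
    (\<lambda>z. ennreal (indicator (ball 0 1) z * ((norm (f z))\<^sup>2 * bergman_weight \<alpha> z)))
        \<in> borel_measurable lborel"
  using measurable_on_disk[OF continuous_on_energy_density[of f \<alpha>]] by simp

lemma energy_mono_combination:
  assumes "f \<in> bergman_space \<alpha>" "g \<in> bergman_space \<alpha>" "0 \<le> a" "0 \<le> b"
    and le: "\<And>z. z \<in> ball 0 1 \<Longrightarrow> (norm (h z))\<^sup>2 \<le> a * (norm (f z))\<^sup>2 + b * (norm (g z))\<^sup>2"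
  shows "disk_energy \<alpha> h \<le> ennreal (a * (bergman_norm \<alpha> f)\<^sup>2 + b * (bergman_norm \<alpha> g)\<^sup>2)"
proof -
  let ?F = "\<lambda>f z. ennreal (indicator (ball 0 1) z * ((norm (f z))\<^sup>2 * bergman_weight \<alpha> z))"
  have hol: "f holomorphic_on ball 0 1" "g holomorphic_on ball 0 1"
    using assms unfolding bergman_space_def by auto
  note [measurable] = energy_measurable[OF hol(1)] energy_measurable[OF hol(2)]
  have "disk_energy \<alpha> h \<le> (\<integral>\<^sup>+z. ennreal a * ?F f z + ennreal b * ?F g z \<partial>lborel)"
    unfolding energy_as_nn_integral[OF \<alpha>]
  proof (rule nn_integral_mono)
    fix z :: complex
    show "?F h z \<le> ennreal a * ?F f z + ennreal b * ?F g z"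
    proof (cases "z \<in> ball 0 1")
      case True
      have w: "0 \<le> bergman_weight \<alpha> z" using bergman_weight_pos[OF \<alpha> True] by simp
      have "?F h z \<le> ennreal ((a * (norm (f z))\<^sup>2 + b * (norm (g z))\<^sup>2) * bergman_weight \<alpha> z)"
        using True w le[OF True] by (intro ennreal_leI) (auto intro!: mult_right_mono)
      also have "\<dots> = ennreal a * ?F f z + ennreal b * ?F g z"
        using True w assms(3,4) by (simp add: distrib_right ennreal_mult' mult.assoc)
      finally show ?thesis .
    qed simp
  qed
  also have "\<dots> = ennreal a * disk_energy \<alpha> f + ennreal b * disk_energy \<alpha> g"
    unfolding energy_as_nn_integral[OF \<alpha>]
    by (simp add: nn_integral_add nn_integral_cmult)
  also have "\<dots> = ennreal (a * (bergman_norm \<alpha> f)\<^sup>2 + b * (bergman_norm \<alpha> g)\<^sup>2)"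
    unfolding energy_eq_norm[OF \<alpha> assms(1)] energy_eq_norm[OF \<alpha> assms(2)]
    using assms(3,4) by (simp add: ennreal_mult)
  finally show ?thesis .
qed

lemma bergman_comparison:
  assumes "f \<in> bergman_space \<alpha>" "h holomorphic_on ball 0 1" "\<And>z. z \<notin> ball 0 1 \<Longrightarrow> h z = 0"
    and B: "0 \<le> B" "\<And>z. z \<in> ball 0 1 \<Longrightarrow> norm (h z) \<le> B * norm (f z)"
  shows "h \<in> bergman_space \<alpha> \<and> bergman_norm \<alpha> h \<le> B * bergman_norm \<alpha> f"
proof (rule bergmanI[OF \<alpha>])
  have "(norm (h z))\<^sup>2 \<le> B\<^sup>2 * (norm (f z))\<^sup>2 + 0 * (norm (f z))\<^sup>2" if "z \<in> ball 0 1" for z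
    using power_mono[OF B(2)[OF that], of 2] by (simp add: power_mult_distrib)
  from energy_mono_combination[OF assms(1,1) _ _ this]
  show "disk_energy \<alpha> h \<le> ennreal ((B * bergman_norm \<alpha> f)\<^sup>2)" by (simp add: power_mult_distrib)
  show "0 \<le> B * bergman_norm \<alpha> f" using B bergman_norm_nonneg[OF \<alpha>] by simp
qed (use assms in auto)

lemma bergman_scale:
  assumes "f \<in> bergman_space \<alpha>"
  shows "(\<lambda>z. c * f z) \<in> bergman_space \<alpha>" "bergman_norm \<alpha> (\<lambda>z. c * f z) = norm c * bergman_norm \<alpha> f"
proof -
  have hol: "f holomorphic_on ball 0 1" and off: "\<And>z. z \<notin> ball 0 1 \<Longrightarrow> f z = 0"
    using assms unfolding bergman_space_def by auto
  have 1: "(\<lambda>z. d * f z) \<in> bergman_space \<alpha> \<and> bergman_norm \<alpha> (\<lambda>z. d * f z) \<le> norm d * bergman_norm \<alpha> f"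
      for d
    by (rule bergman_comparison[OF assms]) (auto simp: norm_mult off intro!: holomorphic_intros hol)
  then show "(\<lambda>z. c * f z) \<in> bergman_space \<alpha>" by blast
  show "bergman_norm \<alpha> (\<lambda>z. c * f z) = norm c * bergman_norm \<alpha> f"
    unfolding bergman_norm_def set_lebesgue_integral_def
    by (simp add: norm_mult power_mult_distrib real_sqrt_mult mult.assoc mult.left_commute[of _ "(norm
        c)\<^sup>2"])
qed

lemma bergman_add:
  assumes "f \<in> bergman_space \<alpha>" "g \<in> bergman_space \<alpha>"
  shows "(\<lambda>z. f z + g z) \<in> bergman_space \<alpha> \<and>
    bergman_norm \<alpha> (\<lambda>z. f z + g z) \<le> bergman_norm \<alpha> f + bergman_norm \<alpha> g"
proof -
  let ?h = "\<lambda>z. f z + g z"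
  have hol: "f holomorphic_on ball 0 1" "g holomorphic_on ball 0 1"
    and off: "\<And>z. z \<notin> ball 0 1 \<Longrightarrow> f z = 0" "\<And>z. z \<notin> ball 0 1 \<Longrightarrow> g z = 0"
    using assms unfolding bergman_space_def by auto
  have le: "disk_energy \<alpha> ?h \<le> ennreal ((1 + t) * (bergman_norm \<alpha> f)\<^sup>2 + (1 + 1 / t) *
      (bergman_norm \<alpha> g)\<^sup>2)" if "t > 0" for t
    using that by (intro energy_mono_combination assms norm_add_squared_le) auto
  have h: "?h \<in> bergman_space \<alpha>"
    unfolding bergman_space_iff[OF \<alpha>] using le[of 1] off
    by (auto intro!: holomorphic_intros hol intro: le_less_trans)
  have "bergman_norm \<alpha> ?h \<le> bergman_norm \<alpha> f + bergman_norm \<alpha> g"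
  proof (rule add_bound_from_weighted_squares)
    fix t :: real assume t: "t > 0"
    have "0 \<le> (1 + t) * (bergman_norm \<alpha> f)\<^sup>2 + (1 + 1 / t) * (bergman_norm \<alpha> g)\<^sup>2" using t by simp
    then show "(bergman_norm \<alpha> ?h)\<^sup>2 \<le> (1 + t) * (bergman_norm \<alpha> f)\<^sup>2 + (1 + 1 / t) * (bergman_norm \<alpha> g)\<^sup>2"
      using le[OF t] unfolding energy_eq_norm[OF \<alpha> h] by simp
  qed (rule bergman_norm_nonneg[OF \<alpha>])+
  with h show ?thesis by blast
qed

lemma bergman_fatou:
  assumes F: "\<And>n. F n \<in> bergman_space \<alpha>" "\<And>n. bergman_norm \<alpha> (F n) \<le> B"
    and f: "f holomorphic_on ball 0 1" "\<And>z. z \<notin> ball 0 1 \<Longrightarrow> f z = 0"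
    and lim: "\<And>z. z \<in> ball 0 1 \<Longrightarrow> (\<lambda>n. F n z) \<longlonglongrightarrow> f z"
  shows "f \<in> bergman_space \<alpha> \<and> bergman_norm \<alpha> f \<le> B"
proof (rule bergmanI[OF \<alpha> f])
  let ?F = "\<lambda>f z. ennreal (indicator (ball 0 1) z * ((norm (f z))\<^sup>2 * bergman_weight \<alpha> z))"
  show B: "0 \<le> B" using F(2)[of 0] bergman_norm_nonneg[OF \<alpha>] order_trans by blast
  have hol: "F n holomorphic_on ball 0 1" for n using F(1) unfolding bergman_space_def by auto
  have Flim: "(\<lambda>n. ?F (F n) z) \<longlonglongrightarrow> ?F f z" for z
  proof (cases "z \<in> ball 0 1")
    case True
    then have "(\<lambda>n. indicator (ball 0 1) z * ((norm (F n z))\<^sup>2 * bergman_weight \<alpha> z)) \<longlonglongrightarrow>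
        indicator (ball 0 1) z * ((norm (f z))\<^sup>2 * bergman_weight \<alpha> z)"
      by (intro tendsto_mult tendsto_const tendsto_power tendsto_norm lim)
    then show ?thesis by (rule tendsto_ennrealI)
  qed simp
  have "?F f z = liminf (\<lambda>n. ?F (F n) z)" for z
    by (rule lim_imp_Liminf[OF sequentially_bot Flim, symmetric])
  then have "disk_energy \<alpha> f = (\<integral>\<^sup>+z. liminf (\<lambda>n. ?F (F n) z) \<partial>lborel)"
    unfolding energy_as_nn_integral[OF \<alpha>] by simp
  also have "\<dots> \<le> liminf (\<lambda>n. \<integral>\<^sup>+z. ?F (F n) z \<partial>lborel)"
    by (rule nn_integral_liminf) (rule energy_measurable[OF hol])
  also have "\<dots> \<le> liminf (\<lambda>n. ennreal (B\<^sup>2))"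
  proof (rule Liminf_mono, rule always_eventually, rule allI)
    fix n
    have "(bergman_norm \<alpha> (F n))\<^sup>2 \<le> B\<^sup>2" using F(2) bergman_norm_nonneg[OF \<alpha>] by (intro power_mono)
    then show "(\<integral>\<^sup>+z. ?F (F n) z \<partial>lborel) \<le> ennreal (B\<^sup>2)"
      using energy_eq_norm[OF \<alpha> F(1), of n] unfolding energy_as_nn_integral[OF \<alpha>] by
          (simp add: ennreal_leI)
  qed
  also have "\<dots> = ennreal (B\<^sup>2)" by (simp add: Liminf_const)
  finally show "disk_energy \<alpha> f \<le> ennreal (B\<^sup>2)" .
qed

text \<open>After a change of variables, the comparison of weights is all that boundedness requires.\<close>

lemma bergman_composition:
  assumes f: "f \<in> bergman_space \<alpha>"
    and \<phi>: "\<And>z. z \<in> ball 0 1 \<Longrightarrow> (\<phi> has_field_derivative \<phi>' z) (at z)" "bij_betw \<phi> (ball 0 1) (ball 0 1)"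
    and \<phi>'c: "continuous_on (ball 0 1) \<phi>'"
    and M: "0 \<le> M" "\<And>z. z \<in> ball 0 1 \<Longrightarrow> bergman_weight \<alpha> z \<le> M * ((norm (\<phi>' z))\<^sup>2 * bergman_weight \<alpha>
        (\<phi> z))"
  shows "(\<lambda>z. if z \<in> ball 0 1 then f (\<phi> z) else 0) \<in> bergman_space \<alpha> \<and>
    bergman_norm \<alpha> (\<lambda>z. if z \<in> ball 0 1 then f (\<phi> z) else 0) \<le> sqrt M * bergman_norm \<alpha> f"
proof (rule bergmanI[OF \<alpha>])
  let ?h = "\<lambda>z. if z \<in> ball 0 1 then f (\<phi> z) else 0"
  let ?F = "\<lambda>z. (norm (f z))\<^sup>2 * bergman_weight \<alpha> z"
  have hol: "f holomorphic_on ball 0 1" and int: "set_integrable lborel (ball 0 1) ?F"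
    using f unfolding bergman_space_def by auto
  have im: "\<phi> ` ball 0 1 = ball 0 1" and inj: "inj_on \<phi> (ball 0 1)"
    using \<phi>(2) by (auto simp: bij_betw_def)
  have \<phi>hol: "\<phi> holomorphic_on ball 0 1"
    unfolding holomorphic_on_open[OF open_ball] using \<phi>(1) by blast
  have "(\<lambda>z. f (\<phi> z)) holomorphic_on ball 0 1"
    using holomorphic_on_compose_gen[OF \<phi>hol hol] im by (simp add: o_def)
  then show "?h holomorphic_on ball 0 1" by (rule holomorphic_transform) simp
  have Fc: "continuous_on (\<phi> ` ball 0 1) ?F"
    unfolding im by (rule continuous_on_energy_density[OF hol])
  note CV = holomorphic_change_of_variables[OF open_ball \<phi>(1) inj \<phi>'c Fc, unfolded im, simplified]
  let ?G = "\<lambda>z. indicat_real (ball 0 1) z * ((norm (\<phi>' z))\<^sup>2 * ?F (\<phi> z))"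
  have Gint: "integrable lborel ?G"
    using CV(1) int unfolding set_integrable_def by simp
  have mem: "\<phi> z \<in> ball 0 1" if "z \<in> ball 0 1" for z using im that by blast
  have Gpos: "0 \<le> ?G z" for z
    using bergman_weight_pos[OF \<alpha> mem, of z] by (auto simp: indicator_def)
  have "disk_energy \<alpha> ?h \<le> (\<integral>\<^sup>+z. ennreal (M * ?G z) \<partial>lborel)"
    unfolding energy_as_nn_integral[OF \<alpha>]
  proof (intro nn_integral_mono ennreal_leI)
    fix z :: complex
    show "indicator (ball 0 1) z * ((norm (?h z))\<^sup>2 * bergman_weight \<alpha> z) \<le> M * ?G z"
    proof (cases "z \<in> ball 0 1")
      case True
      have "(norm (f (\<phi> z)))\<^sup>2 * bergman_weight \<alpha> z \<le> (norm (f (\<phi> z)))\<^sup>2 * (M * ((norm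
          (\<phi>' z))\<^sup>2 * bergman_weight \<alpha> (\<phi> z)))"
        by (intro mult_left_mono M(2) True) auto
      with True show ?thesis by (simp add: mult_ac)
    qed simp
  qed
  also have "\<dots> = ennreal (\<integral>z. M * ?G z \<partial>lborel)"
    using Gint Gpos M(1) by (intro nn_integral_eq_integral) auto
  also have "(\<integral>z. M * ?G z \<partial>lborel) = M * (\<integral>z. ?G z \<partial>lborel)" by simp
  also have "(\<integral>z. ?G z \<partial>lborel) = set_lebesgue_integral lborel (ball 0 1) ?F"
    using CV(2) unfolding set_lebesgue_integral_def by simp
  also have "\<dots> = (bergman_norm \<alpha> f)\<^sup>2"
    unfolding bergman_norm_def set_lebesgue_integral_def
    using bergman_weight_pos[OF \<alpha>]
    by (intro real_sqrt_pow2[symmetric] Bochner_Integration.integral_nonneg)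
        (auto simp: indicator_def less_imp_le)
  also have "M * (bergman_norm \<alpha> f)\<^sup>2 = (sqrt M * bergman_norm \<alpha> f)\<^sup>2"
    using M(1) by (simp add: power_mult_distrib)
  finally show "disk_energy \<alpha> ?h \<le> ennreal ((sqrt M * bergman_norm \<alpha> f)\<^sup>2)" .
  show "0 \<le> sqrt M * bergman_norm \<alpha> f" using M bergman_norm_nonneg[OF \<alpha>] by simp
qed auto

lemma bergman_rotation:
  assumes f: "f \<in> bergman_space \<alpha>" and w: "norm w = 1"
  shows "(\<lambda>z. if z \<in> ball 0 1 then f (w * z) else 0) \<in> bergman_space \<alpha> \<and>
    bergman_norm \<alpha> (\<lambda>z. if z \<in> ball 0 1 then f (w * z) else 0) \<le> bergman_norm \<alpha> f"
proof -
  have w0: "w \<noteq> 0" using w by auto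
  have "bij_betw ((*) w) (ball 0 1) (ball 0 1)"
    using w w0 by (intro bij_betwI[where g = "\<lambda>z. z / w"]) (auto simp: norm_mult norm_divide)
  from bergman_composition[OF f _ this, where \<phi>' = "\<lambda>_. w" and M = 1]
  show ?thesis using w by (auto simp: bergman_weight_def norm_mult intro!: derivative_eq_intros)
qed

end


section \<open>The involutive automorphisms of the disk\<close>

definition disk_swap :: "complex \<Rightarrow> complex \<Rightarrow> complex"
  where "disk_swap a z = (a - z) / (1 - cnj a * z)"

context
  fixes a :: complex
  assumes a: "norm a < 1"
begin

lemma swap_denominator: "norm z \<le> 1 \<Longrightarrow> 1 - cnj a * z \<noteq> 0"
proof
  assume "norm z \<le> 1" "1 - cnj a * z = 0"
  then have "norm (cnj a * z) = 1" by simp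
  moreover have "norm (cnj a * z) \<le> norm a * 1"
    unfolding norm_mult using \<open>norm z \<le> 1\<close> by (intro mult_mono) auto
  ultimately show False using a by simp
qed

lemma one_minus_norm_swap:
  assumes "norm z \<le> 1"
  shows "1 - (norm (disk_swap a z))\<^sup>2 = (1 - (norm z)\<^sup>2) * ((1 - (norm a)\<^sup>2) / (norm (1 - cnj a * z))\<^sup>2)"
proof -
  have d: "norm (1 - cnj a * z) \<noteq> 0" using swap_denominator[OF assms] by simp
  have "(norm (1 - cnj a * z))\<^sup>2 - (norm (a - z))\<^sup>2 = (1 - (norm z)\<^sup>2) * (1 - (norm a)\<^sup>2)"
    by (simp add: cmod_power2) (simp add: power2_eq_square algebra_simps)
  then have "(norm (a - z))\<^sup>2 = (norm (1 - cnj a * z))\<^sup>2 - (1 - (norm z)\<^sup>2) * (1 - (norm a)\<^sup>2)" by simp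
  then show ?thesis
    unfolding disk_swap_def norm_divide power_divide using d by (simp add: field_simps)
qed

lemma norm_swap_less: "norm z < 1 \<Longrightarrow> norm (disk_swap a z) < 1"
proof -
  assume z: "norm z < 1"
  have "0 < norm (1 - cnj a * z)" using swap_denominator[of z] z by simp
  then have "0 < (1 - (norm z)\<^sup>2) * ((1 - (norm a)\<^sup>2) / (norm (1 - cnj a * z))\<^sup>2)"
    using z a by (intro mult_pos_pos divide_pos_pos) (auto simp: abs_square_less_1)
  then have "(norm (disk_swap a z))\<^sup>2 < 1" using one_minus_norm_swap[of z] z by simp
  then show ?thesis by (simp add: abs_square_less_1)
qed

lemma norm_swap_eq: "norm z = 1 \<Longrightarrow> norm (disk_swap a z) = 1"
  using one_minus_norm_swap[of z] by (simp add: power2_eq_1_iff) (smt (verit) norm_ge_zero)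

lemma swap_swap: "norm z \<le> 1 \<Longrightarrow> disk_swap a (disk_swap a z) = z"
proof -
  assume "norm z \<le> 1"
  then have d: "1 - cnj a * z \<noteq> 0" by (rule swap_denominator)
  have n: "1 - a * cnj a \<noteq> 0" using swap_denominator[of a] a by (simp add: mult.commute)
  have 1: "a - (a - z) / (1 - cnj a * z) = z * (1 - a * cnj a) / (1 - cnj a * z)"
    using d by (simp add: field_simps)
  have 2: "1 - cnj a * ((a - z) / (1 - cnj a * z)) = (1 - a * cnj a) / (1 - cnj a * z)"
    using d by (simp add: field_simps)
  show ?thesis unfolding disk_swap_def 1 2 using d n by simp
qed

lemma swap_center [simp]: "disk_swap a 0 = a" "disk_swap a a = 0"
  by (simp_all add: disk_swap_def)

lemma swap_derivative:
  assumes "norm z \<le> 1"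
  shows "(disk_swap a has_field_derivative - of_real (1 - (norm a)\<^sup>2) / (1 - cnj a * z)\<^sup>2) (at z)"
proof -
  have d: "1 - cnj a * z \<noteq> 0" using swap_denominator[OF assms] .
  have "((\<lambda>z. (a - z) / (1 - cnj a * z)) has_field_derivative
      ((0 - 1) * (1 - cnj a * z) - (a - z) * (0 - cnj a)) / ((1 - cnj a * z) * (1 - cnj a * z))) (at z)"
    by (intro DERIV_divide DERIV_diff DERIV_const DERIV_ident DERIV_cmult d)
        (auto intro!: derivative_eq_intros)
  moreover have "(0 - 1) * (1 - cnj a * z) - (a - z) * (0 - cnj a) = - of_real (1 - (norm a)\<^sup>2)"
    unfolding of_real_diff complex_norm_square by (simp add: algebra_simps)
  ultimately show ?thesis unfolding disk_swap_def[abs_def] power2_eq_square by (simp only:)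
qed

lemma swap_continuous: "continuous_on (cball 0 1) (disk_swap a)"
  by (intro continuous_at_imp_continuous_on ballI DERIV_isCont[OF swap_derivative]) auto

lemma swap_holomorphic: "disk_swap a holomorphic_on ball 0 1"
  unfolding holomorphic_on_open[OF open_ball] using swap_derivative
  by (meson less_imp_le mem_ball_0)

lemma bij_swap: "bij_betw (disk_swap a) (ball 0 1) (ball 0 1)"
  by (rule bij_betwI[where g = "disk_swap a"]) (auto simp: swap_swap norm_swap_less)

text \<open>Since \<open>1 - \<bar>s z\<bar>\<^sup>2 = (1 - \<bar>z\<bar>\<^sup>2) \<bar>s' z\<bar>\<close>, the quotient of the weights is a power of \<open>\<bar>s' z\<bar>\<close>,
  which is bounded below by \<open>(1 - \<bar>a\<bar>) / (1 + \<bar>a\<bar>)\<close>.\<close>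

lemma swap_weight:
  assumes \<alpha>: "\<alpha> > -1" and z: "norm z < 1"
  shows "bergman_weight \<alpha> z \<le> ((1 + norm a) / (1 - norm a)) powr (2 + \<alpha>) *
    ((norm (- of_real (1 - (norm a)\<^sup>2) / (1 - cnj a * z)\<^sup>2))\<^sup>2 * bergman_weight \<alpha> (disk_swap a z))"
proof -
  define d where "d = (1 - (norm a)\<^sup>2) / (norm (1 - cnj a * z))\<^sup>2"
  define m where "m = (1 + norm a) / (1 - norm a)"
  have den: "0 < norm (1 - cnj a * z)" using swap_denominator[of z] z by simp
  have a2: "0 < 1 - (norm a)\<^sup>2" using a by (simp add: abs_square_less_1)
  have z2: "0 < 1 - (norm z)\<^sup>2" using z by (simp add: abs_square_less_1)
  have dpos: "d > 0" unfolding d_def using den a2 by simp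
  have mpos: "m > 0" unfolding m_def using a norm_ge_zero[of a] by (intro divide_pos_pos) linarith+
  have "norm (1 - cnj a * z) \<le> 1 + norm a"
  proof -
    have "norm (1 - cnj a * z) \<le> 1 + norm (cnj a * z)" using norm_triangle_ineq4[of 1 "cnj a * z"]
        by simp
    also have "norm (cnj a * z) \<le> norm a * 1" unfolding norm_mult using z by (intro mult_mono) auto
    finally show ?thesis by simp
  qed
  then have "(norm (1 - cnj a * z))\<^sup>2 \<le> (1 + norm a)\<^sup>2" by (intro power_mono) auto
  then have "1 / m \<le> d"
  proof -
    have "1 / m = (1 - (norm a)\<^sup>2) / (1 + norm a)\<^sup>2"
    proof -
      have "1 - (norm a)\<^sup>2 = (1 - norm a) * (1 + norm a)" by (simp add: power2_eq_square algebra_simps)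
      moreover have "1 + norm a \<noteq> 0" using norm_ge_zero[of a] by linarith
      ultimately show ?thesis by (simp add: m_def power2_eq_square)
    qed
    also have "\<dots> \<le> d" unfolding d_def 
      using \<open>_ \<le> (1 + norm a)\<^sup>2\<close> a2 den norm_ge_zero[of a]
      by (intro divide_left_mono mult_pos_pos zero_less_power) linarith+
    finally show ?thesis .
  qed
  then have md: "1 \<le> m * d" using mpos by (simp add: field_simps)
  have dn: "norm (- of_real (1 - (norm a)\<^sup>2) / (1 - cnj a * z)\<^sup>2) = d"
    unfolding d_def norm_divide norm_minus_cancel norm_power norm_of_real using a2 by simp
  have "m powr (2 + \<alpha>) * (d\<^sup>2 * d powr \<alpha>) = (m * d) powr (2 + \<alpha>)"
    using mpos dpos by (simp add: powr_mult powr_add)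
  also have "\<dots> \<ge> 1" using md \<alpha> by (intro ge_one_powr_ge_zero) auto
  finally have ge1: "1 \<le> m powr (2 + \<alpha>) * (d\<^sup>2 * d powr \<alpha>)" .
  have "bergman_weight \<alpha> (disk_swap a z) = bergman_weight \<alpha> z * d powr \<alpha>"
    unfolding bergman_weight_def
    using one_minus_norm_swap[of z] z z2 dpos by (simp add: d_def[symmetric] powr_mult)
  then have "m powr (2 + \<alpha>) * (d\<^sup>2 * bergman_weight \<alpha> (disk_swap a z)) =
      (m powr (2 + \<alpha>) * (d\<^sup>2 * d powr \<alpha>)) * bergman_weight \<alpha> z" by (simp add: mult_ac)
  also have "\<dots> \<ge> 1 * bergman_weight \<alpha> z"
    using ge1 bergman_weight_pos[OF \<alpha>, of z] z by (intro mult_right_mono) auto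
  finally show ?thesis unfolding dn m_def by simp
qed

lemma bergman_swap:
  assumes \<alpha>: "\<alpha> > -1" and f: "f \<in> bergman_space \<alpha>"
  shows "(\<lambda>z. if z \<in> ball 0 1 then f (disk_swap a z) else 0) \<in> bergman_space \<alpha> \<and>
    bergman_norm \<alpha> (\<lambda>z. if z \<in> ball 0 1 then f (disk_swap a z) else 0)
      \<le> sqrt (((1 + norm a) / (1 - norm a)) powr (2 + \<alpha>)) * bergman_norm \<alpha> f"
proof (rule bergman_composition[OF \<alpha> f])
  show "(disk_swap a has_field_derivative - of_real (1 - (norm a)\<^sup>2) / (1 - cnj a * z)\<^sup>2) (at z)"
    if "z \<in> ball 0 1" for z using that by (intro swap_derivative) auto
  show "continuous_on (ball 0 1) (\<lambda>z. - of_real (1 - (norm a)\<^sup>2) / (1 - cnj a * z)\<^sup>2)"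
    using swap_denominator by (intro continuous_intros) auto
qed (use bij_swap swap_weight[OF \<alpha>] in auto)

end

context
  fixes \<alpha> :: real
  assumes \<alpha>: "\<alpha> > -1"
begin

lemma bergman_one: "(\<lambda>z. if z \<in> ball 0 1 then 1 else 0) \<in> bergman_space \<alpha>"
proof -
  have "disk_energy \<alpha> (\<lambda>z. if z \<in> ball 0 1 then 1 else 0) = disk_energy \<alpha> (\<lambda>z. 1)"
    unfolding disk_energy_def by (intro nn_integral_cong) (auto simp: indicator_def)
  then show ?thesis
    unfolding bergman_space_iff[OF \<alpha>] using energy_const(1)[OF \<alpha>]
    by (auto intro: holomorphic_transform[of "\<lambda>_. 1"] holomorphic_on_const)
qed

text \<open>The averages of \<open>f\<close> over rotations by roots of unity have norm at most that of \<open>f\<close> and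
  converge to the constant \<open>f 0\<close>; Fatou's lemma then bounds the norm of that constant.\<close>

lemma bergman_evaluation_at_0:
  "\<exists>C\<ge>0. \<forall>f\<in>bergman_space \<alpha>. norm (f 0) \<le> C * bergman_norm \<alpha> f"
proof -
  let ?one = "\<lambda>z::complex. if z \<in> ball 0 1 then 1 else 0 :: complex"
  define W where "W = bergman_norm \<alpha> ?one"
  have "ennreal (W\<^sup>2) = disk_energy \<alpha> (\<lambda>z. 1)"
    unfolding W_def energy_eq_norm[OF \<alpha> bergman_one, symmetric]
    unfolding disk_energy_def by (intro nn_integral_cong) (auto simp: indicator_def)
  then have W: "W > 0" using energy_const(2)[OF \<alpha>] bergman_norm_nonneg[OF \<alpha>, of ?one]
    unfolding W_def[symmetric] by (auto simp: less_le)
  have "norm (f 0) * W \<le> bergman_norm \<alpha> f" if f: "f \<in> bergman_space \<alpha>" for f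
  proof -
    have hol: "f holomorphic_on ball 0 1" using f unfolding bergman_space_def by auto
    define R where "R n j = (\<lambda>z. if z \<in> ball 0 1 then f (cis (2 * pi / real (Suc n)) ^ j * z) else 0)"
        for n j
    have R: "R n j \<in> bergman_space \<alpha>" "bergman_norm \<alpha> (R n j) \<le> bergman_norm \<alpha> f" for n j
      using bergman_rotation[OF \<alpha> f, of "cis (2 * pi / real (Suc n)) ^ j"]
      unfolding R_def by (auto simp: norm_power)
    have sumR: "(\<lambda>z. \<Sum>j<m. R n j z) \<in> bergman_space \<alpha> \<and>
        bergman_norm \<alpha> (\<lambda>z. \<Sum>j<m. R n j z) \<le> real m * bergman_norm \<alpha> f" for n m
    proof (induction m)
      case 0
      show ?case using bergman_zero[OF \<alpha>] by (simp add: bergman_norm_def)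
    next
      case (Suc m)
      then show ?case
        using bergman_add[OF \<alpha> conjunct1[OF Suc] R(1)[of n m]] R(2)[of n m] by (simp add: algebra_simps)
    qed
    define A where "A n = (\<lambda>z. (1 / of_nat (Suc n)) * (\<Sum>j<Suc n. R n j z))" for n
    have A: "A n \<in> bergman_space \<alpha>" "bergman_norm \<alpha> (A n) \<le> bergman_norm \<alpha> f" for n
    proof -
      show "A n \<in> bergman_space \<alpha>" unfolding A_def using sumR by (intro bergman_scale \<alpha>) blast
      have "bergman_norm \<alpha> (A n) = norm (1 / of_nat (Suc n) :: complex) * bergman_norm \<alpha>
          (\<lambda>z. \<Sum>j<Suc n. R n j z)"
        unfolding A_def using sumR by (intro bergman_scale \<alpha>) blast
      also have "\<dots> = bergman_norm \<alpha> (\<lambda>z. \<Sum>j<Suc n. R n j z) / real (Suc n)"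
        unfolding norm_divide norm_of_nat by simp
      also have "\<dots> \<le> bergman_norm \<alpha> f"
        using sumR[where n = n and m = "Suc n"] by (simp only: pos_divide_le_eq of_nat_0_less_iff
            zero_less_Suc mult.commute)
      finally show "bergman_norm \<alpha> (A n) \<le> bergman_norm \<alpha> f" .
    qed
    have "(\<lambda>z. f 0 * ?one z) \<in> bergman_space \<alpha> \<and> bergman_norm \<alpha> (\<lambda>z. f 0 * ?one z) \<le> bergman_norm \<alpha> f"
    proof (rule bergman_fatou[OF \<alpha> A])
      fix z :: complex assume z: "z \<in> ball 0 1"
      have "A n z = (\<Sum>j<Suc n. f (cis (2 * pi / real (Suc n)) ^ j * z)) / of_nat (Suc n)" for n
        unfolding A_def R_def using z by simp
      then show "(\<lambda>n. A n z) \<longlonglongrightarrow> f 0 * ?one z"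
        using tendsto_average_over_roots[OF hol z] z by simp
    qed (use bergman_one in \<open>auto simp: bergman_space_def intro!: holomorphic_intros\<close>)
    then show ?thesis using bergman_scale(2)[OF \<alpha> bergman_one, of "f 0"] by (simp add: W_def)
  qed
  then show ?thesis using W by (intro exI[of _ "1 / W"]) (auto simp: field_simps)
qed

text \<open>Composition with the involution at \<open>z\<close> moves the evaluation at \<open>z\<close> to the evaluation at \<open>0\<close>,
  with a bound that is uniform on compact sets.\<close>

lemma bergman_evaluation:
  assumes "r < 1"
  shows "\<exists>C\<ge>0. \<forall>f\<in>bergman_space \<alpha>. \<forall>z. norm z \<le> r \<longrightarrow> norm (f z) \<le> C * bergman_norm \<alpha> f"
proof -
  obtain C where C: "C \<ge> 0" "\<And>f. f \<in> bergman_space \<alpha> \<Longrightarrow> norm (f 0) \<le> C * bergman_norm \<alpha> f"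
    using bergman_evaluation_at_0 by blast
  define L where "L = sqrt (((1 + r) / (1 - r)) powr (2 + \<alpha>))"
  have "norm (f z) \<le> C * L * bergman_norm \<alpha> f" if f: "f \<in> bergman_space \<alpha>" and z: "norm z \<le> r" for f z
  proof -
    let ?g = "\<lambda>w. if w \<in> ball 0 1 then f (disk_swap z w) else 0"
    have z1: "norm z < 1" using z assms by simp
    have r0: "0 \<le> 1 + r" using z norm_ge_zero[of z] by linarith
    have "norm (f z) = norm (?g 0)" using z1 by simp
    also have "\<dots> \<le> C * bergman_norm \<alpha> ?g" using bergman_swap[OF z1 \<alpha> f] by (intro C(2)) blast
    also have "bergman_norm \<alpha> ?g \<le> sqrt (((1 + norm z) / (1 - norm z)) powr (2 + \<alpha>)) * bergman_norm \<alpha> f"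
      using bergman_swap[OF z1 \<alpha> f] by blast
    also have "sqrt (((1 + norm z) / (1 - norm z)) powr (2 + \<alpha>)) \<le> L"
      unfolding L_def using z z1 assms \<alpha> norm_ge_zero[of z]
      by (intro real_sqrt_le_mono powr_mono2 frac_le) (auto simp: r0)
    finally show ?thesis using C(1) bergman_norm_nonneg[OF \<alpha>, of f]
      by (simp add: mult_left_mono mult_right_mono mult.assoc)
  qed
  moreover have "0 \<le> C * L" unfolding L_def using C by simp
  ultimately show ?thesis by blast
qed

lemma bergman_weakly_compact:
  assumes F: "\<And>n. F n \<in> bergman_space \<alpha>" "\<And>n::nat. bergman_norm \<alpha> (F n) \<le> B"
  shows "\<exists>f\<in>bergman_space \<alpha>. \<exists>r. strict_mono r \<and> bergman_norm \<alpha> f \<le> B \<and> (\<forall>z. (\<lambda>n. F (r n) z) \<longlonglongrightarrow> f z)"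
proof -
  define H where "H = {f \<in> bergman_space \<alpha>. bergman_norm \<alpha> f \<le> B}"
  obtain g r where g: "g holomorphic_on ball 0 1" "strict_mono r"
    "\<And>z. z \<in> ball 0 1 \<Longrightarrow> (\<lambda>n. F (r n) z) \<longlonglongrightarrow> g z"
  proof (rule Montel[where \<H> = H and \<F> = F and S = "ball 0 1"])
    show "\<And>h. h \<in> H \<Longrightarrow> h holomorphic_on ball 0 1" unfolding H_def bergman_space_def by blast
    show "range F \<subseteq> H" unfolding H_def using F by auto
    fix K :: "complex set" assume K: "compact K" "K \<subseteq> ball 0 1"
    show "\<exists>B. \<forall>h\<in>H. \<forall>z\<in>K. norm (h z) \<le> B"
    proof (cases "K = {}")
      case False
      obtain z0 where z0: "z0 \<in> K" "\<forall>z\<in>K. norm z \<le> norm z0"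
        using continuous_attains_sup[OF K(1) False continuous_on_norm[OF continuous_on_id]] by auto
      then have "norm z0 < 1" using K by auto
      then obtain C where C: "C \<ge> 0" "\<And>f z. f \<in> bergman_space \<alpha> \<Longrightarrow> norm z \<le> norm z0 \<Longrightarrow> norm (f z)
          \<le> C * bergman_norm \<alpha> f"
        using bergman_evaluation by blast
      have "norm (h z) \<le> C * B" if "h \<in> H" "z \<in> K" for h z
      proof -
        have "norm (h z) \<le> C * bergman_norm \<alpha> h" using that z0 by (intro C) (auto simp: H_def)
        also have "\<dots> \<le> C * B" using that C(1) by (intro mult_left_mono) (auto simp: H_def)
        finally show ?thesis .
      qed
      then show ?thesis by blast
    qed auto
  qed auto
  define f where "f = (\<lambda>z. if z \<in> ball 0 1 then g z else 0)"
  have f: "f holomorphic_on ball 0 1" "\<And>z. z \<notin> ball 0 1 \<Longrightarrow> f z = 0"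
    unfolding f_def by (rule holomorphic_transform[OF g(1)]) auto
  have lim: "(\<lambda>n. F (r n) z) \<longlonglongrightarrow> f z" for z
  proof (cases "z \<in> ball 0 1")
    case False
    then show ?thesis using F(1) unfolding f_def bergman_space_def by simp
  qed (use g(3) in \<open>simp add: f_def\<close>)
  have "f \<in> bergman_space \<alpha> \<and> bergman_norm \<alpha> f \<le> B"
    by (rule bergman_fatou[OF \<alpha>, where F = "\<lambda>n. F (r n)"]) (use F f lim in auto)
  with lim g(2) show ?thesis by blast
qed

lemma bergman_evaluation_space: "evaluation_space (bergman_space \<alpha>) (bergman_norm \<alpha>)"
proof
  fix z :: complex
  show "\<exists>C. \<forall>f\<in>bergman_space \<alpha>. norm (f z) \<le> C * bergman_norm \<alpha> f"
  proof (cases "norm z < 1")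
    case True
    then show ?thesis using bergman_evaluation[OF True] by blast
  next
    case False
    then show ?thesis by (intro exI[of _ 0]) (auto simp: bergman_space_def)
  qed
qed (use bergman_zero bergman_add bergman_scale bergman_norm_nonneg bergman_weakly_compact \<alpha> in auto)

lemma bergman_multiplier:
  assumes f: "f \<in> bergman_space \<alpha>" and h: "h holomorphic_on ball 0 1"
    and B: "0 \<le> B" "\<And>z. z \<in> ball 0 1 \<Longrightarrow> norm (h z) \<le> B"
  shows "(\<lambda>z. h z * f z) \<in> bergman_space \<alpha> \<and> bergman_norm \<alpha> (\<lambda>z. h z * f z) \<le> B * bergman_norm \<alpha> f"
proof (rule bergman_comparison[OF \<alpha> f])
  show "(\<lambda>z. h z * f z) holomorphic_on ball 0 1" using f by (intro holomorphic_intros h)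
      (simp add: bergman_space_def)
qed (use f B in \<open>auto simp: bergman_space_def norm_mult intro!: mult_right_mono\<close>)

lemma bergman_bounded:
  assumes h: "h holomorphic_on ball 0 1" and B: "\<And>z. z \<in> ball 0 1 \<Longrightarrow> norm (h z) \<le> B"
  shows "(\<lambda>z. if z \<in> ball 0 1 then h z else 0) \<in> bergman_space \<alpha>"
proof -
  have "0 \<le> B" using B[of 0] norm_ge_zero[of "h 0"] by (simp del: norm_ge_zero)
  then have "(\<lambda>z. h z * (if z \<in> ball 0 1 then 1 else 0)) \<in> bergman_space \<alpha>"
    using bergman_multiplier[OF bergman_one h _ B] by blast
  then show ?thesis by (simp add: if_distrib cong: if_cong)
qed

text \<open>The quotient is at most \<open>2 \<bar>f z\<bar>\<close> where \<open>\<bar>z\<bar> > 1/2\<close>, and by the maximum principle it is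
  bounded by values of \<open>f\<close> on the circle \<open>\<bar>z\<bar> = 1/2\<close> in the rest of the disk.\<close>

lemma bergman_divide_by_z:
  "\<exists>K\<ge>0. \<forall>f\<in>bergman_space \<alpha>. f 0 = 0 \<longrightarrow>
    (\<exists>u\<in>bergman_space \<alpha>. bergman_norm \<alpha> u \<le> K * bergman_norm \<alpha> f \<and> (\<forall>z. f z = z * u z))"
proof -
  let ?one = "\<lambda>z::complex. if z \<in> ball 0 1 then 1 else 0 :: complex"
  obtain C where C: "C \<ge> 0" "\<And>f z. f \<in> bergman_space \<alpha> \<Longrightarrow> norm z \<le> 1 / 2 \<Longrightarrow> norm (f z)
      \<le> C * bergman_norm \<alpha> f"
    using bergman_evaluation[of "1 / 2"] by auto
  define K where "K = sqrt ((2 * C)\<^sup>2 * (bergman_norm \<alpha> ?one)\<^sup>2 + 4)"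
  have "\<exists>u\<in>bergman_space \<alpha>. bergman_norm \<alpha> u \<le> K * bergman_norm \<alpha> f \<and> (\<forall>z. f z = z * u z)"
    if f: "f \<in> bergman_space \<alpha>" and f0: "f 0 = 0" for f
  proof -
    have hol: "f holomorphic_on ball 0 1" and off: "\<And>z. z \<notin> ball 0 1 \<Longrightarrow> f z = 0"
      using f unfolding bergman_space_def by auto
    define q where "q z = (if z = 0 then deriv f 0 else f z / z)" for z
    have "(\<lambda>z. if z = 0 then deriv f 0 else (f z - f 0) / (z - 0)) holomorphic_on ball 0 1"
      by (rule pole_lemma[OF hol]) auto
    moreover have "(\<lambda>z. if z = 0 then deriv f 0 else (f z - f 0) / (z - 0)) = q"
      by (auto simp: q_def f0)
    ultimately have q: "q holomorphic_on ball 0 1" by (simp only:)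
    define u where "u z = (if z \<in> ball 0 1 then q z else 0)" for z
    have u: "u holomorphic_on ball 0 1" unfolding u_def by (rule holomorphic_transform[OF q]) simp
    have fu: "f z = z * u z" for z unfolding u_def q_def using off f0 by auto
    have inner: "norm (u z) \<le> 2 * C * bergman_norm \<alpha> f" if z: "norm z \<le> 1 / 2" for z
    proof -
      have "norm (q z) \<le> 2 * (C * bergman_norm \<alpha> f)"
      proof (rule maximum_modulus_frontier[of q "cball 0 (1/2)"])
        show "q holomorphic_on interior (cball 0 (1/2))" by (rule holomorphic_on_subset[OF q]) auto
        show "continuous_on (closure (cball 0 (1/2))) q"
          by (rule continuous_on_subset[OF holomorphic_on_imp_continuous_on[OF q]]) auto
        fix w :: complex assume "w \<in> frontier (cball 0 (1/2))"
        then have w: "norm w = 1 / 2" by simp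
        then have "w \<noteq> 0" by auto
        then have "norm (q w) = norm (f w) / (1 / 2)" unfolding q_def w[symmetric] by
            (simp add: norm_divide)
        then have "norm (q w) = 2 * norm (f w)" by simp
        then show "norm (q w) \<le> 2 * (C * bergman_norm \<alpha> f)" using C(2)[OF f, of w] w by simp
      qed (use z in auto)
      then show ?thesis using z by (simp add: u_def)
    qed
    have outer: "norm (u z) \<le> 2 * norm (f z)" if "norm z > 1 / 2" for z
    proof -
      have "norm (u z) * (1 / 2) \<le> norm (u z) * norm z" using that by (intro mult_left_mono) auto
      then show ?thesis unfolding fu norm_mult by (simp add: mult.commute)
    qed
    have "(norm (u z))\<^sup>2 \<le> (2 * C * bergman_norm \<alpha> f)\<^sup>2 * (norm (?one z))\<^sup>2 + 4 * (norm (f z))\<^sup>2"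
      if "z \<in> ball 0 1" for z
    proof (cases "norm z \<le> 1 / 2")
      case True
      have "(norm (u z))\<^sup>2 \<le> (2 * C * bergman_norm \<alpha> f)\<^sup>2" using inner[OF True] by (intro power_mono) auto
      then show ?thesis using that by (simp add: add_increasing2)
    next
      case False
      then have "(norm (u z))\<^sup>2 \<le> (2 * norm (f z))\<^sup>2" using outer[of z] by (intro power_mono) auto
      then show ?thesis by (simp add: power_mult_distrib add_increasing)
    qed
    from energy_mono_combination[OF \<alpha> bergman_one f _ _ this]
    have E: "disk_energy \<alpha> u \<le> ennreal ((2 * C * bergman_norm \<alpha> f)\<^sup>2 * (bergman_norm \<alpha> ?one)\<^sup>2 + 4 *
        (bergman_norm \<alpha> f)\<^sup>2)"
      by simp
    have "(2 * C * bergman_norm \<alpha> f)\<^sup>2 * (bergman_norm \<alpha> ?one)\<^sup>2 + 4 * (bergman_norm \<alpha> f)\<^sup>2 =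
        (K * bergman_norm \<alpha> f)\<^sup>2"
      unfolding K_def power_mult_distrib by (subst real_sqrt_pow2) (auto simp: algebra_simps)
    with E have E': "disk_energy \<alpha> u \<le> ennreal ((K * bergman_norm \<alpha> f)\<^sup>2)" by (simp only:)
    have "u \<in> bergman_space \<alpha> \<and> bergman_norm \<alpha> u \<le> K * bergman_norm \<alpha> f"
      by (rule bergmanI[OF \<alpha> u _ E']) (auto simp: u_def K_def bergman_norm_nonneg[OF \<alpha>])
    with fu show ?thesis by blast
  qed
  moreover have "K \<ge> 0" unfolding K_def by simp
  ultimately show ?thesis by blast
qed

end


section \<open>Poisson integrals, Hardy functions and outer parts\<close>

abbreviation circle_measure :: "real measure"
  where "circle_measure \<equiv> lebesgue_on {0..2 * pi}"

definition poisson_kernel :: "complex \<Rightarrow> real \<Rightarrow> real"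
  where "poisson_kernel z t = (1 - (norm z)\<^sup>2) / (norm (cis t - z))\<^sup>2"

lemma circle_distance:
  assumes "norm z < 1"
  shows "1 - norm z \<le> norm (cis t - z)" "cis t \<noteq> z"
  using norm_triangle_ineq2[of "cis t" z] assms by auto

lemma poisson_kernel_nonneg: "norm z < 1 \<Longrightarrow> 0 \<le> poisson_kernel z t"
  by (simp add: poisson_kernel_def power_le_one)

lemma poisson_kernel_le:
  assumes "norm z < 1"
  shows "poisson_kernel z t \<le> (1 + norm z) / (1 - norm z)"
proof -
  have "poisson_kernel z t \<le> (1 - (norm z)\<^sup>2) / (1 - norm z)\<^sup>2"
    unfolding poisson_kernel_def using assms circle_distance[OF assms, of t]
    by (intro divide_left_mono power_mono) (auto simp: power_le_one)
  also have "\<dots> = (1 + norm z) / (1 - norm z)"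
    using assms by (simp add: power2_eq_square divide_simps) (simp add: algebra_simps)
  finally show ?thesis .
qed

lemma continuous_on_poisson_kernel: "norm z < 1 \<Longrightarrow> continuous_on S (poisson_kernel z)"
  unfolding poisson_kernel_def using circle_distance(2)[of z]
  by (intro continuous_intros) auto

lemma continuous_on_circle:
  assumes "continuous_on (sphere 0 r) f" "0 \<le> r"
  shows "continuous_on S (\<lambda>t. f (of_real r * cis t))"
  by (rule continuous_on_compose2[OF assms(1)]) (use assms(2) in \<open>auto intro!: continuous_intros simp:
      norm_mult\<close>)

lemma integrable_circle:
  fixes f :: "real \<Rightarrow> 'b::euclidean_space"
  assumes "continuous_on {0..2 * pi} f"
  shows "integrable circle_measure f"
  by (rule continuous_imp_integrable_real[OF assms])

text \<open>Cauchy's formula for \<open>u \<mapsto> f u * (1 - \<bar>z\<bar>\<^sup>2) / (1 - cnj z * u)\<close>, a function with the same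
  value at \<open>z\<close>: on the circle its Cauchy kernel becomes positive.\<close>

lemma poisson_formula:
  assumes f: "continuous_on (cball 0 1) f" "f holomorphic_on ball 0 1" and z: "norm z < 1"
  shows "complex_of_real (2 * pi) * f z = (LINT t|circle_measure. of_real (poisson_kernel z t) * f
      (cis t))"
    and "integrable circle_measure (\<lambda>t. of_real (poisson_kernel z t) * f (cis t))"
proof -
  have ne: "1 - cnj z * u \<noteq> 0" if "norm u \<le> 1" for u
  proof
    assume "1 - cnj z * u = 0"
    then have "norm (cnj z * u) = 1" by simp
    moreover have "norm (cnj z * u) \<le> norm z * 1" unfolding norm_mult using that by
        (intro mult_mono) auto
    ultimately show False using z by simp
  qed
  let ?F = "\<lambda>u. f u * (of_real (1 - (norm z)\<^sup>2) / (1 - cnj z * u))"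
  have "((\<lambda>u. ?F u / (u - z)) has_contour_integral (2 * of_real pi * \<i> * ?F z)) (circlepath 0 1)"
    using ne z by (intro Cauchy_integral_circlepath continuous_intros holomorphic_intros f) auto
  moreover have Fz: "?F z = f z"
    using ne[of z] z by (simp add: complex_norm_square[symmetric] mult.commute flip: of_real_power)
  ultimately have "((\<lambda>u. ?F u / (u - z)) has_contour_integral (2 * of_real pi * \<i> * f z))
      (circlepath 0 1)"
    by (simp only: Fz)
  then have "((\<lambda>t. ?F (cis t) / (cis t - z) * \<i> * cis t) has_integral
      (2 * of_real pi * \<i> * f z)) {0..2 * pi}"
    unfolding circlepath_def by (subst (asm) has_contour_integral_part_circlepath_iff)
        (auto simp: mult_ac)
  then have "((\<lambda>t. - \<i> * (?F (cis t) / (cis t - z) * \<i> * cis t)) has_integral - \<i> *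
      (2 * of_real pi * \<i> * f z)) {0..2 * pi}"
    by (rule has_integral_mult_right)
  moreover have "- \<i> * (?F (cis t) / (cis t - z) * \<i> * cis t) = of_real (poisson_kernel z t) * f
      (cis t)" for t
  proof -
    \<comment> \<open>On the circle \<open>cis t\<close> is the inverse of its conjugate.\<close>
    have "1 - cnj z * cis t = cis t * cnj (cis t - z)"
      by (simp add: algebra_simps cis_cnj cis_mult)
    then have "(1 - cnj z * cis t) * (cis t - z) = cis t * of_real ((norm (cis t - z))\<^sup>2)"
      unfolding complex_norm_square by (simp only: mult_ac)
    then have "?F (cis t) / (cis t - z) * cis t
        = f (cis t) * of_real (1 - (norm z)\<^sup>2) * cis t / (cis t * of_real ((norm (cis t - z))\<^sup>2))"
      by (metis divide_divide_eq_left times_divide_eq_left times_divide_eq_right)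
    also have "\<dots> = of_real (poisson_kernel z t) * f (cis t)"
      unfolding poisson_kernel_def of_real_divide by simp
    finally show ?thesis by (simp add: mult_ac)
  qed
  moreover have "- \<i> * (2 * of_real pi * \<i> * f z) = 2 * of_real pi * f z"
    by (simp add: algebra_simps)
  ultimately have "((\<lambda>t. of_real (poisson_kernel z t) * f (cis t)) has_integral
      (2 * of_real pi * f z)) {0..2 * pi}"
    by (simp only:)
  moreover show int: "integrable circle_measure (\<lambda>t. of_real (poisson_kernel z t) * f (cis t))"
    using continuous_on_circle[of 1 f "{0..2 * pi}"] continuous_on_subset[OF f(1), of "sphere 0 1"]
    by (intro integrable_circle continuous_intros continuous_on_poisson_kernel z) auto
  ultimately show "complex_of_real (2 * pi) * f z = (LINT t|circle_measure. of_real
      (poisson_kernel z t) * f (cis t))"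
    using lebesgue_integral_eq_integral[OF int] by (simp add: integral_unique)
qed

lemma poisson_formula_Re:
  assumes f: "continuous_on (cball 0 1) f" "f holomorphic_on ball 0 1" and z: "norm z < 1"
  shows "2 * pi * Re (f z) = (LINT t|circle_measure. poisson_kernel z t * Re (f (cis t)))"
    and "integrable circle_measure (\<lambda>t. poisson_kernel z t * Re (f (cis t)))"
proof -
  have eq: "Re (of_real (poisson_kernel z t) * f (cis t)) = poisson_kernel z t * Re (f (cis t))" for t
      by simp
  show "2 * pi * Re (f z) = (LINT t|circle_measure. poisson_kernel z t * Re (f (cis t)))"
    using arg_cong[OF poisson_formula(1)[OF assms], of Re] integral_Re[OF poisson_formula(2)[OF assms]]
    by (simp add: eq)
  show "integrable circle_measure (\<lambda>t. poisson_kernel z t * Re (f (cis t)))"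
    using integrable_Re[OF poisson_formula(2)[OF assms]] by (simp add: eq)
qed

lemma poisson_kernel_integral:
  assumes "norm z < 1"
  shows "(LINT t|circle_measure. poisson_kernel z t) = 2 * pi" "integrable circle_measure
      (poisson_kernel z)"
  using poisson_formula_Re[of "\<lambda>_. 1" z] assms by simp_all

lemma mean_value_Re:
  assumes f: "continuous_on (cball 0 1) f" "f holomorphic_on ball 0 1"
  shows "2 * pi * Re (f 0) = (LINT t|circle_measure. Re (f (cis t)))"
    and "integrable circle_measure (\<lambda>t. Re (f (cis t)))"
  using poisson_formula_Re[OF f, of 0] by (simp_all add: poisson_kernel_def)

lemma dilation:
  assumes f: "f holomorphic_on ball 0 1" and r: "0 \<le> r" "r < 1"
  shows "continuous_on (cball 0 1) (\<lambda>w. f (of_real r * w))" "(\<lambda>w. f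
      (of_real r * w)) holomorphic_on ball 0 1"
proof -
  have "(\<lambda>w. f (of_real r * w)) holomorphic_on cball 0 1"
  proof (rule holomorphic_on_compose_gen[of "\<lambda>w. of_real r * w" _ f "ball 0 1", unfolded o_def])
    show "(*) (complex_of_real r) ` cball 0 1 \<subseteq> ball 0 1"
    proof safe
      fix w :: complex assume "w \<in> cball 0 1"
      then have "r * norm w \<le> r * 1" using r by (intro mult_left_mono) auto
      then show "of_real r * w \<in> ball 0 1" using r by (simp add: norm_mult)
    qed
  qed (auto intro!: holomorphic_intros f)
  then show "continuous_on (cball 0 1) (\<lambda>w. f (of_real r * w))" "(\<lambda>w. f
      (of_real r * w)) holomorphic_on ball 0 1"
    by (auto intro: holomorphic_on_imp_continuous_on holomorphic_on_subset)
qed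

text \<open>Apply the Poisson formula on circles of radius \<open>r < 1\<close> and let \<open>r\<close> tend to \<open>1\<close>. The bound on
  squares makes the boundary values uniformly integrable: values above \<open>M\<close> contribute at most a
  constant times \<open>1 / M\<close>, and the truncated values converge dominatedly.\<close>

lemma hardy_maximum_principle:
  assumes f: "f holomorphic_on ball 0 1"
    and B: "\<And>r. 0 < r \<Longrightarrow> r < 1 \<Longrightarrow> (LINT t|circle_measure. (norm (f (of_real r * cis t)))\<^sup>2) \<le> B"
    and bd: "AE t in circle_measure. \<exists>l. ((\<lambda>r. f (of_real r * cis t)) \<longlongrightarrow> l) (at_left 1) \<and> norm l \<le> 1"
    and z: "norm z < 1"
  shows "norm (f z) \<le> 1"
proof -
  define C where "C = (1 + norm z) / (1 - norm z)"
  have C: "poisson_kernel z t \<le> C" for t unfolding C_def by (rule poisson_kernel_le[OF z])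
  have C0: "0 \<le> C" unfolding C_def using z by simp
  define r where "r n = 1 - 1 / real (n + 2)" for n
  have r: "0 < r n" "r n < 1" for n unfolding r_def by (auto simp: field_simps)
  have rlim: "r \<longlonglongrightarrow> 1"
    unfolding r_def by real_asymp
  have rfilter: "filterlim r (at_left 1) sequentially"
    unfolding filterlim_at using rlim r by (auto intro: always_eventually simp: less_imp_neq)
  have cont: "continuous_on {0..2 * pi} (\<lambda>t. f (of_real (r n) * cis t))" for n
    using r[of n] by (intro continuous_on_circle continuous_on_subset[OF
        holomorphic_on_imp_continuous_on[OF f]]) auto
  have main: "norm (f z) \<le> 1 + C * B / (2 * pi * M)" if M: "0 < M" for M
  proof -
    define Y where "Y n t = max (min (norm (f (of_real (r n) * cis t))) M - 1) 0" for n t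
    have Ycont: "continuous_on {0..2 * pi} (\<lambda>t. poisson_kernel z t * Y n t)" for n
      unfolding Y_def by (intro continuous_intros continuous_on_poisson_kernel z cont)
    have "(\<lambda>n. LINT t|circle_measure. poisson_kernel z t * Y n t) \<longlonglongrightarrow> (LINT t|circle_measure. 0)"
    proof (rule integral_dominated_convergence[where w = "\<lambda>_. C * M"])
      show "(\<lambda>t. poisson_kernel z t * Y n t) \<in> borel_measurable circle_measure" for n
        using integrable_circle[OF Ycont] by (rule borel_measurable_integrable)
      show "AE t in circle_measure. norm (poisson_kernel z t * Y n t) \<le> C * M" for n
      proof (rule AE_I2)
        fix t
        have "Y n t \<le> M" "0 \<le> Y n t" unfolding Y_def using M by auto
        then have "poisson_kernel z t * Y n t \<le> C * M"
          using C C0 by (intro mult_mono) auto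
        then show "norm (poisson_kernel z t * Y n t) \<le> C * M"
          using poisson_kernel_nonneg[OF z] \<open>0 \<le> Y n t\<close> by simp
      qed
      show "AE t in circle_measure. (\<lambda>n. poisson_kernel z t * Y n t) \<longlonglongrightarrow> 0"
        using bd
      proof eventually_elim
        case (elim t)
        then obtain l where l: "((\<lambda>r. f (of_real r * cis t)) \<longlongrightarrow> l) (at_left 1)" "norm l \<le> 1" by blast
        have "(\<lambda>n. f (of_real (r n) * cis t)) \<longlonglongrightarrow> l"
          using filterlim_compose[OF l(1) rfilter] .
        then have "(\<lambda>n. poisson_kernel z t * Y n t) \<longlonglongrightarrow> poisson_kernel z t * max (min (norm l) M - 1) 0"
          unfolding Y_def by (intro tendsto_intros)
        moreover have "max (min (norm l) M - 1) 0 = 0" using l(2) by auto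
        ultimately show ?case by simp
      qed
    qed simp_all
    then have Y0: "(\<lambda>n. LINT t|circle_measure. poisson_kernel z t * Y n t) \<longlonglongrightarrow> 0" by simp
    have "norm (f (of_real (r n) * z)) \<le> 1 + C * B / (2 * pi * M) +
        (LINT t|circle_measure. poisson_kernel z t * Y n t) / (2 * pi)" for n
    proof -
      note dil = dilation[OF f less_imp_le[OF r(1)] r(2), of n]
      have pw: "norm (of_real (poisson_kernel z t) * f (of_real (r n) * cis t)) \<le>
          poisson_kernel z t + poisson_kernel z t * Y n t + C / M * (norm (f (of_real (r n) * cis t)))\<^sup>2"
              for t
      proof -
        let ?x = "norm (f (of_real (r n) * cis t))"
        have x: "?x \<le> 1 + Y n t + ?x\<^sup>2 / M"
        proof (cases "?x \<le> M")
          case True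
          then have "?x \<le> 1 + Y n t" unfolding Y_def by auto
          moreover have "0 \<le> ?x\<^sup>2 / M" using M by simp
          ultimately show ?thesis by linarith
        next
          case False
          then have "?x * M \<le> ?x * ?x" by (intro mult_left_mono) auto
          then have "?x \<le> ?x\<^sup>2 / M" using M by (simp add: power2_eq_square pos_le_divide_eq)
          then show ?thesis unfolding Y_def by linarith
        qed
        have "norm (of_real (poisson_kernel z t) * f (of_real (r n) * cis t)) = poisson_kernel z t * ?x"
          using poisson_kernel_nonneg[OF z] by (simp add: norm_mult)
        also have "\<dots> \<le> poisson_kernel z t * (1 + Y n t + ?x\<^sup>2 / M)"
          using x poisson_kernel_nonneg[OF z] by (rule mult_left_mono)
        also have "\<dots> \<le> poisson_kernel z t + poisson_kernel z t * Y n t + C * (?x\<^sup>2 / M)"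
          using mult_right_mono[OF C, of "?x\<^sup>2 / M" t] M by (simp add: algebra_simps)
        finally show ?thesis by simp
      qed
      have "2 * pi * norm (f (of_real (r n) * z)) = norm (complex_of_real (2 * pi) * f (of_real
          (r n) * z))"
        by (simp add: norm_mult)
      also have "\<dots> = norm (LINT t|circle_measure. of_real (poisson_kernel z t) * f (of_real
          (r n) * cis t))"
        by (subst poisson_formula(1)[OF dil z]) simp
      also have "\<dots> \<le> (LINT t|circle_measure. norm (of_real (poisson_kernel z t) * f (of_real
          (r n) * cis t)))"
        by (rule integral_norm_bound)
      also have "\<dots> \<le> (LINT t|circle_measure. poisson_kernel z t + poisson_kernel z t * Y n t + C / M *
          (norm (f (of_real (r n) * cis t)))\<^sup>2)"
        using pw by (intro integral_mono integrable_circle continuous_intros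
            continuous_on_poisson_kernel z cont Ycont)
      also have "\<dots> = 2 * pi + (LINT t|circle_measure. poisson_kernel z t * Y n t) + C / M *
          (LINT t|circle_measure. (norm (f (of_real (r n) * cis t)))\<^sup>2)"
        using z by (simp add: poisson_kernel_integral integrable_circle continuous_on_poisson_kernel
            Ycont cont continuous_intros)
      also have "\<dots> \<le> 2 * pi + (LINT t|circle_measure. poisson_kernel z t * Y n t) + C / M * B"
        using B[OF r, of n] C0 M by (intro add_left_mono mult_left_mono) auto
      finally show ?thesis by (simp add: field_simps)
    qed
    moreover have "(\<lambda>n. 1 + C * B / (2 * pi * M) +
        (LINT t|circle_measure. poisson_kernel z t * Y n t) / (2 * pi)) \<longlonglongrightarrow>
        1 + C * B / (2 * pi * M) + 0 / (2 * pi)"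
      by (intro tendsto_intros Y0) simp
    moreover have "(\<lambda>n. norm (f (of_real (r n) * z))) \<longlonglongrightarrow> norm (f (of_real 1 * z))"
    proof (intro tendsto_norm isCont_tendsto_compose[of _ f])
      show "isCont f (of_real 1 * z)"
        using z holomorphic_on_imp_continuous_on[OF f] by (simp add: continuous_on_eq_continuous_at)
      show "(\<lambda>n. complex_of_real (r n) * z) \<longlonglongrightarrow> of_real 1 * z" by (intro tendsto_intros rlim)
    qed
    ultimately show ?thesis by (auto intro: LIMSEQ_le)
  qed
  have "((\<lambda>M. 1 + C * B / (2 * pi * M)) \<longlongrightarrow> 1 + 0) at_top"
    by (intro tendsto_intros tendsto_divide_0[OF tendsto_const] filterlim_at_top_imp_at_infinity
        filterlim_tendsto_pos_mult_at_top[OF tendsto_const]) (auto intro: filterlim_ident)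
  then show ?thesis
    by (intro tendsto_lowerbound[of "\<lambda>M. 1 + C * B / (2 * pi * M)" 1 at_top])
      (use main in \<open>auto simp: eventually_at_top_linorder intro!: exI[of _ 1]\<close>)
qed

text \<open>Harnack's inequality for the nonnegative harmonic function \<open>1 - Re (c h)\<close>, where the
  unimodular constant \<open>c\<close> makes \<open>c h 0\<close> real and nonnegative.\<close>

lemma harnack_at_maximum:
  assumes h: "h holomorphic_on ball 0 1" and bd: "\<And>z. z \<in> ball 0 1 \<Longrightarrow> norm (h z) \<le> 1" and z: "norm z < 1"
  shows "1 - norm (h z) \<le> (1 + norm z) / (1 - norm z) * (1 - norm (h 0))"
proof -
  define C where "C = (1 + norm z) / (1 - norm z)"
  obtain c where c: "norm c = 1" "c * h 0 = of_real (norm (h 0))"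
  proof (cases "h 0 = 0")
    case False
    then show ?thesis
      by (intro that[of "of_real (norm (h 0)) / h 0"]) (auto simp: norm_divide)
  qed (auto intro: that[of 1])
  define u where "u w = 1 - c * h w" for w
  have u: "u holomorphic_on ball 0 1" unfolding u_def by (intro holomorphic_intros h)
  have upos: "0 \<le> Re (u w)" if "w \<in> ball 0 1" for w
    using bd[OF that] complex_Re_le_cmod[of "c * h w"] c(1) unfolding u_def by (simp add: norm_mult)
  have "Re (u (of_real r * z)) \<le> C * Re (u 0)" if r: "0 \<le> r" "r < 1" for r
  proof -
    note dil = dilation[OF u r]
    have mem: "of_real r * cis t \<in> ball 0 1" for t using r by (simp add: norm_mult)
    have "2 * pi * Re (u (of_real r * z)) = (LINT t|circle_measure. poisson_kernel z t * Re (u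
        (of_real r * cis t)))"
      by (rule poisson_formula_Re(1)[OF dil z])
    also have "\<dots> \<le> (LINT t|circle_measure. C * Re (u (of_real r * cis t)))"
    proof (rule integral_mono)
      show "integrable circle_measure (\<lambda>t. poisson_kernel z t * Re (u (of_real r * cis t)))"
        by (rule poisson_formula_Re(2)[OF dil z])
      show "integrable circle_measure (\<lambda>t. C * Re (u (of_real r * cis t)))"
        using mean_value_Re(2)[OF dil] by simp
      show "poisson_kernel z t * Re (u (of_real r * cis t)) \<le> C * Re (u (of_real r * cis t))" for t
        unfolding C_def using upos[OF mem] poisson_kernel_le[OF z] by (intro mult_right_mono) auto
    qed
    also have "\<dots> = 2 * pi * (C * Re (u 0))"
      using mean_value_Re(1)[OF dil] by simp
    finally show ?thesis by simp
  qed
  moreover have "((\<lambda>r. Re (u (of_real r * z))) \<longlongrightarrow> Re (u (of_real 1 * z))) (at_left 1)"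
  proof (intro tendsto_Re isCont_tendsto_compose[of _ u])
    show "isCont u (of_real 1 * z)"
      using z holomorphic_on_imp_continuous_on[OF u] by (simp add: continuous_on_eq_continuous_at)
  qed (intro tendsto_intros)
  ultimately have "Re (u z) \<le> C * Re (u 0)"
    using eventually_at_left_real[of 0 1]
    by (intro tendsto_upperbound[of "\<lambda>r. Re (u (of_real r * z))" _ "at_left 1"])
      (auto elim!: eventually_mono)
  moreover have "1 - norm (h z) \<le> Re (u z)"
    using complex_Re_le_cmod[of "c * h z"] c(1) unfolding u_def by (simp add: norm_mult)
  moreover have "Re (u 0) = 1 - norm (h 0)" unfolding u_def using c(2) by simp
  ultimately show ?thesis unfolding C_def by simp
qed

lemma boundary_maximum_principle:
  assumes f: "continuous_on (cball 0 1) f" "f holomorphic_on ball 0 1"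
    and bd: "\<And>w. norm w = 1 \<Longrightarrow> norm (f w) \<le> B" and z: "norm z \<le> 1"
  shows "norm (f z) \<le> B"
  using maximum_modulus_frontier[of f "cball 0 1" B z] assms by simp

text \<open>The function \<open>exp p\<close> is zero free and its modulus on the circle is that of \<open>g\<close> up to \<open>\<epsilon>\<close>: it
  approximates the outer part of \<open>g\<close> and remains continuous, even where \<open>g\<close> vanishes.\<close>

definition outer_majorant :: "(complex \<Rightarrow> complex) \<Rightarrow> real \<Rightarrow> (complex \<Rightarrow> complex) \<Rightarrow> bool"
  where "outer_majorant g \<epsilon> p \<longleftrightarrow>
    continuous_on (cball 0 1) p \<and> p holomorphic_on ball 0 1 \<and>
    (\<forall>z. norm z = 1 \<longrightarrow> norm (g z) \<le> exp (Re (p z)) \<and> exp (Re (p z)) \<le> norm (g z) + \<epsilon>)"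

context
  fixes \<psi> g v :: "complex \<Rightarrow> complex"
  assumes g: "continuous_on (cball 0 1) g" "\<And>z. z \<in> ball 0 1 \<Longrightarrow> g z = \<psi> z"
    and v: "is_outer_part v \<psi>"
begin

lemma outer_part_boundary:
  "AE t in circle_measure. ((\<lambda>r. v (of_real r * cis t)) \<longlongrightarrow> radial_limit v t) (at_left 1) \<and>
     norm (radial_limit v t) = norm (g (cis t))"
proof -
  obtain \<tau> where \<tau>: "inner_function \<tau>" "\<And>z. z \<in> ball 0 1 \<Longrightarrow> \<psi> z = \<tau> z * v z"
    using v unfolding is_outer_part_def by blast
  have 1: "AE t in circle_measure. ((\<lambda>r. \<tau> (of_real r * cis t)) \<longlongrightarrow> radial_limit \<tau> t) (at_left 1)"
    and 2: "AE t in circle_measure. norm (radial_limit \<tau> t) = 1"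
    and 3: "AE t in circle_measure. ((\<lambda>r. v (of_real r * cis t)) \<longlongrightarrow> radial_limit v t) (at_left 1)"
    using \<tau>(1) v unfolding is_outer_part_def outer_function_def inner_function_def has_radial_limits_def
    by auto
  show ?thesis
    using 1 2 3
  proof eventually_elim
    case (elim t)
    have "((\<lambda>r. \<tau> (of_real r * cis t) * v (of_real r * cis t)) \<longlongrightarrow> radial_limit \<tau> t * radial_limit v t)
        (at_left 1)"
      by (intro tendsto_mult elim)
    moreover have "\<forall>\<^sub>F r in at_left 1. \<tau> (of_real r * cis t) * v (of_real r * cis t) = g
        (of_real r * cis t)"
      using eventually_at_left_real[of 0 1]
    proof (rule eventually_mono)
      fix r :: real assume "r \<in> {0<..<1}"
      then show "\<tau> (of_real r * cis t) * v (of_real r * cis t) = g (of_real r * cis t)"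
        using \<tau>(2)[of "of_real r * cis t"] g(2)[of "of_real r * cis t"] by (simp add: norm_mult)
    qed simp
    ultimately have l1: "((\<lambda>r. g (of_real r * cis t)) \<longlongrightarrow> radial_limit \<tau> t * radial_limit v t) (at_left 1)"
      by (rule Lim_transform_eventually)
    have "((\<lambda>r. g (of_real r * cis t)) \<longlongrightarrow> g (cis t)) (at_left 1)"
    proof (rule continuous_on_tendsto_compose[OF g(1)])
      have "((\<lambda>r. of_real r * cis t) \<longlongrightarrow> of_real 1 * cis t) (at_left 1)" by (intro tendsto_intros)
      then show "((\<lambda>r. of_real r * cis t) \<longlongrightarrow> cis t) (at_left 1)" by simp
      show "\<forall>\<^sub>F r in at_left 1. of_real r * cis t \<in> cball 0 1"
        using eventually_at_left_real[of 0 1] by (rule eventually_mono) (auto simp: norm_mult)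
    qed simp
    then have "radial_limit \<tau> t * radial_limit v t = g (cis t)"
      using l1 by (intro tendsto_unique[OF trivial_limit_at_left_real])
    then show ?case using elim(2,3) by (metis norm_mult mult_1)
  qed
qed

text \<open>The quotient \<open>v / exp p\<close> belongs to the Hardy space and its radial limits have modulus at
  most one.\<close>

lemma outer_part_le_majorant:
  assumes p: "outer_majorant g \<epsilon> p" and z: "norm z < 1"
  shows "norm (v z) \<le> exp (Re (p z))"
proof -
  have pc: "continuous_on (cball 0 1) p" "p holomorphic_on ball 0 1"
    and pg: "\<And>z. norm z = 1 \<Longrightarrow> norm (g z) \<le> exp (Re (p z))"
    using p unfolding outer_majorant_def by auto
  have vh: "v \<in> hardy_H2" using v unfolding is_outer_part_def outer_function_def by blast
  then have hol: "v holomorphic_on ball 0 1" unfolding hardy_H2_def by blast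
  obtain B where B: "\<And>r. 0 < r \<Longrightarrow> r < 1 \<Longrightarrow>
      1 / (2 * pi) * integral {0..2 * pi} (\<lambda>t. (norm (v (of_real r * cis t)))\<^sup>2) \<le> B"
  proof -
    obtain M where "\<forall>y\<in>(\<lambda>r. 1 / (2 * pi) * integral {0..2 * pi} (\<lambda>t. (norm (v
        (of_real r * cis t)))\<^sup>2)) ` {0<..<1}. y \<le> M"
      using vh unfolding hardy_H2_def bdd_above_def by blast
    then show ?thesis by (intro that[of M]) (metis greaterThanLessThan_iff image_eqI)
  qed
  have "compact ((\<lambda>z. exp (- p z)) ` cball 0 1)"
    by (intro compact_continuous_image continuous_intros pc) auto
  then obtain E where E: "\<forall>y\<in>(\<lambda>z. exp (- p z)) ` cball 0 1. norm y \<le> E"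
    using compact_imp_bounded bounded_iff by blast
  then have E: "norm (exp (- p z)) \<le> E" if "norm z \<le> 1" for z
    using that by auto
  let ?f = "\<lambda>z. v z * exp (- p z)"
  have "norm (?f z) \<le> 1"
  proof (rule hardy_maximum_principle[where B = "E\<^sup>2 * (2 * pi * B)" and f = ?f and z = z])
    show "?f holomorphic_on ball 0 1" by (intro holomorphic_intros hol pc)
    fix r :: real assume r: "0 < r" "r < 1"
    have cv: "continuous_on {0..2 * pi} (\<lambda>t. v (of_real r * cis t))"
      using r by (intro continuous_on_circle continuous_on_subset[OF holomorphic_on_imp_continuous_on[OF
          hol]]) auto
    have cf: "continuous_on {0..2 * pi} (\<lambda>t. ?f (of_real r * cis t))"
      using r by (intro continuous_on_circle continuous_on_subset[OF holomorphic_on_imp_continuous_on[of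
          ?f "ball 0 1"]]
          holomorphic_intros hol pc) auto
    have int: "integrable circle_measure (\<lambda>t. (norm (v (of_real r * cis t)))\<^sup>2)"
      by (intro integrable_circle continuous_intros cv)
    have "(LINT t|circle_measure. (norm (?f (of_real r * cis t)))\<^sup>2)
        \<le> (LINT t|circle_measure. E\<^sup>2 * (norm (v (of_real r * cis t)))\<^sup>2)"
    proof (rule integral_mono)
      show "integrable circle_measure (\<lambda>t. (norm (?f (of_real r * cis t)))\<^sup>2)"
        by (intro integrable_circle continuous_on_power continuous_on_norm cf)
      show "integrable circle_measure (\<lambda>t. E\<^sup>2 * (norm (v (of_real r * cis t)))\<^sup>2)" using int by simp
      fix t
      have "norm (exp (- p (of_real r * cis t))) \<le> E" using r by (intro E) (simp add: norm_mult)
      then have "(norm (exp (- p (of_real r * cis t))))\<^sup>2 \<le> E\<^sup>2" by (intro power_mono) auto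
      then show "(norm (?f (of_real r * cis t)))\<^sup>2 \<le> E\<^sup>2 * (norm (v (of_real r * cis t)))\<^sup>2"
        unfolding norm_mult power_mult_distrib by (subst mult.commute) (rule mult_right_mono, auto)
    qed
    also have "\<dots> = E\<^sup>2 * (LINT t|circle_measure. (norm (v (of_real r * cis t)))\<^sup>2)" by simp
    also have "(LINT t|circle_measure. (norm (v (of_real r * cis t)))\<^sup>2) \<le> 2 * pi * B"
      using B[OF r] lebesgue_integral_eq_integral[OF int] by (simp add: field_simps)
    finally show "(LINT t|circle_measure. (norm (?f (of_real r * cis t)))\<^sup>2) \<le> E\<^sup>2 * (2 * pi * B)"
      by (simp add: mult_left_mono)
  next
    show "AE t in circle_measure. \<exists>l. ((\<lambda>r. ?f (of_real r * cis t)) \<longlongrightarrow> l) (at_left 1) \<and> norm l \<le> 1"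
      using outer_part_boundary
    proof eventually_elim
      case (elim t)
      have "((\<lambda>r. p (of_real r * cis t)) \<longlongrightarrow> p (cis t)) (at_left 1)"
      proof (rule continuous_on_tendsto_compose[OF pc(1)])
        have "((\<lambda>r. of_real r * cis t) \<longlongrightarrow> of_real 1 * cis t) (at_left 1)" by (intro tendsto_intros)
        then show "((\<lambda>r. of_real r * cis t) \<longlongrightarrow> cis t) (at_left 1)" by simp
        show "\<forall>\<^sub>F r in at_left 1. of_real r * cis t \<in> cball 0 1"
          using eventually_at_left_real[of 0 1] by (rule eventually_mono) (auto simp: norm_mult)
      qed simp
      then have "((\<lambda>r. ?f (of_real r * cis t)) \<longlongrightarrow> radial_limit v t * exp (- p (cis t))) (at_left 1)"
        using elim by (intro tendsto_intros) auto
      moreover have "norm (radial_limit v t * exp (- p (cis t))) \<le> 1"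
        using elim pg[of "cis t"] by (simp add: norm_mult norm_divide norm_exp_eq_Re exp_minus
            field_simps)
      ultimately show ?case by blast
    qed
  qed (rule z)
  then show ?thesis by (simp add: norm_mult norm_divide norm_exp_eq_Re exp_minus field_simps)
qed

lemma majorant_at_0:
  assumes p: "outer_majorant g \<epsilon> p" and eps: "\<epsilon> > 0"
  shows "2 * pi * Re (p 0) \<le> (LINT t|circle_measure. ln (norm (g (cis t)) + \<epsilon>))"
proof -
  have pc: "continuous_on (cball 0 1) p" "p holomorphic_on ball 0 1"
    and pg: "\<And>z. norm z = 1 \<Longrightarrow> exp (Re (p z)) \<le> norm (g z) + \<epsilon>"
    using p unfolding outer_majorant_def by auto
  have "2 * pi * Re (p 0) = (LINT t|circle_measure. Re (p (cis t)))"
    by (rule mean_value_Re(1)[OF pc])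
  also have "\<dots> \<le> (LINT t|circle_measure. ln (norm (g (cis t)) + \<epsilon>))"
  proof (rule integral_mono)
    show "integrable circle_measure (\<lambda>t. Re (p (cis t)))" by (rule mean_value_Re(2)[OF pc])
    have pos: "norm (g (cis t)) + \<epsilon> > 0" for t by (rule add_nonneg_pos) (use eps in auto)
    then show "integrable circle_measure (\<lambda>t. ln (norm (g (cis t)) + \<epsilon>))"
      using continuous_on_circle[of 1 g "{0..2 * pi}"] continuous_on_subset[OF g(1), of "sphere 0 1"]
      by (intro integrable_circle continuous_intros) (auto simp: less_imp_neq[THEN not_sym])
    show "Re (p (cis t)) \<le> ln (norm (g (cis t)) + \<epsilon>)" for t
      using pg[of "cis t"] pos[of t] by (simp add: ln_ge_iff)
  qed
  finally show ?thesis .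
qed

text \<open>At the origin this is the definition of an outer function, together with dominated
  convergence of \<open>log (\<bar>g\<bar> + \<epsilon>)\<close> as \<open>\<epsilon>\<close> tends to \<open>0\<close>. To reach another point \<open>a\<close>, note that
  \<open>h = v / exp p\<close> maps the disk into the closed disk and \<open>\<bar>h 0\<bar>\<close> is close to \<open>1\<close>; by Harnack's
  inequality so is \<open>\<bar>h a\<bar>\<close>.\<close>

lemma majorant_limit:
  assumes maj: "\<And>\<epsilon>. \<epsilon> > 0 \<Longrightarrow> \<exists>p. outer_majorant g \<epsilon> p" and a: "norm a < 1" and \<eta>: "\<eta> > 0"
  shows "\<exists>\<epsilon>0>0. \<forall>\<epsilon> p. 0 < \<epsilon> \<longrightarrow> \<epsilon> \<le> \<epsilon>0 \<longrightarrow> outer_majorant g \<epsilon> p \<longrightarrow> exp (Re (p a)) \<le> norm (v a) + \<eta>"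
proof -
  have v0: "v 0 \<noteq> 0" and vint: "integrable circle_measure (\<lambda>t. ln (norm (radial_limit v t)))"
    and vmean: "1 / (2 * pi) * (LINT t|circle_measure. ln (norm (radial_limit v t))) = ln (norm (v 0))"
    using v unfolding is_outer_part_def outer_function_def by blast+
  have vhol: "v holomorphic_on ball 0 1"
    using v unfolding is_outer_part_def outer_function_def hardy_H2_def by blast
  define L where "L \<epsilon> = (LINT t|circle_measure. ln (norm (g (cis t)) + \<epsilon>))" for \<epsilon>
  have "compact (g ` cball 0 1)" by (intro compact_continuous_image g) auto
  then obtain B0 where B0: "\<forall>y\<in>g ` cball 0 1. norm y \<le> B0"
    using compact_imp_bounded bounded_iff by blast
  then have B0: "norm (g z) \<le> B0" if "norm z \<le> 1" for z
    using that by auto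
  define B where "B = B0 + 1"
  have B: "norm (g (cis t)) + 1 \<le> B" for t unfolding B_def using B0[of "cis t"] by simp
  have B1: "1 \<le> B" using B[of 0] norm_ge_zero[of "g (cis 0)"] by linarith
  have gc: "continuous_on {0..2 * pi} (\<lambda>t. g (cis t))"
    using continuous_on_circle[of 1 g "{0..2 * pi}"] continuous_on_subset[OF g(1), of "sphere 0 1"]
        by auto
  have pos: "norm (g (cis t)) + \<epsilon> > 0" if "\<epsilon> > 0" for t \<epsilon> by (rule add_nonneg_pos) (use that in auto)
  have lint: "integrable circle_measure (\<lambda>t. ln (norm (g (cis t)) + \<epsilon>))" if "\<epsilon> > 0" for \<epsilon>
    using pos[OF that] by (intro integrable_circle continuous_intros gc)
        (auto simp: less_imp_neq[THEN not_sym])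
  have Llower: "2 * pi * ln (norm (v 0)) \<le> L \<epsilon>" if e: "\<epsilon> > 0" for \<epsilon>
  proof -
    obtain p where p: "outer_majorant g \<epsilon> p" using maj[OF e] by blast
    have "norm (v 0) \<le> exp (Re (p 0))" by (rule outer_part_le_majorant[OF p]) simp
    then have "ln (norm (v 0)) \<le> ln (exp (Re (p 0)))" using v0 by (intro ln_mono) auto
    then have "ln (norm (v 0)) \<le> Re (p 0)" by simp
    then have "2 * pi * ln (norm (v 0)) \<le> 2 * pi * Re (p 0)" by simp
    also have "\<dots> \<le> L \<epsilon>" unfolding L_def by (rule majorant_at_0[OF p e])
    finally show ?thesis .
  qed
  define Z where "Z = {t \<in> {0..2 * pi}. g (cis t) = 0}"
  have "Z = {0..2 * pi} \<inter> (\<lambda>t. g (cis t)) -` {0}" unfolding Z_def by auto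
  then have "closed Z" using continuous_closed_preimage[OF gc, of "{0}"] by simp
  then have Zs: "Z \<in> sets circle_measure" by (auto simp: sets_restrict_space_iff Z_def)
  define m where "m = measure circle_measure Z"
  \<comment> \<open>The zeros of \<open>g\<close> on the circle form a null set: otherwise the integrals \<open>L\<close> would tend to
    minus infinity, against \<open>Llower\<close>.\<close>
  have m0: "m = 0"
  proof (rule ccontr)
    assume "m \<noteq> 0"
    then have mpos: "m > 0" unfolding m_def using measure_nonneg[of circle_measure Z] by linarith
    have const: "integrable circle_measure (\<lambda>t. c)" for c :: real by (rule integrable_circle) auto
    have cint: "(LINT t|circle_measure. c) = 2 * pi * c" for c :: real
      using lebesgue_integral_eq_integral[OF const] by simp
    have ind: "integrable circle_measure (\<lambda>t. indicat_real Z t)"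
      using integrable_real_mult_indicator[OF Zs const, of 1] by simp
    \<comment> \<open>For \<open>\<epsilon> = exp x\<close> the part over \<open>Z\<close> alone pushes the integral below its lower bound by one.\<close>
    define x where "x = min (- 1) ((2 * pi * ln (norm (v 0)) - 2 * pi * ln B - 1) / m)"
    have "L (exp x) \<le> (LINT t|circle_measure. indicat_real Z t * x + ln B)"
      unfolding L_def
    proof (rule integral_mono)
      show "integrable circle_measure (\<lambda>t. ln (norm (g (cis t)) + exp x))" by (rule lint) simp
      show "integrable circle_measure (\<lambda>t. indicat_real Z t * x + ln B)"
        using ind const by simp
      fix t
      have "ln (norm (g (cis t)) + exp x) \<le> ln B"
      proof (intro ln_mono)
        have "exp x \<le> 1" by (simp add: x_def)
        then show "norm (g (cis t)) + exp x \<le> B" using B[of t] by linarith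
      qed (use B1 pos[of "exp x" t] in auto)
      then show "ln (norm (g (cis t)) + exp x) \<le> indicat_real Z t * x + ln B"
        using B1 by (auto simp: indicator_def Z_def)
    qed
    also have "\<dots> = m * x + 2 * pi * ln B"
    proof -
      have "Z \<inter> space circle_measure = Z" by (auto simp: Z_def)
      then have Zm: "(LINT t|circle_measure. indicat_real Z t) = m"
        unfolding m_def by (subst Bochner_Integration.integral_indicator) simp
      have "(LINT t|circle_measure. indicat_real Z t * x + ln B)
          = (LINT t|circle_measure. indicat_real Z t * x) + (LINT t|circle_measure. ln B)"
        using ind const by (intro Bochner_Integration.integral_add integrable_mult_left)
      then show ?thesis by (simp only: integral_mult_left_zero Zm cint)
    qed
    also have "m * x \<le> 2 * pi * ln (norm (v 0)) - 2 * pi * ln B - 1"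
      using mpos by (auto simp: x_def min_def field_simps)
    finally show False using Llower[of "exp x"] by simp
  qed
  have gne: "AE t in circle_measure. g (cis t) \<noteq> 0"
  proof (subst AE_iff_measurable[OF Zs])
    show "{t \<in> space circle_measure. \<not> g (cis t) \<noteq> 0} = Z" by (auto simp: Z_def)
    show "emeasure circle_measure Z = 0"
      using m0 unfolding m_def
      by (subst finite_measure.emeasure_eq_measure[OF finite_measure_lebesgue_on]) auto
  qed
  have "((\<lambda>n. L (1 / real (Suc n))) \<longlonglongrightarrow> 2 * pi * ln (norm (v 0)))"
  proof -
    have "((\<lambda>n. L (1 / real (Suc n))) \<longlonglongrightarrow> (LINT t|circle_measure. ln (norm (radial_limit v t))))"
      unfolding L_def
    proof (rule integral_dominated_convergence[where w = "\<lambda>t. \<bar>ln (norm (radial_limit v t))\<bar> + ln B"])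
      show "(\<lambda>t. ln (norm (radial_limit v t))) \<in> borel_measurable circle_measure"
        using vint by (rule borel_measurable_integrable)
      show "(\<lambda>t. ln (norm (g (cis t)) + 1 / real (Suc n))) \<in> borel_measurable circle_measure" for n
        by (rule borel_measurable_integrable[OF lint]) simp
      show "integrable circle_measure (\<lambda>t. \<bar>ln (norm (radial_limit v t))\<bar> + ln B)"
        using vint finite_measure.integrable_const[OF finite_measure_lebesgue_on]
        by (intro Bochner_Integration.integrable_add integrable_abs) auto
      show "AE t in circle_measure. (\<lambda>n. ln (norm (g (cis t)) + 1 / real (Suc n))) \<longlonglongrightarrow> ln (norm
          (radial_limit v t))"
        using outer_part_boundary gne
      proof eventually_elim
        case (elim t)
        have "(\<lambda>n. ln (norm (g (cis t)) + 1 / real (Suc n))) \<longlonglongrightarrow> ln (norm (g (cis t)) + 0)"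
          using elim by (intro tendsto_intros LIMSEQ_Suc[OF lim_1_over_n]) auto
        with elim show ?case by simp
      qed
      show "AE t in circle_measure. norm (ln (norm (g (cis t)) + 1 / real (Suc n))) \<le> \<bar>ln (norm
          (radial_limit v t))\<bar> + ln B" for n
        using outer_part_boundary gne
      proof eventually_elim
        case (elim t)
        have "1 / real (Suc n) \<le> 1" by simp
        then have "ln (norm (g (cis t)) + 1 / real (Suc n)) \<le> ln B"
          using B[of t] by (intro ln_mono pos) (linarith | simp)+
        moreover have "ln (norm (g (cis t))) \<le> ln (norm (g (cis t)) + 1 / real (Suc n))"
          using elim by (intro ln_mono) auto
        moreover have "0 \<le> ln B" using B1 by simp
        ultimately show ?case using elim by (simp add: abs_le_iff) linarith
      qed
    qed
    then show ?thesis using vmean by (simp add: field_simps)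
  qed
  define \<kappa> where "\<kappa> = (1 + norm a) / (1 - norm a)"
  have \<kappa>: "\<kappa> > 0" unfolding \<kappa>_def using a norm_ge_zero[of a] by (intro divide_pos_pos) linarith+
  have "(\<lambda>n. 1 - norm (v 0) * exp (- (L (1 / real (Suc n)) / (2 * pi)))) \<longlonglongrightarrow> 1 - norm (v 0) * exp
      (- (2 * pi * ln (norm (v 0)) / (2 * pi)))"
    by (intro tendsto_intros \<open>_ \<longlonglongrightarrow> 2 * pi * ln (norm (v 0))\<close>) simp
  also have "1 - norm (v 0) * exp (- (2 * pi * ln (norm (v 0)) / (2 * pi))) = 0"
    using v0 by (simp add: exp_minus)
  finally have "\<forall>\<^sub>F n in sequentially. 1 - norm (v 0) * exp (- (L (1 / real (Suc n)) / (2 * pi))) < \<eta> /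
      (\<kappa> * B)"
    using \<eta> \<kappa> B1 by (intro order_tendstoD) auto
  then obtain n where n: "1 - norm (v 0) * exp (- (L (1 / real (Suc n)) / (2 * pi))) < \<eta> / (\<kappa> * B)"
    using eventually_happens by force
  show ?thesis
  proof (intro exI[of _ "1 / real (Suc n)"] conjI allI impI)
    fix \<epsilon> p assume e: "0 < \<epsilon>" "\<epsilon> \<le> 1 / real (Suc n)" and p: "outer_majorant g \<epsilon> p"
    have pc: "continuous_on (cball 0 1) p" "p holomorphic_on ball 0 1"
      and pg: "\<And>z. norm z = 1 \<Longrightarrow> exp (Re (p z)) \<le> norm (g z) + \<epsilon>"
      using p unfolding outer_majorant_def by auto
    define h where "h z = v z * exp (- p z)" for z
    have hnorm: "norm (h z) = norm (v z) * exp (- Re (p z))" for z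
      unfolding h_def by (simp add: norm_mult norm_exp_eq_Re)
    have "1 - norm (h a) \<le> \<kappa> * (1 - norm (h 0))"
      unfolding \<kappa>_def
    proof (rule harnack_at_maximum)
      show "h holomorphic_on ball 0 1" unfolding h_def by (intro holomorphic_intros vhol pc)
      show "norm (h z) \<le> 1" if "z \<in> ball 0 1" for z
        using outer_part_le_majorant[OF p, of z] that unfolding hnorm by
            (simp add: exp_minus field_simps)
    qed (rule a)
    moreover have "1 - norm (h 0) \<le> \<eta> / (\<kappa> * B)"
    proof -
      have "L \<epsilon> \<le> L (1 / real (Suc n))"
        unfolding L_def using e pos[OF e(1)] by (intro integral_mono lint ln_mono) auto
      then have "2 * pi * Re (p 0) \<le> L (1 / real (Suc n))"
        using majorant_at_0[OF p e(1)] unfolding L_def by linarith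
      then have "exp (- (L (1 / real (Suc n)) / (2 * pi))) \<le> exp (- Re (p 0))"
        by (simp add: field_simps)
      then have "norm (v 0) * exp (- (L (1 / real (Suc n)) / (2 * pi))) \<le> norm (h 0)"
        unfolding hnorm by (intro mult_left_mono) auto
      with n show ?thesis by linarith
    qed
    ultimately have "1 - norm (h a) \<le> \<kappa> * (\<eta> / (\<kappa> * B))"
      using \<kappa> by (meson less_imp_le mult_left_mono order_trans)
    then have "1 - norm (h a) \<le> \<eta> / B" using \<kappa> B1 by simp
    then have "exp (Re (p a)) * (1 - norm (h a)) \<le> exp (Re (p a)) * (\<eta> / B)"
      by (intro mult_left_mono) auto
    also have "\<dots> \<le> B * (\<eta> / B)"
    proof (rule mult_right_mono)
      have "norm (exp (p a)) \<le> B"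
      proof (rule boundary_maximum_principle[where f = "\<lambda>z. exp (p z)"])
        show "continuous_on (cball 0 1) (\<lambda>z. exp (p z))" "(\<lambda>z. exp (p z)) holomorphic_on ball 0 1"
          by (intro continuous_intros holomorphic_intros pc)+
        show "norm (exp (p w)) \<le> B" if "norm w = 1" for w
        proof -
          have "exp (Re (p w)) \<le> norm (g w) + \<epsilon>" by (rule pg[OF that])
          also have "\<dots> \<le> B0 + 1"
            using B0[of w] e that by (intro add_mono) (auto intro: order_trans)
          finally show ?thesis unfolding B_def norm_exp_eq_Re .
        qed
      qed (use a in simp)
      then show "exp (Re (p a)) \<le> B" by (simp add: norm_exp_eq_Re)
    qed (use \<eta> B1 in auto)
    also have "\<dots> = \<eta>" using B1 by simp
    also have "exp (Re (p a)) * (1 - norm (h a)) = exp (Re (p a)) - norm (v a)"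
      unfolding hnorm by (simp add: algebra_simps exp_minus)
    finally show "exp (Re (p a)) \<le> norm (v a) + \<eta>" by simp
  qed simp
qed

end


section \<open>Approximation on the circle by real parts of polynomials\<close>

definition circle_trig_polynomial :: "(complex \<Rightarrow> real) \<Rightarrow> bool"
  where "circle_trig_polynomial u \<longleftrightarrow>
    (\<exists>c n. \<forall>z. norm z = 1 \<longrightarrow> u z = Re (\<Sum>k\<le>n::nat. c k * z ^ k))"

lemma trig_monomial: "circle_trig_polynomial (\<lambda>z. Re (c * z ^ k))"
  unfolding circle_trig_polynomial_def
proof (intro exI allI impI)
  fix z :: complex
  have "(\<Sum>j\<le>k. (if j = k then c else 0) * z ^ j) = (\<Sum>j\<le>k. if j = k then c * z ^ j else 0)"
    by (intro sum.cong) auto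
  then show "Re (c * z ^ k) = Re (\<Sum>j\<le>k. (if j = k then c else 0) * z ^ j)" by simp
qed

lemma trig_add:
  assumes "circle_trig_polynomial u" "circle_trig_polynomial w"
  shows "circle_trig_polynomial (\<lambda>z. u z + w z)"
proof -
  obtain c m where c: "\<And>z. norm z = 1 \<Longrightarrow> u z = Re (\<Sum>k\<le>m::nat. c k * z ^ k)"
    using assms(1) unfolding circle_trig_polynomial_def by blast
  obtain d n where d: "\<And>z. norm z = 1 \<Longrightarrow> w z = Re (\<Sum>k\<le>n::nat. d k * z ^ k)"
    using assms(2) unfolding circle_trig_polynomial_def by blast
  have pad: "(\<Sum>k\<le>j. b k * z ^ k) = (\<Sum>k\<le>m + n. (if k \<le> j then b k else 0) * z ^ k)"
    if "j \<le> m + n" for j and b :: "nat \<Rightarrow> complex" and z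
    using that by (intro sum.mono_neutral_cong_left) auto
  have "u z + w z = Re (\<Sum>k\<le>m + n. ((if k \<le> m then c k else 0) + (if k \<le> n then d k else 0)) * z ^ k)"
    if "norm z = 1" for z
    unfolding c[OF that] d[OF that] pad[OF le_add1] pad[OF le_add2] distrib_right sum.distrib by simp
  then show ?thesis unfolding circle_trig_polynomial_def by (intro exI allI impI)
qed

lemma trig_sum:
  "finite I \<Longrightarrow> (\<And>i. i \<in> I \<Longrightarrow> circle_trig_polynomial (u i)) \<Longrightarrow> circle_trig_polynomial (\<lambda>z. \<Sum>i\<in>I. u i z)"
proof (induction I rule: finite_induct)
  case empty
  then show ?case using trig_monomial[of 0 0] by simp
next
  case (insert x F)
  then show ?case by (simp add: trig_add)
qed

lemma trig_cong:
  "circle_trig_polynomial u \<Longrightarrow> (\<And>z. norm z = 1 \<Longrightarrow> w z = u z) \<Longrightarrow> circle_trig_polynomial w"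
  unfolding circle_trig_polynomial_def by simp

text \<open>On the circle \<open>cnj z = 1 / z\<close>, so the product formula
  \<open>2 Re x Re y = Re (x y) + Re (x cnj y)\<close> does not leave the class of real parts of polynomials.
  Hence the class contains all real polynomials in the coordinates and the theorem of Stone and
  Weierstrass applies.\<close>

lemma trig_mult_monomials: "circle_trig_polynomial (\<lambda>z. Re (c * z ^ j) * Re (d * z ^ k))"
proof -
  have "circle_trig_polynomial (\<lambda>z. Re (c * z ^ j) * Re (d * z ^ k))" if "k \<le> j" for c d j k
  proof -
    have "circle_trig_polynomial (\<lambda>z. Re (c * d / 2 * z ^ (j + k)) + Re (c * cnj d / 2 * z ^ (j - k)))"
      by (intro trig_add trig_monomial)
    moreover have "Re (c * z ^ j) * Re (d * z ^ k)
        = Re (c * d / 2 * z ^ (j + k)) + Re (c * cnj d / 2 * z ^ (j - k))" if z: "norm z = 1" for z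
    proof -
      have "z ^ j = z ^ (j - k) * z ^ k" using \<open>k \<le> j\<close> by (simp flip: power_add)
      moreover have "z ^ k * cnj (z ^ k) = 1"
        using z complex_norm_square[of "z ^ k"] by (simp add: norm_power)
      ultimately have "z ^ j * cnj (z ^ k) = z ^ (j - k)" by (simp add: mult.assoc)
      then have "c * cnj d / 2 * z ^ (j - k) = (c * z ^ j) * cnj (d * z ^ k) / 2"
        by (metis (no_types, lifting) complex_cnj_mult mult.assoc mult.left_commute times_divide_eq_left)
      moreover have "c * d / 2 * z ^ (j + k) = (c * z ^ j) * (d * z ^ k) / 2"
        by (simp add: power_add)
      moreover have "Re a * Re b = Re (a * b / 2) + Re (a * cnj b / 2)" for a b
        by (simp add: field_simps)
      ultimately show ?thesis by (simp only:)
    qed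
    ultimately show ?thesis by (rule trig_cong)
  qed
  from this[of k j c d] this[of j k d c] show ?thesis
    by (cases "k \<le> j") (simp_all add: mult.commute)
qed

lemma trig_mult:
  assumes "circle_trig_polynomial u" "circle_trig_polynomial w"
  shows "circle_trig_polynomial (\<lambda>z. u z * w z)"
proof -
  obtain c m where c: "\<And>z. norm z = 1 \<Longrightarrow> u z = Re (\<Sum>k\<le>m::nat. c k * z ^ k)"
    using assms(1) unfolding circle_trig_polynomial_def by blast
  obtain d n where d: "\<And>z. norm z = 1 \<Longrightarrow> w z = Re (\<Sum>k\<le>n::nat. d k * z ^ k)"
    using assms(2) unfolding circle_trig_polynomial_def by blast
  have "circle_trig_polynomial (\<lambda>z. \<Sum>j\<le>m. \<Sum>k\<le>n. Re (c j * z ^ j) * Re (d k * z ^ k))"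
    by (intro trig_sum trig_mult_monomials) auto
  moreover have "u z * w z = (\<Sum>j\<le>m. \<Sum>k\<le>n. Re (c j * z ^ j) * Re (d k * z ^ k))" if "norm z = 1" for z
    unfolding c[OF that] d[OF that] Re_sum sum_product ..
  ultimately show ?thesis by (rule trig_cong)
qed

lemma real_polynomial_function_trig:
  "real_polynomial_function g \<Longrightarrow> circle_trig_polynomial g"
proof (induction rule: real_polynomial_function.induct)
  case (linear f)
  interpret bounded_linear f by fact
  have "f z = Re ((of_real (f 1) - \<i> * of_real (f \<i>)) * z ^ 1)" for z
  proof -
    have "z = Re z *\<^sub>R 1 + Im z *\<^sub>R \<i>" by (simp add: complex_eq_iff)
    then have "f z = f (Re z *\<^sub>R 1 + Im z *\<^sub>R \<i>)" by (rule arg_cong)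
    also have "\<dots> = Re z * f 1 + Im z * f \<i>" by (simp only: add scaleR real_scaleR_def)
    finally show ?thesis by simp
  qed
  then show ?case by (rule trig_cong[OF trig_monomial])
next
  case (const c)
  then show ?case using trig_monomial[of "of_real c" 0] by simp
qed (auto intro: trig_add trig_mult)

text \<open>Approximate \<open>ln (u + \<epsilon> / 2)\<close> from above; the approximation error \<open>2 e\<close> that is allowed uses
  the room between \<open>\<epsilon> / 2\<close> and \<open>\<epsilon>\<close> at the largest value \<open>B\<close> of \<open>u\<close>, where it is smallest on the
  logarithmic scale.\<close>

lemma polynomial_majorant:
  fixes u :: "complex \<Rightarrow> real"
  assumes u: "continuous_on (sphere 0 1) u" "\<And>z. norm z = 1 \<Longrightarrow> 0 \<le> u z" and eps: "\<epsilon> > 0"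
  obtains c n where
    "\<And>z. norm z = 1 \<Longrightarrow> u z \<le> exp (Re (\<Sum>k\<le>n::nat. c k * z ^ k))"
    "\<And>z. norm z = 1 \<Longrightarrow> exp (Re (\<Sum>k\<le>n. c k * z ^ k)) \<le> u z + \<epsilon>"
proof -
  have "compact (u ` sphere 0 1)" by (intro compact_continuous_image u) auto
  then obtain B where "\<forall>y\<in>u ` sphere 0 1. norm y \<le> B"
    using compact_imp_bounded bounded_iff by blast
  then have B: "u z \<le> B" if "norm z = 1" for z using that by force
  have B0: "0 \<le> B" using B[of 1] u(2)[of 1] by simp
  define e where "e = ln ((B + \<epsilon>) / (B + \<epsilon> / 2)) / 2"
  have e: "e > 0" unfolding e_def using B0 eps by (simp add: field_simps)
  have pos: "u z + \<epsilon> / 2 > 0" if "norm z = 1" for z using u(2)[OF that] eps by linarith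
  have "continuous_on (sphere 0 1) (\<lambda>z. ln (u z + \<epsilon> / 2) + e)"
    using pos by (intro continuous_intros u) (auto simp: less_imp_neq[THEN not_sym])
  then obtain g where g: "real_polynomial_function g"
    "\<And>z. z \<in> sphere 0 1 \<Longrightarrow> \<bar>(ln (u z + \<epsilon> / 2) + e) - g z\<bar> < e"
    using Stone_Weierstrass_real_polynomial_function[OF compact_sphere _ e] by metis
  obtain c n where c: "\<And>z. norm z = 1 \<Longrightarrow> g z = Re (\<Sum>k\<le>n::nat. c k * z ^ k)"
    using real_polynomial_function_trig[OF g(1)] unfolding circle_trig_polynomial_def by blast
  show ?thesis
  proof
    fix z :: complex assume z: "norm z = 1"
    have b: "ln (u z + \<epsilon> / 2) \<le> g z" "g z \<le> ln (u z + \<epsilon> / 2) + 2 * e"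
      using g(2)[of z] z by (auto simp: abs_less_iff)
    have "exp (ln (u z + \<epsilon> / 2)) \<le> exp (g z)" using b by simp
    then show "u z \<le> exp (Re (\<Sum>k\<le>n. c k * z ^ k))"
      unfolding c[OF z, symmetric] using pos[OF z] eps by simp
    have "exp (g z) \<le> exp (ln (u z + \<epsilon> / 2) + 2 * e)" using b by simp
    also have "\<dots> = (u z + \<epsilon> / 2) * ((B + \<epsilon>) / (B + \<epsilon> / 2))"
      using pos[OF z] B0 eps by (simp add: exp_add e_def)
    also have "\<dots> \<le> u z + \<epsilon>"
    proof -
      have "u z * \<epsilon> \<le> B * \<epsilon>" using B[OF z] eps by (intro mult_right_mono) auto
      then have "(u z + \<epsilon> / 2) * (B + \<epsilon>) \<le> (u z + \<epsilon>) * (B + \<epsilon> / 2)" by (simp add: field_simps)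
      moreover have "B + \<epsilon> / 2 > 0" using B0 eps by linarith
      ultimately show ?thesis by (simp add: pos_divide_le_eq)
    qed
    finally show "exp (Re (\<Sum>k\<le>n. c k * z ^ k)) \<le> u z + \<epsilon>" unfolding c[OF z, symmetric] .
  qed
qed


section \<open>Weighted rotations of finite order\<close>

text \<open>The power map is open, so a ball around \<open>c\<close> is mapped onto a neighbourhood of \<open>c ^ n\<close>.\<close>

lemma mem_closure_roots:
  fixes c :: complex
  assumes n: "n > 0" and c: "c ^ n \<in> closure W"
  shows "c \<in> closure {d. d ^ n \<in> W}"
proof (rule iffD2[OF closure_approachable], intro allI impI)
  fix e :: real assume e: "0 < e"
  have "\<not> (\<lambda>z::complex. z ^ n) constant_on UNIV"
  proof
    assume "(\<lambda>z::complex. z ^ n) constant_on UNIV"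
    then obtain y where y: "\<And>x::complex. x ^ n = y" unfolding constant_on_def by auto
    have "(0::complex) ^ n = (1::complex) ^ n" by (simp only: y)
    then show False using n by (simp add: zero_power)
  qed
  then have "open ((\<lambda>z::complex. z ^ n) ` ball c e)"
    by (intro open_mapping_thm[of _ UNIV]) (auto intro!: holomorphic_intros)
  moreover have "c ^ n \<in> (\<lambda>z. z ^ n) ` ball c e" using e by auto
  ultimately obtain w where "w \<in> W" "w \<in> (\<lambda>z. z ^ n) ` ball c e"
    using c unfolding closure_iff_nhds_not_empty by blast
  then show "\<exists>d\<in>{d. d ^ n \<in> W}. dist d c < e" by (auto simp: dist_commute)
qed

text \<open>Kronecker's theorem, in multiplicative form.\<close>

lemma sphere_generated_by_irrational_rotation:
  fixes l c d :: complex
  assumes l: "norm l = 1" "\<And>n::nat. n > 0 \<Longrightarrow> l ^ n \<noteq> 1"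
    and d: "norm d = norm c"
  shows "d \<in> closure (range (\<lambda>k::nat. l ^ k * c))"
proof (cases "c = 0")
  case True
  with d have "d = l ^ 0 * c" by simp
  then have "d \<in> range (\<lambda>k::nat. l ^ k * c)" by (rule range_eqI)
  then show ?thesis by (rule closure_subset[THEN subsetD])
next
  case False
  define \<theta> where "\<theta> = Arg2pi l / (2 * pi)"
  have cis_frac: "cis (2 * pi * frac x) = cis (2 * pi * x)" for x
  proof -
    have "2 * pi * frac x = 2 * pi * x - 2 * pi * of_int \<lfloor>x\<rfloor>" by (simp add: frac_def algebra_simps)
    then show ?thesis using cis_multiple_2pi[of "of_int \<lfloor>x\<rfloor>"] by (simp add: cis_divide[symmetric])
  qed
  have l\<theta>: "l = cis (2 * pi * \<theta>)"
    using Arg2pi_eq[of l] l(1) by (simp add: \<theta>_def cis_conv_exp)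
  have lpow: "l ^ k = cis (2 * pi * frac (real k * \<theta>))" for k
    unfolding cis_frac by (subst l\<theta>) (simp add: Complex.DeMoivre mult_ac)
  have "\<theta> \<notin> \<rat>"
  proof
    assume "\<theta> \<in> \<rat>"
    then obtain p q :: int where pq: "q > 0" "\<theta> = of_int p / of_int q" by (meson Rats_cases')
    have "real (nat q) * \<theta> = of_int p" using pq by simp
    then have "frac (real (nat q) * \<theta>) = 0" by simp
    then have "l ^ nat q = 1" unfolding lpow by simp
    with l(2)[of "nat q"] pq show False by simp
  qed
  then have dense: "closure (range (\<lambda>n. frac (real n * \<theta>))) = {0..1}" by (rule Kronecker_approx_1)
  define \<beta> where "\<beta> = Arg2pi (d / c) / (2 * pi)"
  have "d / c = cis (2 * pi * \<beta>)"
    using Arg2pi_eq[of "d / c"] d False by (simp add: \<beta>_def cis_conv_exp norm_divide)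
  then have d\<beta>: "d = cis (2 * pi * \<beta>) * c" using False by (simp add: field_simps)
  have "\<beta> \<in> {0..1}" unfolding \<beta>_def using Arg2pi_ge_0[of "d / c"] Arg2pi_lt_2pi[of "d / c"] by simp
  then have "d \<in> (\<lambda>t. cis (2 * pi * t) * c) ` closure (range (\<lambda>n. frac (real n * \<theta>)))"
    unfolding dense d\<beta> by blast
  also have "\<dots> \<subseteq> closure (range (\<lambda>k::nat. l ^ k * c))"
  proof (rule image_closure_subset)
    show "continuous_on (closure (range (\<lambda>n. frac (real n * \<theta>)))) (\<lambda>t. cis (2 * pi * t) * c)"
      by (intro continuous_intros)
    show "(\<lambda>t. cis (2 * pi * t) * c) ` range (\<lambda>n. frac (real n * \<theta>)) \<subseteq> closure (range
        (\<lambda>k::nat. l ^ k * c))"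
      unfolding image_image lpow[symmetric] by (rule closure_subset)
  qed simp
  finally show ?thesis .
qed

text \<open>The weight of the \<open>n\<close>-th power of the weighted rotation; comments below write \<open>\<psi>\<^sub>n\<close> for it.\<close>

definition rotation_cocycle :: "(complex \<Rightarrow> complex) \<Rightarrow> complex \<Rightarrow> nat \<Rightarrow> complex \<Rightarrow> complex"
  where "rotation_cocycle \<psi> l n z = (\<Prod>k<n. \<psi> (l ^ k * z))"

lemma rotation_cocycle_0 [simp]: "rotation_cocycle \<psi> l 0 z = 1"
  by (simp add: rotation_cocycle_def)

lemma rotation_cocycle_Suc: "rotation_cocycle \<psi> l (Suc n) z = rotation_cocycle \<psi> l n z * \<psi> (l ^ n * z)"
  by (simp add: rotation_cocycle_def)

lemma rotation_cocycle_Suc_shift: "rotation_cocycle \<psi> l (Suc n) z = \<psi> z * rotation_cocycle \<psi> l n (l * z)"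
  unfolding rotation_cocycle_def prod.lessThan_Suc_shift by
      (simp add: mult.assoc power_commutes mult.left_commute)

locale rotation_operator =
  fixes \<alpha> :: real and l :: complex and \<psi> :: "complex \<Rightarrow> complex"
  assumes \<alpha>: "\<alpha> > -1" and l: "norm l = 1"
    and \<psi>: "\<psi> holomorphic_on ball 0 1" "bounded (\<psi> ` ball 0 1)"
begin

abbreviation X where "X \<equiv> bergman_space \<alpha>"
abbreviation N where "N \<equiv> bergman_norm \<alpha>"
abbreviation T where "T \<equiv> weighted_composition \<psi> (\<lambda>z. l * z)"

sublocale evaluation_space "bergman_space \<alpha>" "bergman_norm \<alpha>"
  by (rule bergman_evaluation_space[OF \<alpha>])

lemma rotate_mem: "norm (l ^ k * z) = norm z"
  by (simp add: norm_mult norm_power l)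

lemma l_nonzero: "l \<noteq> 0"
  using l by auto

lemma outside: "f \<in> X \<Longrightarrow> z \<notin> ball 0 1 \<Longrightarrow> f z = 0"
  by (simp add: bergman_space_def)

lemma holomorphic: "f \<in> X \<Longrightarrow> f holomorphic_on ball 0 1"
  by (simp add: bergman_space_def)

lemma identity_principle:
  assumes "f \<in> X" "g \<in> X" and U: "open U" "U \<noteq> {}" "U \<subseteq> ball 0 1" "\<And>z. z \<in> U \<Longrightarrow> f z = g z"
  shows "f = g"
proof
  fix z
  show "f z = g z"
  proof (cases "z \<in> ball 0 1")
    case True
    show ?thesis
      by (rule analytic_continuation_open[OF U(1) open_ball U(2) _ U(3) holomorphic holomorphic U(4)
          True])
        (use assms in auto)
  next
    case False
    with assms show ?thesis by (simp add: outside)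
  qed
qed

lemma cancel_z:
  assumes "f \<in> X" "g \<in> X" "\<And>z. z \<in> ball 0 1 \<Longrightarrow> z * f z = z * g z"
  shows "f = g"
proof (rule identity_principle[OF assms(1,2)])
  show "open (ball 0 1 - {0::complex})" by (intro open_Diff) auto
  have "1 / 2 \<in> ball 0 1 - {0::complex}" by simp
  then show "ball 0 1 - {0::complex} \<noteq> {}" by blast
qed (use assms(3) in auto)

lemma rotated_multiplier:
  assumes f: "f \<in> X" and h: "h holomorphic_on ball 0 1" and B: "0 \<le> B" "\<And>z. z \<in> ball 0 1 \<Longrightarrow> norm (h z)
      \<le> B"
    and w: "norm w = 1"
  shows "weighted_composition h (\<lambda>z. w * z) f \<in> X \<and> N (weighted_composition h (\<lambda>z. w * z) f) \<le> B * N f"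
proof -
  let ?g = "\<lambda>z. if z \<in> ball 0 1 then f (w * z) else 0"
  have g: "?g \<in> X" "N ?g \<le> N f" using bergman_rotation[OF \<alpha> f w] by blast+
  have eq: "weighted_composition h (\<lambda>z. w * z) f = (\<lambda>z. h z * ?g z)"
    by (auto simp: weighted_composition_def)
  have "(\<lambda>z. h z * ?g z) \<in> X \<and> N (\<lambda>z. h z * ?g z) \<le> B * N ?g"
    by (rule bergman_multiplier[OF \<alpha> g(1) h B])
  moreover have "B * N ?g \<le> B * N f" using g(2) B(1) by (intro mult_left_mono)
  ultimately show ?thesis unfolding eq by simp
qed

lemma rotated_multiplier_operator:
  assumes h: "h holomorphic_on ball 0 1" "bounded (h ` ball 0 1)" and w: "norm w = 1"
  shows "bounded_operator X N (weighted_composition h (\<lambda>z. w * z))"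
proof -
  obtain B where B: "B > 0" "\<And>z. z \<in> ball 0 1 \<Longrightarrow> norm (h z) \<le> B"
    using h(2) unfolding bounded_pos by auto
  have *: "weighted_composition h (\<lambda>z. w * z) f \<in> X \<and> N (weighted_composition h (\<lambda>z. w * z) f) \<le> B * N f"
    if "f \<in> X" for f
    using B by (intro rotated_multiplier that h w) auto
  show ?thesis
    unfolding bounded_operator_def
  proof (intro conjI ballI allI exI[of _ B])
    fix f assume "f \<in> X"
    from *[OF this] show "weighted_composition h (\<lambda>z. w * z) f \<in> X"
      "N (weighted_composition h (\<lambda>z. w * z) f) \<le> B * N f" by simp_all
  qed (auto simp: weighted_composition_def algebra_simps)
qed

lemma T_bounded: "bounded_operator X N T"
  by (rule rotated_multiplier_operator[OF \<psi> l])

lemma one_mem: "(\<lambda>z. if z \<in> ball 0 1 then 1 else 0) \<in> X"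
  by (rule bergman_one[OF \<alpha>])

lemma T_apply: "z \<in> ball 0 1 \<Longrightarrow> T f z = \<psi> z * f (l * z)"
  by (simp add: weighted_composition_def)

lemma T_power:
  assumes "f \<in> X"
  shows "(T ^^ n) f = weighted_composition (rotation_cocycle \<psi> l n) (\<lambda>z. l ^ n * z) f"
proof (induction n)
  case 0
  show ?case using outside[OF assms] by (auto simp: weighted_composition_def)
next
  case (Suc n)
  have "(T ^^ Suc n) f = T (weighted_composition (rotation_cocycle \<psi> l n) (\<lambda>z. l ^ n * z) f)"
    by (simp only: funpow.simps o_apply Suc)
  also have "\<dots> = weighted_composition (rotation_cocycle \<psi> l (Suc n)) (\<lambda>z. l ^ Suc n * z) f"
    by (auto simp: weighted_composition_def rotation_cocycle_Suc_shift norm_mult l mult_ac)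
  finally show ?case .
qed

lemma T_power_apply:
  "f \<in> X \<Longrightarrow> z \<in> ball 0 1 \<Longrightarrow> (T ^^ n) f z = rotation_cocycle \<psi> l n z * f (l ^ n * z)"
  by (simp add: T_power weighted_composition_def)

lemma cocycle_holomorphic: "rotation_cocycle \<psi> l n holomorphic_on ball 0 1"
proof -
  have "(\<lambda>z. \<psi> (l ^ k * z)) holomorphic_on ball 0 1" for k
  proof -
    have "(\<psi> \<circ> (*) (l ^ k)) holomorphic_on ball 0 1"
      by (rule holomorphic_on_compose_gen[OF _ \<psi>(1)]) (auto intro!: holomorphic_intros simp: rotate_mem)
    then show ?thesis by (simp add: o_def)
  qed
  then show ?thesis unfolding rotation_cocycle_def[abs_def] by (intro holomorphic_intros)
qed

lemma cocycle_small_disk: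
  assumes q: "\<And>z. norm z < s \<Longrightarrow> norm (\<psi> z) \<le> q" and z: "norm z < s" and "0 \<le> q"
  shows "norm (rotation_cocycle \<psi> l n z) \<le> q ^ n"
proof (induction n)
  case (Suc n)
  have "norm (\<psi> (l ^ n * z)) \<le> q" using z by (intro q) (simp add: rotate_mem)
  with Suc have "norm (rotation_cocycle \<psi> l n z) * norm (\<psi> (l ^ n * z)) \<le> q ^ n * q"
    using \<open>0 \<le> q\<close> by (intro mult_mono) auto
  then show ?case by (simp add: rotation_cocycle_Suc norm_mult mult.commute)
qed simp

lemma cocycle_small_disk_lower:
  assumes q: "\<And>z. norm z < s \<Longrightarrow> q \<le> norm (\<psi> z)" and z: "norm z < s" and "0 \<le> q"
  shows "q ^ n \<le> norm (rotation_cocycle \<psi> l n z)"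
proof (induction n)
  case (Suc n)
  have "q \<le> norm (\<psi> (l ^ n * z))" using z by (intro q) (simp add: rotate_mem)
  with Suc have "q ^ n * q \<le> norm (rotation_cocycle \<psi> l n z) * norm (\<psi> (l ^ n * z))"
    using \<open>0 \<le> q\<close> by (intro mult_mono) auto
  then show ?case by (simp add: rotation_cocycle_Suc norm_mult mult.commute)
qed simp

lemma not_in_spectrumI:
  assumes "\<And>f. f \<in> X \<Longrightarrow> N f \<le> K * N (\<lambda>z. T f z - c * f z)"
    and "\<And>g. g \<in> X \<Longrightarrow> \<exists>f\<in>X. (\<lambda>z. T f z - c * f z) = g" "0 \<le> K"
  shows "c \<notin> operator_spectrum X N T"
proof -
  have "inverse_bound (\<lambda>f z. T f z - c * f z) K" using assms by (intro inverse_boundI)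
  then have "inverse_bound (\<lambda>f z. T f z - c * f z) (K + 1)" by (rule inverse_bound_mono) simp
  then show ?thesis unfolding spectrum_iff[OF T_bounded] using assms(3) by (intro exI[of _ "K + 1"]) auto
qed

lemma resolvent_solution:
  assumes "c \<notin> operator_spectrum X N T" "g \<in> X"
  obtains f where "f \<in> X" "(\<lambda>z. T f z - c * f z) = g"
  using assms inverse_bound_surj unfolding spectrum_iff[OF T_bounded] by blast

text \<open>The value at \<open>z\<close> of \<open>(\<Sum>k<n. c ^ (n - 1 - k) T\<^sup>k) f\<close>, the quotient of \<open>T\<^sup>n - c\<^sup>n\<close> by \<open>T - c\<close>
  applied to \<open>f\<close>.\<close>

definition telescope :: "nat \<Rightarrow> complex \<Rightarrow> (complex \<Rightarrow> complex) \<Rightarrow> complex \<Rightarrow> complex"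
  where "telescope n c f z = (\<Sum>k<n. c ^ (n - 1 - k) * (rotation_cocycle \<psi> l k z * f (l ^ k * z)))"

lemma telescope_T:
  assumes z: "z \<in> ball 0 1"
  shows "telescope n c (\<lambda>z. T f z - c * f z) z = rotation_cocycle \<psi> l n z * f (l ^ n * z) - c ^ n * f z"
proof -
  define b where "b k = c ^ (n - k) * (rotation_cocycle \<psi> l k z * f (l ^ k * z))" for k
  have "telescope n c (\<lambda>z. T f z - c * f z) z = (\<Sum>k<n. b (Suc k) - b k)"
    unfolding telescope_def
  proof (rule sum.cong)
    fix k assume k: "k \<in> {..<n}"
    have "T f (l ^ k * z) = \<psi> (l ^ k * z) * f (l ^ Suc k * z)"
      using z by (simp add: T_apply rotate_mem mult.assoc)
    moreover have "c ^ (n - k) = c ^ (n - 1 - k) * c"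
    proof -
      have "n - k = Suc (n - 1 - k)" using k by auto
      then show ?thesis by simp
    qed
    ultimately show "c ^ (n - 1 - k) * (rotation_cocycle \<psi> l k z * (T f (l ^ k * z) - c * f
        (l ^ k * z))) = b (Suc k) - b k"
      unfolding b_def rotation_cocycle_Suc by (simp add: algebra_simps)
  qed simp
  also have "\<dots> = b n - b 0" by (rule sum_lessThan_telescope)
  finally show ?thesis by (simp add: b_def)
qed

lemma T_telescope:
  assumes z: "z \<in> ball 0 1"
  shows "\<psi> z * telescope n c f (l * z) - c * telescope n c f z = rotation_cocycle \<psi> l n z * f
      (l ^ n * z) - c ^ n * f z"
proof -
  define b where "b k = c ^ (n - k) * (rotation_cocycle \<psi> l k z * f (l ^ k * z))" for k
  have "\<psi> z * telescope n c f (l * z) - c * telescope n c f z = (\<Sum>k<n. b (Suc k) - b k)"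
    unfolding telescope_def sum_distrib_left sum_subtractf[symmetric]
  proof (rule sum.cong)
    fix k assume k: "k \<in> {..<n}"
    have "n - k = Suc (n - 1 - k)" using k by auto
    then have "c ^ (n - k) = c ^ (n - 1 - k) * c" by simp
    then show "\<psi> z * (c ^ (n - 1 - k) * (rotation_cocycle \<psi> l k (l * z) * f (l ^ k * (l * z)))) -
        c * (c ^ (n - 1 - k) * (rotation_cocycle \<psi> l k z * f (l ^ k * z))) = b (Suc k) - b k"
      unfolding b_def rotation_cocycle_Suc_shift by (simp add: algebra_simps)
  qed simp
  also have "\<dots> = b n - b 0" by (rule sum_lessThan_telescope)
  finally show ?thesis by (simp add: b_def)
qed

lemma telescope_bounded:
  "\<exists>K\<ge>0. \<forall>f\<in>X. (\<lambda>z. if z \<in> ball 0 1 then telescope n c f z else 0) \<in> X \<and>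
    N (\<lambda>z. if z \<in> ball 0 1 then telescope n c f z else 0) \<le> K * N f"
proof -
  obtain K where K: "K > 0" "\<And>f. f \<in> X \<Longrightarrow> N (T f) \<le> K * N f"
    using bounded_operatorD(5)[OF T_bounded] by blast
  have pow: "N ((T ^^ k) f) \<le> K ^ k * N f" if "f \<in> X" for f k
  proof (induction k)
    case (Suc k)
    have "N ((T ^^ Suc k) f) \<le> K * N ((T ^^ k) f)" using K(2) funpow_mem[OF T_bounded that] by simp
    also have "\<dots> \<le> K * (K ^ k * N f)" using Suc K(1) by (intro mult_left_mono) auto
    finally show ?case by simp
  qed simp
  let ?L = "\<Sum>k<n. norm (c ^ (n - 1 - k)) * K ^ k"
  have "(\<lambda>z. if z \<in> ball 0 1 then telescope n c f z else 0) \<in> X \<and>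
    N (\<lambda>z. if z \<in> ball 0 1 then telescope n c f z else 0) \<le> ?L * N f" if f: "f \<in> X" for f
  proof -
    have off: "(T ^^ k) f z = 0" if "z \<notin> ball 0 1" for k z
      by (rule outside[OF funpow_mem[OF T_bounded f] that])
    have eq: "(\<lambda>z. if z \<in> ball 0 1 then telescope n c f z else 0) = (\<lambda>z. \<Sum>k<n. c ^ (n - 1 - k) *
        (T ^^ k) f z)"
    proof
      fix z
      show "(if z \<in> ball 0 1 then telescope n c f z else 0) = (\<Sum>k<n. c ^ (n - 1 - k) * (T ^^ k) f z)"
      proof (cases "z \<in> ball 0 1")
        case True
        then show ?thesis by (simp only: telescope_def T_power_apply[OF f True] if_True)
      next
        case False
        then show ?thesis by (simp only: off[OF False] if_False mult_zero_right sum.neutral_const)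
      qed
    qed
    have mem: "(\<lambda>z. c ^ (n - 1 - k) * (T ^^ k) f z) \<in> X" for k
      by (intro scale_mem funpow_mem[OF T_bounded f])
    have "N (\<lambda>z. \<Sum>k<n. c ^ (n - 1 - k) * (T ^^ k) f z) \<le> (\<Sum>k<n. N (\<lambda>z. c ^ (n - 1 - k) * (T ^^ k) f z))"
      by (rule norm_sum_le[OF mem])
    also have "\<dots> \<le> (\<Sum>k<n. norm (c ^ (n - 1 - k)) * (K ^ k * N f))"
      unfolding norm_scale[OF funpow_mem[OF T_bounded f]]
      by (intro sum_mono mult_left_mono pow f) auto
    also have "\<dots> = ?L * N f" by (simp add: sum_distrib_right mult.assoc)
    finally show ?thesis unfolding eq using sum_mem[of "{..<n}", OF mem] by simp
  qed
  moreover have "0 \<le> ?L" using K(1) by (intro sum_nonneg) auto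
  ultimately show ?thesis by blast
qed

lemma bounded_reciprocal:
  fixes h :: "complex \<Rightarrow> complex"
  assumes "c \<notin> closure (h ` ball 0 1)"
  shows "\<exists>B>0. \<forall>z\<in>ball 0 1. norm (1 / (h z - c)) \<le> B \<and> h z \<noteq> c"
proof -
  obtain e where e: "e > 0" "\<forall>w\<in>h ` ball 0 1. e \<le> dist w c"
    using assms unfolding closure_approachable by (meson not_le)
  have "norm (1 / (h z - c)) \<le> 1 / e \<and> h z \<noteq> c" if "z \<in> ball 0 1" for z
  proof -
    have d: "e \<le> norm (h z - c)" using e(2) that by (simp add: dist_norm)
    then have "h z \<noteq> c" using e(1) by auto
    moreover have "norm (1 / (h z - c)) \<le> 1 / e" using d e(1) by (simp add: norm_divide frac_le)
    ultimately show ?thesis by blast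
  qed
  then show ?thesis using e(1) by (intro exI[of _ "1 / e"]) auto
qed

text \<open>As \<open>l ^ n = 1\<close>, the telescoping sum inverts \<open>T - c\<close> up to the factor \<open>\<psi>\<^sub>n - c ^ n\<close>, which is
  invariant under the rotation and thus commutes with \<open>T\<close>.\<close>

lemma rational_resolvent:
  assumes ln: "l ^ n = 1" and c: "c ^ n \<notin> closure (rotation_cocycle \<psi> l n ` ball 0 1)"
  shows "c \<notin> operator_spectrum X N T"
proof -
  let ?P = "rotation_cocycle \<psi> l n"
  obtain B where B: "B > 0" "\<And>z. z \<in> ball 0 1 \<Longrightarrow> norm (1 / (?P z - c ^ n)) \<le> B" "\<And>z. z \<in> ball 0 1
      \<Longrightarrow> ?P z \<noteq> c ^ n"
    using bounded_reciprocal[OF c] by auto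
  have hol: "(\<lambda>z. 1 / (?P z - c ^ n)) holomorphic_on ball 0 1"
    using B(3) by (intro holomorphic_intros cocycle_holomorphic) auto
  obtain K where K: "K \<ge> 0" "\<And>f. f \<in> X \<Longrightarrow> (\<lambda>z. if z \<in> ball 0 1 then telescope n c f z else 0) \<in> X"
    "\<And>f. f \<in> X \<Longrightarrow> N (\<lambda>z. if z \<in> ball 0 1 then telescope n c f z else 0) \<le> K * N f"
    using telescope_bounded[of n c] by blast
  define S where "S f = (\<lambda>z. 1 / (?P z - c ^ n) * (if z \<in> ball 0 1 then telescope n c f z else 0))" for f
  have S: "S f \<in> X" "N (S f) \<le> B * K * N f" if "f \<in> X" for f
  proof -
    have "S f \<in> X \<and> N (S f) \<le> B * N (\<lambda>z. if z \<in> ball 0 1 then telescope n c f z else 0)"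
      unfolding S_def using B by (intro bergman_multiplier[OF \<alpha> K(2)[OF that] hol]) auto
    moreover have "B * N (\<lambda>z. if z \<in> ball 0 1 then telescope n c f z else 0) \<le> B * (K * N f)"
      using B(1) K(3)[OF that] by (intro mult_left_mono) auto
    ultimately show "S f \<in> X" "N (S f) \<le> B * K * N f" by (auto simp: mult.assoc)
  qed
  have P_rot: "?P (l * z) = ?P z" if "z \<in> ball 0 1" for z
  proof -
    have "\<psi> z * ?P (l * z) = ?P z * \<psi> z"
      unfolding rotation_cocycle_Suc_shift[symmetric] rotation_cocycle_Suc using ln by simp
    moreover have "?P (l * z) = ?P z" if "\<psi> z = 0"
    proof (cases n)
      case (Suc m)
      then have "?P z = 0" using that by (simp add: rotation_cocycle_Suc_shift)
      moreover have e: "l ^ m * (l * z) = z" using ln Suc by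
          (simp add: mult.assoc[symmetric] mult.commute)
      have "?P (l * z) = rotation_cocycle \<psi> l m (l * z) * \<psi> z"
        unfolding Suc rotation_cocycle_Suc e ..
      then have "?P (l * z) = 0" using that by simp
      ultimately show ?thesis by simp
    qed simp
    ultimately show ?thesis by (metis mult.commute mult_left_cancel)
  qed
  have ST: "S (\<lambda>z. T f z - c * f z) = f" if f: "f \<in> X" for f
  proof
    fix z
    show "S (\<lambda>z. T f z - c * f z) z = f z"
    proof (cases "z \<in> ball 0 1")
      case True
      have "S (\<lambda>z. T f z - c * f z) z = 1 / (?P z - c ^ n) * ((?P z - c ^ n) * f z)"
        unfolding S_def telescope_T[OF True] using True ln by (simp add: algebra_simps)
      then show ?thesis using B(3)[OF True] by simp
    qed (simp add: S_def outside f)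
  qed
  have TS: "(\<lambda>z. T (S g) z - c * S g z) = g" if g: "g \<in> X" for g
  proof
    fix z
    show "T (S g) z - c * S g z = g z"
    proof (cases "z \<in> ball 0 1")
      case True
      then have "l * z \<in> ball 0 1" by (simp add: norm_mult l)
      then have "T (S g) z - c * S g z = (\<psi> z * telescope n c g (l * z) - c * telescope n c g z) /
          (?P z - c ^ n)"
        using True by (simp add: T_apply S_def P_rot diff_divide_distrib)
      also have "\<dots> = (?P z - c ^ n) * g z / (?P z - c ^ n)"
        unfolding T_telescope[OF True] using ln by (simp add: algebra_simps)
      finally show ?thesis using B(3)[OF True] by simp
    qed (simp add: S_def weighted_composition_def outside g)
  qed
  show ?thesis
  proof (rule not_in_spectrumI)
    show "N f \<le> B * K * N (\<lambda>z. T f z - c * f z)" if f: "f \<in> X" for f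
      using S(2)[of "\<lambda>z. T f z - c * f z"] ST[OF f] bounded_operatorD(1)[OF
          bounded_operator_diff_scalar[OF T_bounded] f] by metis
    show "\<exists>f\<in>X. (\<lambda>z. T f z - c * f z) = g" if "g \<in> X" for g using S(1)[OF that] TS[OF that] by blast
    show "0 \<le> B * K" using B K by simp
  qed
qed

text \<open>If \<open>c ^ n = \<psi>\<^sub>n z\<close>, the telescoping sum at \<open>z\<close> is a combination of evaluations on the orbit
  of \<open>z\<close> that vanishes on the range of \<open>T - c\<close>. For \<open>c \<noteq> 0\<close> it is not the zero functional: the \<open>n\<close>
  points of the orbit are distinct, and a polynomial separates \<open>z\<close> from the others. For \<open>c = 0\<close>
  the weight vanishes somewhere on the orbit.\<close>

lemma rational_spectrum_point:
  assumes n: "n > 0" "l ^ n = 1" "\<And>k. 0 < k \<Longrightarrow> k < n \<Longrightarrow> l ^ k \<noteq> 1"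
    and z: "z \<in> ball 0 1" "z \<noteq> 0" and c: "c ^ n = rotation_cocycle \<psi> l n z"
  shows "c \<in> operator_spectrum X N T"
proof (rule ccontr)
  assume res: "c \<notin> operator_spectrum X N T"
  show False
  proof (cases "c = 0")
    case True
    then have "c ^ n = 0" using n(1) by simp
    then have "(\<Prod>k<n. \<psi> (l ^ k * z)) = 0" using c by (simp only: rotation_cocycle_def)
    then obtain k where k: "\<psi> (l ^ k * z) = 0" by auto
    obtain f where f: "(\<lambda>w. T f w - c * f w) = (\<lambda>z. if z \<in> ball 0 1 then 1 else 0)"
      using resolvent_solution[OF res one_mem] by blast
    have "T f (l ^ k * z) = 0" using k z by (simp add: T_apply rotate_mem)
    then show False using fun_cong[OF f, of "l ^ k * z"] True z by (simp add: rotate_mem)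
  next
    case False
    \<comment> \<open>This polynomial vanishes on the orbit of \<open>z\<close> except at \<open>z\<close>.\<close>
    define p where "p w = (\<Prod>k\<in>{1..<n}. w - l ^ k * z)" for w
    have "p holomorphic_on ball 0 1" unfolding p_def[abs_def] by (intro holomorphic_intros)
    moreover have "continuous_on (cball 0 1) p" unfolding p_def[abs_def] by (intro continuous_intros)
    then have "bounded (p ` ball 0 1)"
      by (intro bounded_subset[OF compact_imp_bounded[OF compact_continuous_image[of "cball 0 1" p]]]
          image_mono) auto
    then obtain B where "\<And>w. w \<in> ball 0 1 \<Longrightarrow> norm (p w) \<le> B" unfolding bounded_iff by blast
    ultimately have g: "(\<lambda>w. if w \<in> ball 0 1 then p w else 0) \<in> X"
      by (rule bergman_bounded[OF \<alpha>])
    obtain f where f: "f \<in> X" "(\<lambda>w. T f w - c * f w) = (\<lambda>w. if w \<in> ball 0 1 then p w else 0)"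
      using resolvent_solution[OF res g] by blast
    have "telescope n c (\<lambda>w. if w \<in> ball 0 1 then p w else 0) z = 0"
      unfolding f(2)[symmetric] telescope_T[OF z(1)] using n(2) c by simp
    moreover have "telescope n c (\<lambda>w. if w \<in> ball 0 1 then p w else 0) z = (\<Sum>k<n. if k = 0 then c ^
        (n - 1) * p z else 0)"
      unfolding telescope_def
    proof (rule sum.cong)
      fix k assume k: "k \<in> {..<n}"
      show "c ^ (n - 1 - k) * (rotation_cocycle \<psi> l k z * (if l ^ k * z \<in> ball 0 1 then p
          (l ^ k * z) else 0)) =
          (if k = 0 then c ^ (n - 1) * p z else 0)"
      proof (cases "k = 0")
        case True
        then show ?thesis using z by simp
      next
        case False
        then have "p (l ^ k * z) = 0" unfolding p_def using k by (intro prod_zero) auto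
        then show ?thesis using False by simp
      qed
    qed simp
    ultimately have "p z = 0" using n(1) False by simp
    then obtain k where "k \<in> {1..<n}" "z = l ^ k * z" unfolding p_def by auto
    then show False using n(3)[of k] z(2) by auto
  qed
qed

text \<open>The solutions of \<open>c ^ n = \<psi>\<^sub>n 0\<close> have to be obtained as limits, because the orbit of \<open>0\<close> is a
  single point.\<close>

lemma rational_spectrum:
  assumes n: "n > 0" "l ^ n = 1" "\<And>k. 0 < k \<Longrightarrow> k < n \<Longrightarrow> l ^ k \<noteq> 1"
  shows "operator_spectrum X N T = closure {c. c ^ n \<in> rotation_cocycle \<psi> l n ` ball 0 1}"
proof
  let ?P = "rotation_cocycle \<psi> l n"
  show "operator_spectrum X N T \<subseteq> closure {c. c ^ n \<in> ?P ` ball 0 1}"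
    using rational_resolvent[OF n(2)] mem_closure_roots[OF n(1)] by blast
  have sub: "{c. c ^ n \<in> ?P ` (ball 0 1 - {0})} \<subseteq> operator_spectrum X N T"
    using rational_spectrum_point[OF n] by blast
  have "?P 0 \<in> closure (?P ` (ball 0 1 - {0}))"
    unfolding closure_sequential
  proof (intro exI conjI allI)
    have "isCont ?P 0"
      using holomorphic_on_imp_continuous_on[OF cocycle_holomorphic[of n]]
      by (simp add: continuous_on_eq_continuous_at)
    moreover have "(\<lambda>k. complex_of_real (1 / real (Suc (Suc k)))) \<longlonglongrightarrow> of_real 0"
      by (intro tendsto_of_real LIMSEQ_Suc lim_1_over_n)
    ultimately show "(\<lambda>k. ?P (complex_of_real (1 / real (Suc (Suc k))))) \<longlonglongrightarrow> ?P 0"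
      by (intro isCont_tendsto_compose[of _ ?P]) auto
    show "?P (complex_of_real (1 / real (Suc (Suc k)))) \<in> ?P ` (ball 0 1 - {0})" for k
    proof (rule imageI)
      have "complex_of_real x \<in> ball 0 1 - {0}" if "0 < x" "x < 1" for x using that by simp
      from this[of "1 / real (Suc (Suc k))"]
      show "complex_of_real (1 / real (Suc (Suc k))) \<in> ball 0 1 - {0}" by simp
    qed
  qed
  moreover have "?P z \<in> closure (?P ` (ball 0 1 - {0}))" if "z \<in> ball 0 1" "z \<noteq> 0" for z
    using that by (intro closure_subset[THEN subsetD] imageI) auto
  ultimately have "?P ` ball 0 1 \<subseteq> closure (?P ` (ball 0 1 - {0}))"
    by (intro image_subsetI) metis
  then have "{c. c ^ n \<in> ?P ` ball 0 1} \<subseteq> closure {c. c ^ n \<in> ?P ` (ball 0 1 - {0})}"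
    using mem_closure_roots[OF n(1)] by blast
  also have "\<dots> \<subseteq> operator_spectrum X N T"
    by (rule closure_minimal[OF sub spectrum_closed[OF T_bounded]])
  finally show "closure {c. c ^ n \<in> ?P ` ball 0 1} \<subseteq> operator_spectrum X N T"
    by (rule closure_minimal[OF _ spectrum_closed[OF T_bounded]])
qed

end


section \<open>Averages of the resolvent over roots of unity\<close>

context rotation_operator
begin

lemma times_z_mem: "f \<in> X \<Longrightarrow> (\<lambda>z. z * f z) \<in> X \<and> N (\<lambda>z. z * f z) \<le> N f"
  using bergman_multiplier[OF \<alpha>, of f "\<lambda>z. z" 1] by (auto intro: holomorphic_intros)

lemma divide_by_z:
  obtains K where "K \<ge> 0"
    "\<And>f. f \<in> X \<Longrightarrow> f 0 = 0 \<Longrightarrow> \<exists>u\<in>X. \<forall>z. f z = z * u z"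
    "\<And>u. u \<in> X \<Longrightarrow> N u \<le> K * N (\<lambda>z. z * u z)"
proof -
  obtain K where K: "K \<ge> 0" "\<And>f. f \<in> X \<Longrightarrow> f 0 = 0 \<Longrightarrow> \<exists>u\<in>X. N u \<le> K * N f \<and> (\<forall>z. f z = z * u z)"
    using bergman_divide_by_z[OF \<alpha>] by blast
  have "N u \<le> K * N (\<lambda>z. z * u z)" if u: "u \<in> X" for u
  proof -
    have zu: "(\<lambda>z. z * u z) \<in> X" using times_z_mem[OF u] ..
    obtain w where w: "w \<in> X" "N w \<le> K * N (\<lambda>z. z * u z)" "\<forall>z. z * u z = z * w z"
      using K(2)[OF zu mult_zero_left] by blast
    then have "u = w" by (intro cancel_z u) auto
    with w show ?thesis by simp
  qed
  with K show ?thesis by (intro that[of K]) blast+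
qed

lemma spectrum_mem_psi_0: "\<psi> 0 \<in> operator_spectrum X N T"
proof (rule ccontr)
  assume "\<psi> 0 \<notin> operator_spectrum X N T"
  from resolvent_solution[OF this one_mem] obtain f
    where "(\<lambda>z. T f z - \<psi> 0 * f z) = (\<lambda>z. if z \<in> ball 0 1 then 1 else 0)" by blast
  from fun_cong[OF this, of 0] show False by (simp add: T_apply)
qed

text \<open>Multiplication by \<open>z\<close> intertwines \<open>T - c\<close> with \<open>l\<^sup>-\<^sup>1 (T - l c)\<close>. A solution \<open>f\<close> of
  \<open>(T - l c) f = l z g\<close> vanishes at \<open>0\<close>, because evaluation there multiplies its value by
  \<open>\<psi> 0 - l c \<noteq> 0\<close>; so \<open>f = z u\<close> and \<open>(T - c) u = g\<close>.\<close>

lemma spectrum_rotate: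
  assumes c: "c \<in> operator_spectrum X N T"
  shows "l * c \<in> operator_spectrum X N T"
proof (rule ccontr)
  assume res: "l * c \<notin> operator_spectrum X N T"
  then obtain K where K: "K > 0" "inverse_bound (\<lambda>f z. T f z - l * c * f z) K"
    unfolding spectrum_iff[OF T_bounded] by blast
  obtain L where L: "L \<ge> 0" "\<And>f. f \<in> X \<Longrightarrow> f 0 = 0 \<Longrightarrow> \<exists>u\<in>X. \<forall>z. f z = z * u z"
    "\<And>u. u \<in> X \<Longrightarrow> N u \<le> L * N (\<lambda>z. z * u z)"
    using divide_by_z by blast
  have ne: "\<psi> 0 \<noteq> l * c" using spectrum_mem_psi_0 res by auto
  have intertwine: "T (\<lambda>z. z * f z) z - l * c * (z * f z) = l * (z * (T f z - c * f z))" if "f \<in> X"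
      for f z
    using outside[OF that] by (auto simp: weighted_composition_def algebra_simps)
  have mem: "(\<lambda>z. T f z - c * f z) \<in> X" if "f \<in> X" for f
    by (rule bounded_operatorD(1)[OF bounded_operator_diff_scalar[OF T_bounded] that])
  have "c \<notin> operator_spectrum X N T"
  proof (rule not_in_spectrumI)
    fix f assume f: "f \<in> X"
    have "N f \<le> L * N (\<lambda>z. z * f z)" by (rule L(3)[OF f])
    also have "N (\<lambda>z. z * f z) \<le> K * N (\<lambda>z. T (\<lambda>z. z * f z) z - l * c * (z * f z))"
      using inverse_bound_lower[OF K(2)] times_z_mem[OF f] by blast
    also have "(\<lambda>z. T (\<lambda>z. z * f z) z - l * c * (z * f z)) = (\<lambda>z. l * (z * (T f z - c * f z)))"
      using intertwine[OF f] by auto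
    also have "N \<dots> = N (\<lambda>z. z * (T f z - c * f z))"
      using norm_scale[of "\<lambda>z. z * (T f z - c * f z)" l] times_z_mem[OF mem[OF f]] l by simp
    also have "\<dots> \<le> N (\<lambda>z. T f z - c * f z)" using times_z_mem[OF mem[OF f]] ..
    finally show "N f \<le> L * K * N (\<lambda>z. T f z - c * f z)"
      using L(1) K(1) by (simp add: mult_left_mono mult.assoc)
  next
    fix g assume g: "g \<in> X"
    have "(\<lambda>z. l * (z * g z)) \<in> X" using times_z_mem[OF g] by (intro scale_mem) blast
    then obtain f where f: "f \<in> X" "(\<lambda>z. T f z - l * c * f z) = (\<lambda>z. l * (z * g z))"
      using inverse_bound_surj[OF K(2)] by blast
    have "\<psi> 0 * f 0 - l * c * f 0 = 0" using fun_cong[OF f(2), of 0] T_apply[of 0 f] by simp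
    then have "(\<psi> 0 - l * c) * f 0 = 0" by (simp add: algebra_simps)
    then have "f 0 = 0" using ne by simp
    then obtain u where u: "u \<in> X" "\<forall>z. f z = z * u z" using L(2)[OF f(1)] by blast
    then have fu: "f = (\<lambda>z. z * u z)" by auto
    have "(\<lambda>z. T u z - c * u z) = g"
    proof (rule cancel_z[OF mem[OF u(1)] g])
      fix z :: complex
      have "l * (z * (T u z - c * u z)) = l * (z * g z)"
        using fun_cong[OF f(2), of z] intertwine[OF u(1), of z] unfolding fu by simp
      then show "z * (T u z - c * u z) = z * g z" using l_nonzero by simp
    qed
    with u(1) show "\<exists>f\<in>X. (\<lambda>z. T f z - c * f z) = g" by blast
  qed (use L K in simp)
  with c show False by simp
qed

lemma irrational_spectrum_circular:
  assumes irr: "\<And>n::nat. n > 0 \<Longrightarrow> l ^ n \<noteq> 1"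
    and c: "c \<in> operator_spectrum X N T" and d: "norm d = norm c"
  shows "d \<in> operator_spectrum X N T"
proof -
  have "l ^ k * c \<in> operator_spectrum X N T" for k
    by (induction k) (use c spectrum_rotate in \<open>auto simp: mult.assoc\<close>)
  then have "closure (range (\<lambda>k::nat. l ^ k * c)) \<subseteq> operator_spectrum X N T"
    by (intro closure_minimal spectrum_closed[OF T_bounded]) auto
  then show ?thesis using sphere_generated_by_irrational_rotation[OF l irr d] by blast
qed

text \<open>The identity \<open>T\<^sup>m - c\<^sup>m = (\<Sum>i<m. c ^ (m - 1 - i) T\<^sup>i) (T - c)\<close> applied to \<open>u\<close>.\<close>

lemma T_power_of_solution:
  assumes u: "u \<in> X" "(\<lambda>z. T u z - c * u z) = g" and z: "z \<in> ball 0 1"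
  shows "(T ^^ m) u z = c ^ m * u z + (\<Sum>i<m. c ^ (m - 1 - i) * (T ^^ i) g z)"
proof -
  have g: "g \<in> X"
    unfolding u(2)[symmetric] by (rule bounded_operatorD(1)[OF bounded_operator_diff_scalar[OF
        T_bounded] u(1)])
  have step: "(T ^^ Suc i) u z = c * (T ^^ i) u z + (T ^^ i) g z" for i
  proof -
    have "(T ^^ i) g z = (T ^^ i) (\<lambda>z. T u z - c * u z) z" by (simp only: u(2))
    also have "\<dots> = rotation_cocycle \<psi> l i z * (T u (l ^ i * z) - c * u (l ^ i * z))"
      by (rule T_power_apply[OF _ z]) (simp add: u(2) g)
    also have "\<dots> = (T ^^ i) (T u) z - c * (T ^^ i) u z"
      using T_power_apply[OF u(1) z] T_power_apply[OF bounded_operatorD(1)[OF T_bounded u(1)] z]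
      by (simp add: algebra_simps)
    also have "(T ^^ i) (T u) = (T ^^ Suc i) u" by (simp add: funpow_swap1)
    finally show ?thesis by simp
  qed
  show ?thesis
  proof (induction m)
    case (Suc m)
    have "(\<Sum>i<Suc m. c ^ (Suc m - 1 - i) * (T ^^ i) g z) = c * (\<Sum>i<m. c ^ (m - 1 - i) * (T ^^ i) g z) +
        (T ^^ m) g z"
    proof -
      have "c ^ (m - i) = c * c ^ (m - 1 - i)" if "i < m" for i
      proof -
        have "m - i = Suc (m - 1 - i)" using that by simp
        then show ?thesis by simp
      qed
      then show ?thesis by (simp add: sum_distrib_left mult.assoc)
    qed
    then show ?case by (simp only: step[of m] Suc power_Suc distrib_left mult.assoc add.assoc)
  qed simp
qed

lemma root_of_unity_power:
  assumes "n > 0"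
  shows "(cis (2 * pi / real n) ^ j) ^ n = 1"
proof -
  have "cis (2 * pi / real n) ^ n = 1" using assms by (simp add: Complex.DeMoivre)
  then show ?thesis by (metis mult.commute power_mult power_one)
qed

lemma weighted_root_sum:
  assumes "n > 0"
  shows "(\<Sum>j<n. (of_real \<rho> * cis (2 * pi / real n) ^ j) ^ k) =
      (if n dvd k then of_real \<rho> ^ k * of_nat n else 0)"
  unfolding power_mult_distrib sum_distrib_left[symmetric] root_of_unity_sum[OF assms] by simp

context
  fixes \<rho> K :: real
  assumes \<rho>: "\<rho> > 0" and K: "K > 0"
    and res: "\<And>c. norm c = \<rho> \<Longrightarrow> inverse_bound (\<lambda>f z. T f z - c * f z) K"
begin

lemma circle_solution:
  assumes "norm c = \<rho>" "g \<in> X"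
  shows "\<exists>u\<in>X. (\<lambda>z. T u z - c * u z) = g \<and> N u \<le> K * N g"
proof -
  obtain u where "u \<in> X" "(\<lambda>z. T u z - c * u z) = g" using inverse_bound_surj[OF res assms(2)] assms(1)
      by blast
  with inverse_bound_lower[OF res[OF assms(1)], of u] show ?thesis by auto
qed

lemma norm_average_le:
  assumes n: "n > 0" and u: "\<And>j. j < n \<Longrightarrow> u j \<in> X \<and> N (u j) \<le> B" and c: "\<And>j. j < n \<Longrightarrow> norm (c j) \<le> r"
      and r: "0 \<le> r"
  shows "(\<lambda>z. (1 / of_nat n) * (\<Sum>j<n. c j * u j z)) \<in> X \<and> N (\<lambda>z. (1 / of_nat n) * (\<Sum>j<n. c j * u j z))
      \<le> r * B"
proof -
  have mem: "(\<lambda>z. c j * u j z) \<in> X" if "j \<in> {..<n}" for j using u that by (intro scale_mem) auto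
  note sm = sum_mem[of "{..<n}" "\<lambda>j z. c j * u j z", OF mem]
  have "N (\<lambda>z. \<Sum>j<n. c j * u j z) \<le> (\<Sum>j<n. N (\<lambda>z. c j * u j z))" by (rule norm_sum_le[OF mem])
  also have "\<dots> \<le> (\<Sum>j<n. r * B)"
  proof (rule sum_mono)
    fix j assume j: "j \<in> {..<n}"
    have "N (\<lambda>z. c j * u j z) = norm (c j) * N (u j)" using u j by (intro norm_scale) auto
    also have "\<dots> \<le> r * B" using u[of j] c[of j] j r norm_nonneg[of "u j"] by (intro mult_mono) auto
    finally show "N (\<lambda>z. c j * u j z) \<le> r * B" .
  qed
  finally have "N (\<lambda>z. \<Sum>j<n. c j * u j z) \<le> real n * (r * B)" by simp
  then have "(1 / real n) * N (\<lambda>z. \<Sum>j<n. c j * u j z) \<le> r * B"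
    using n by (simp add: field_simps)
  moreover have "norm (1 / of_nat n :: complex) = 1 / real n" by (simp add: norm_divide)
  moreover have "N (\<lambda>z. (1 / of_nat n) * (\<Sum>j<n. c j * u j z)) = norm (1 / of_nat n :: complex) * N
      (\<lambda>z. \<Sum>j<n. c j * u j z)"
    by (rule norm_scale[OF sm])
  ultimately have "N (\<lambda>z. (1 / of_nat n) * (\<Sum>j<n. c j * u j z)) \<le> r * B"
    by (simp only:)
  with scale_mem[OF sm] show ?thesis by blast
qed

lemma circle_solutions:
  fixes c :: "nat \<Rightarrow> nat \<Rightarrow> complex"
  assumes "g \<in> X" "\<And>m j. norm (c m j) = \<rho>"
  obtains u where "\<And>m j. u m j \<in> X" "\<And>m j. (\<lambda>z. T (u m j) z - c m j * u m j z) = g"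
    "\<And>m j. N (u m j) \<le> K * N g"
proof -
  have "\<forall>m j. \<exists>u. u \<in> X \<and> (\<lambda>z. T u z - c m j * u z) = g \<and> N u \<le> K * N g"
    using circle_solution[OF assms(2,1)] by blast
  then obtain u where "\<forall>m j. u m j \<in> X \<and> (\<lambda>z. T (u m j) z - c m j * u m j z) = g \<and> N (u m j) \<le> K * N g"
    unfolding choice_iff by blast
  then show ?thesis by (intro that[of u]) simp_all
qed

text \<open>Multiply \<open>T_power_of_solution\<close> by \<open>c\<^sup>n\<^sup>+\<^sup>1\<close> and sum over \<open>c = \<rho> \<omega>\<^sup>j\<close>, where \<open>c\<^sup>m = \<rho>\<^sup>m\<close>: of the
  powers of \<open>T\<close> applied to \<open>g\<close>, only the \<open>n\<close>-th survives.\<close>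

lemma averaged_powers:
  fixes m :: nat
  defines "w \<equiv> \<lambda>j. of_real \<rho> * cis (2 * pi / real m) ^ j"
  assumes u: "\<And>j. u j \<in> X" "\<And>j. (\<lambda>z. T (u j) z - w j * u j z) = g"
    and n: "n < m" and z: "z \<in> ball 0 1"
  shows "(\<Sum>j<m. w j ^ Suc n * (T ^^ m) (u j) z) =
    of_real \<rho> ^ m * ((\<Sum>j<m. w j ^ Suc n * u j z) + of_nat m * (T ^^ n) g z)"
proof -
  have m0: "m > 0" using n by simp
  have wm: "w j ^ m = of_real \<rho> ^ m" for j
    unfolding w_def power_mult_distrib root_of_unity_power[OF m0] by simp
  have powers: "(\<Sum>j<m. w j ^ Suc n * w j ^ (m - 1 - i)) = (if i
      = n then of_real \<rho> ^ m * of_nat m else 0)"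
    if i: "i < m" for i
  proof -
    have e: "Suc n + (m - 1 - i) = m + n - i" using i by simp
    have "(\<Sum>j<m. w j ^ Suc n * w j ^ (m - 1 - i)) = (\<Sum>j<m. w j ^ (m + n - i))"
      unfolding power_add[symmetric] e ..
    also have "\<dots> = (if m dvd m + n - i then of_real \<rho> ^ (m + n - i) * of_nat m else 0)"
      unfolding w_def by (rule weighted_root_sum[OF m0])
    also have "m dvd m + n - i \<longleftrightarrow> i = n"
    proof
      assume "m dvd m + n - i"
      then obtain k where k: "m + n - i = m * k" by auto
      have "m * k > m * 0" "m * k < m * 2" using i n unfolding k[symmetric] by auto
      \<comment> \<open>The exponent \<open>m + n - i\<close> lies strictly between \<open>0\<close> and \<open>2 m\<close>, so only \<open>i = n\<close> survives
        the averaging.\<close>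
      then have "k = 1" using m0 by (simp only: mult_less_cancel1) linarith
      with k show "i = n" using i n by auto
    qed simp
    finally show ?thesis by simp
  qed
  have "(\<Sum>j<m. w j ^ Suc n * (T ^^ m) (u j) z) =
      (\<Sum>j<m. w j ^ Suc n * (of_real \<rho> ^ m * u j z)) +
      (\<Sum>j<m. \<Sum>i<m. w j ^ Suc n * w j ^ (m - 1 - i) * (T ^^ i) g z)"
    unfolding T_power_of_solution[OF u(1,2) z] wm
    by (simp only: distrib_left sum.distrib sum_distrib_left mult.assoc)
  also have "(\<Sum>j<m. \<Sum>i<m. w j ^ Suc n * w j ^ (m - 1 - i) * (T ^^ i) g z)
      = (\<Sum>i<m. (\<Sum>j<m. w j ^ Suc n * w j ^ (m - 1 - i)) * (T ^^ i) g z)"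
    by (subst sum.swap) (simp only: sum_distrib_right)
  also have "\<dots> = (\<Sum>i<m. if i = n then of_real \<rho> ^ m * of_nat m * (T ^^ i) g z else 0)"
  proof (rule sum.cong[OF refl])
    fix i assume "i \<in> {..<m}"
    then have i: "i < m" by simp
    show "(\<Sum>j<m. w j ^ Suc n * w j ^ (m - 1 - i)) * (T ^^ i) g z =
        (if i = n then of_real \<rho> ^ m * of_nat m * (T ^^ i) g z else 0)"
      unfolding powers[OF i] by simp
  qed
  also have "\<dots> = of_real \<rho> ^ m * of_nat m * (T ^^ n) g z" using n by simp
  finally show ?thesis by (simp add: distrib_left sum_distrib_left mult_ac del: power_Suc)
qed

lemma weight_near_0:
  assumes "open U" "norm (\<psi> 0) \<in> U"
  obtains s where "s > 0" "s \<le> 1 / 2" "\<And>z. norm z < s \<Longrightarrow> norm (\<psi> z) \<in> U"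
proof -
  have "isCont (\<lambda>z. norm (\<psi> z)) 0"
    using holomorphic_on_imp_continuous_on[OF \<psi>(1)]
    by (intro continuous_intros) (simp add: continuous_on_eq_continuous_at)
  then obtain V where V: "open V" "0 \<in> V" "\<forall>z\<in>V. norm (\<psi> z) \<in> U"
    using assms unfolding continuous_at_open by blast
  then obtain s where "s > 0" "ball 0 s \<subseteq> V" using open_contains_ball by blast
  with V show ?thesis by (intro that[of "min s (1 / 2)"]) (auto simp: subset_iff)
qed

text \<open>Cauchy's formula would express \<open>T\<^sup>n g\<close> by the resolvent on the circle if the spectrum were
  known to lie inside. The corresponding averages \<open>A m\<close> over roots of unity have norm at most
  \<open>K \<rho>\<^sup>n\<^sup>+\<^sup>1\<close> times that of \<open>g\<close> and differ from \<open>T\<^sup>n g\<close> by averages of \<open>\<rho>\<^sup>-\<^sup>m T\<^sup>m u\<close>. Near \<open>0\<close> the weight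
  has modulus at most \<open>q < \<rho>\<close>, so this error tends to \<open>0\<close> there, and the identity principle
  extends the limit to the whole disk.\<close>

lemma power_bound_of_small_diagonal:
  assumes small: "norm (\<psi> 0) < \<rho>" and g: "g \<in> X"
  shows "N ((T ^^ n) g) \<le> K * \<rho> ^ Suc n * N g"
proof -
  obtain q where q: "norm (\<psi> 0) < q" "q < \<rho>" using dense[OF small] by blast
  have q0: "0 \<le> q" using q(1) norm_ge_zero[of "\<psi> 0"] by linarith
  obtain s where s: "s > 0" "s \<le> 1 / 2" "\<And>z. norm z < s \<Longrightarrow> norm (\<psi> z) < q"
    using weight_near_0[of "{..<q}"] q(1) by auto
  obtain C where C: "C \<ge> 0" "\<And>f z. f \<in> X \<Longrightarrow> norm z \<le> 1 / 2 \<Longrightarrow> norm (f z) \<le> C * N f"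
    using bergman_evaluation[OF \<alpha>, of "1 / 2"] by auto
  define w where "w m j = of_real \<rho> * cis (2 * pi / real m) ^ j" for m j :: nat
  have w: "norm (w m j) = \<rho>" for m j unfolding w_def using \<rho> by (simp add: norm_mult norm_power)
  obtain u where u: "\<And>m j. u m j \<in> X" "\<And>m j. (\<lambda>z. T (u m j) z - w m j * u m j z) = g"
    "\<And>m j. N (u m j) \<le> K * N g"
    using circle_solutions[where c = w, OF g w] by blast
  define A where "A m = (\<lambda>z. (1 / of_nat m) * (\<Sum>j<m. - (w m j ^ Suc n) * u m j z))" for m
  have A: "A m \<in> X \<and> N (A m) \<le> \<rho> ^ Suc n * (K * N g)" if "m > 0" for m
    unfolding A_def using that u w \<rho> by (intro norm_average_le) (auto simp: norm_mult norm_power)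
  have error: "norm (A m z - (T ^^ n) g z) \<le> (q / \<rho>) ^ m * (\<rho> ^ Suc n * (C * (K * N g)))"
    if z: "norm z < s" and m: "n < m" for m z
  proof -
    have zb: "z \<in> ball 0 1" using z s by simp
    have m0: "m > 0" using m by simp
    have "of_nat m * A m z = - (\<Sum>j<m. w m j ^ Suc n * u m j z)"
      unfolding A_def using m0 by (simp add: sum_negf del: power_Suc)
    then have sumA: "(\<Sum>j<m. w m j ^ Suc n * u m j z) = - (of_nat m * A m z)" by simp
    have "(\<Sum>j<m. w m j ^ Suc n * (T ^^ m) (u m j) z)
        = of_real \<rho> ^ m * of_nat m * ((T ^^ n) g z - A m z)"
      unfolding averaged_powers[of "u m" m g n, folded w_def, OF u(1,2) m zb] sumA
      by (simp only: uminus_add_conv_diff right_diff_distrib mult.assoc)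
    then have "\<rho> ^ m * real m * norm (A m z - (T ^^ n) g z) = norm (\<Sum>j<m. w m j ^ Suc n * (T ^^ m)
        (u m j) z)"
      using \<rho> by (simp add: norm_mult norm_power norm_minus_commute)
    also have "\<dots> \<le> (\<Sum>j<m. \<rho> ^ Suc n * (q ^ m * (C * (K * N g))))"
    proof (rule order_trans[OF norm_sum sum_mono])
      fix j
      have "norm (u m j (l ^ m * z)) \<le> C * N (u m j)" using z s by (intro C(2) u) (simp add: rotate_mem)
      also have "\<dots> \<le> C * (K * N g)" by (intro mult_left_mono u C)
      finally have "norm ((T ^^ m) (u m j) z) \<le> q ^ m * (C * (K * N g))"
        unfolding T_power_apply[OF u(1) zb] norm_mult
        using q0 by (intro mult_mono cocycle_small_disk[OF less_imp_le[OF s(3)] z q0]) auto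
      then show "norm (w m j ^ Suc n * (T ^^ m) (u m j) z) \<le> \<rho> ^ Suc n * (q ^ m * (C * (K * N g)))"
        unfolding norm_mult norm_power w using \<rho> by (intro mult_left_mono) auto
    qed
    finally have "norm (A m z - (T ^^ n) g z) \<le> (\<rho> ^ Suc n * (q ^ m * (C * (K * N g)))) / \<rho> ^ m"
      using \<rho> m0 by (simp add: field_simps)
    then show ?thesis by (simp add: power_divide mult_ac)
  qed
  obtain h r where h: "h \<in> X" "strict_mono r" "N h \<le> \<rho> ^ Suc n * (K * N g)"
    "\<forall>z. (\<lambda>k. A (Suc n + r k) z) \<longlonglongrightarrow> h z"
    using weakly_compact[of "\<lambda>k. A (Suc n + k)" "\<rho> ^ Suc n * (K * N g)"] A by force
  have "(T ^^ n) g = h"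
  proof (rule identity_principle[OF funpow_mem[OF T_bounded g] h(1), of "ball 0 s"])
    fix z :: complex assume "z \<in> ball 0 s"
    then have z: "norm z < s" by simp
    have "(\<lambda>k. (q / \<rho>) ^ k) \<longlonglongrightarrow> 0" using q q0 \<rho> by (intro LIMSEQ_realpow_zero) auto
    moreover have "filterlim (\<lambda>k. Suc n + r k) sequentially sequentially"
      by (intro filterlim_subseq strict_monoI) (use h(2) in \<open>simp add: strict_mono_less\<close>)
    ultimately have "(\<lambda>k. (q / \<rho>) ^ (Suc n + r k)) \<longlonglongrightarrow> 0"
      by (rule filterlim_compose)
    from tendsto_mult_right[OF this, of "\<rho> ^ Suc n * (C * (K * N g))"]
    have "(\<lambda>k. (q / \<rho>) ^ (Suc n + r k) * (\<rho> ^ Suc n * (C * (K * N g)))) \<longlonglongrightarrow> 0" by simp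
    then have "(\<lambda>k. A (Suc n + r k) z - (T ^^ n) g z) \<longlonglongrightarrow> 0"
      by (rule Lim_null_comparison[rotated]) (intro always_eventually allI error z, simp)
    then have "(\<lambda>k. A (Suc n + r k) z) \<longlonglongrightarrow> (T ^^ n) g z" by (rule LIM_zero_cancel)
    then show "(T ^^ n) g z = h z" using h(4) LIMSEQ_unique by blast
  qed (use s in auto)
  with h(3) show ?thesis by (simp add: mult_ac)
qed

text \<open>Here the averages \<open>W m\<close> of the solutions \<open>u\<close> of \<open>(T - c) u = g\<close> solve \<open>T (W m) = g + E m\<close>,
  where \<open>E m\<close> averages \<open>c u\<close>. From \<open>T\<^sup>m E = \<rho>\<^sup>m (E + g)\<close> and \<open>\<bar>\<psi>\<^sub>m\<bar> \<ge> q\<^sup>m\<close> with \<open>q > \<rho>\<close> near \<open>0\<close>, the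
  error \<open>E m\<close> tends to \<open>0\<close> near \<open>0\<close>. Every weak limit of \<open>W m\<close> is thus a preimage of \<open>g\<close>.\<close>

lemma invertible_of_large_diagonal:
  assumes large: "\<rho> < norm (\<psi> 0)"
  shows "0 \<notin> operator_spectrum X N T"
proof -
  obtain q where q: "\<rho> < q" "q < norm (\<psi> 0)" using dense[OF large] by blast
  have q0: "0 \<le> q" using q(1) \<rho> by linarith
  obtain s where s: "s > 0" "s \<le> 1 / 2" "\<And>z. norm z < s \<Longrightarrow> q < norm (\<psi> z)"
    using weight_near_0[of "{q<..}"] q(2) by auto
  obtain C where C: "C \<ge> 0" "\<And>f z. f \<in> X \<Longrightarrow> norm z \<le> 1 / 2 \<Longrightarrow> norm (f z) \<le> C * N f"
    using bergman_evaluation[OF \<alpha>, of "1 / 2"] by auto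
  define w where "w m j = of_real \<rho> * cis (2 * pi / real m) ^ j" for m j :: nat
  have w: "norm (w m j) = \<rho>" for m j unfolding w_def using \<rho> by (simp add: norm_mult norm_power)
  have right_inverse: "\<exists>f\<in>X. T f = g \<and> N f \<le> K * N g" if g: "g \<in> X" for g
  proof -
    obtain u where u: "\<And>m j. u m j \<in> X" "\<And>m j. (\<lambda>z. T (u m j) z - w m j * u m j z) = g"
      "\<And>m j. N (u m j) \<le> K * N g"
      using circle_solutions[where c = w, OF g w] by blast
    define W where "W m = (\<lambda>z. (1 / of_nat m) * (\<Sum>j<m. 1 * u m j z))" for m
    define E where "E m = (\<lambda>z. (1 / of_nat m) * (\<Sum>j<m. w m j * u m j z))" for m
    have W: "W m \<in> X \<and> N (W m) \<le> 1 * (K * N g)" if "m > 0" for m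
      unfolding W_def using that u by (intro norm_average_le) auto
    have E: "E m \<in> X \<and> N (E m) \<le> \<rho> * (K * N g)" if "m > 0" for m
      unfolding E_def using that u w \<rho> by (intro norm_average_le) auto
    have TW: "\<psi> z * W m (l * z) = E m z + g z" if "z \<in> ball 0 1" "m > 0" for m z
    proof -
      have "\<psi> z * u m j (l * z) = w m j * u m j z + g z" for j
        using fun_cong[OF u(2), of m j z] that by (simp add: T_apply diff_eq_eq add.commute)
      then have "\<psi> z * W m (l * z) = (1 / of_nat m) * (\<Sum>j<m. w m j * u m j z + g z)"
        unfolding W_def by (simp add: sum_distrib_left mult.left_commute[of "\<psi> z"] flip:
            sum_divide_distrib)
      then show ?thesis unfolding E_def using that by
          (simp add: sum.distrib distrib_left add_divide_distrib)
    qed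
    have Epow: "rotation_cocycle \<psi> l m z * E m (l ^ m * z) = of_real \<rho> ^ m * (E m z + g z)"
      if zb: "z \<in> ball 0 1" and m0: "m > 0" for m z
    proof -
      have sumE: "(\<Sum>j<m. w m j * u m j y) = of_nat m * E m y" for y
        unfolding E_def using m0 by simp
      have "of_nat m * (rotation_cocycle \<psi> l m z * E m (l ^ m * z)) = (\<Sum>j<m. w m j * (T ^^ m) (u m j) z)"
        unfolding T_power_apply[OF u(1) zb] mult.left_commute[of "of_nat m"] sumE[symmetric]
            sum_distrib_left
        by (intro sum.cong) (auto simp: mult_ac)
      also have "\<dots> = of_real \<rho> ^ m * (of_nat m * E m z + of_nat m * g z)"
        using averaged_powers[of "u m" m g 0, folded w_def, OF u(1,2) m0 zb] by (simp add: sumE)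
      finally show ?thesis using m0 by (simp flip: distrib_left add: mult.left_commute[of _ "of_nat m"])
    qed
    define D where "D = C * (\<rho> * (K * N g)) + C * N g"
    have Esmall: "norm (E m z) \<le> (\<rho> / q) ^ m * D" if z: "norm z < s" and m0: "m > 0" for m z
    proof -
      define y where "y = z / l ^ m"
      have y: "norm y < s" "l ^ m * y = z" using z l l_nonzero by
          (auto simp: y_def norm_divide norm_power)
      then have yb: "y \<in> ball 0 1" using s by simp
      have "norm (E m y) \<le> C * N (E m)" using y s E[OF m0] by (intro C(2)) auto
      also have "\<dots> \<le> C * (\<rho> * (K * N g))" using E[OF m0] C(1) by (intro mult_left_mono) auto
      finally have Ey: "norm (E m y) \<le> C * (\<rho> * (K * N g))" .
      have gy: "norm (g y) \<le> C * N g" using y s g by (intro C(2)) auto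
      have "q ^ m * norm (E m z) \<le> norm (rotation_cocycle \<psi> l m y) * norm (E m z)"
        by (intro mult_right_mono cocycle_small_disk_lower[OF less_imp_le[OF s(3)] y(1) q0]) auto
      also have "\<dots> = \<rho> ^ m * norm (E m y + g y)"
        using arg_cong[OF Epow[OF yb m0], of norm] \<rho> unfolding y(2) by (simp add: norm_mult norm_power)
      also have "\<dots> \<le> \<rho> ^ m * D"
        unfolding D_def using \<rho> Ey gy by (intro mult_left_mono order_trans[OF norm_triangle_ineq]
            add_mono) auto
      finally show ?thesis using q \<rho> by (simp add: power_divide field_simps)
    qed
    obtain f r where f: "f \<in> X" "strict_mono r" "N f \<le> 1 * (K * N g)" "\<forall>z. (\<lambda>k. W (Suc (r k)) z) \<longlonglongrightarrow> f z"
      using weakly_compact[of "\<lambda>k. W (Suc k)" "1 * (K * N g)"] W by force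
    have "T f = g"
    proof (rule identity_principle[OF bounded_operatorD(1)[OF T_bounded f(1)] g, of "ball 0 s"])
      fix z :: complex assume "z \<in> ball 0 s"
      then have z: "norm z < s" by simp
      then have zb: "z \<in> ball 0 1" using s by simp
      have "(\<lambda>k. (\<rho> / q) ^ k) \<longlonglongrightarrow> 0" using q q0 \<rho> by (intro LIMSEQ_realpow_zero) auto
      moreover have "filterlim (\<lambda>k. Suc (r k)) sequentially sequentially"
        by (intro filterlim_subseq strict_monoI) (use f(2) in \<open>simp add: strict_mono_less\<close>)
      ultimately have "(\<lambda>k. (\<rho> / q) ^ Suc (r k)) \<longlonglongrightarrow> 0"
        by (rule filterlim_compose)
      from tendsto_mult_right[OF this, of D]
      have "(\<lambda>k. (\<rho> / q) ^ Suc (r k) * D) \<longlonglongrightarrow> 0" by simp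
      then have "(\<lambda>k. E (Suc (r k)) z) \<longlonglongrightarrow> 0"
        by (rule Lim_null_comparison[rotated]) (intro always_eventually allI Esmall z, simp)
      then have "(\<lambda>k. E (Suc (r k)) z + g z) \<longlonglongrightarrow> 0 + g z" by (intro tendsto_intros)
      then have "(\<lambda>k. \<psi> z * W (Suc (r k)) (l * z)) \<longlonglongrightarrow> g z" using TW[OF zb] by simp
      moreover have "(\<lambda>k. \<psi> z * W (Suc (r k)) (l * z)) \<longlonglongrightarrow> \<psi> z * f (l * z)"
        by (intro tendsto_intros) (use f(4) in blast)
      ultimately show "T f z = g z" unfolding T_apply[OF zb] using LIMSEQ_unique by blast
    qed (use s in auto)
    with f show ?thesis by auto
  qed
  show ?thesis
  proof (rule not_in_spectrumI)
    fix f assume f: "f \<in> X"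
    obtain h where h: "h \<in> X" "T h = T f" "N h \<le> K * N (T f)"
      using right_inverse[OF bounded_operatorD(1)[OF T_bounded f]] by blast
    have "h = f"
    proof (rule identity_principle[OF h(1) f, of "ball 0 s"])
      fix z :: complex assume "z \<in> ball 0 s"
      define y where "y = z / l"
      have y: "norm y < s" "l * y = z" using \<open>z \<in> ball 0 s\<close> l l_nonzero by (auto simp: y_def norm_divide)
      then have "\<psi> y * h z = \<psi> y * f z" using fun_cong[OF h(2), of y] s by (simp add: T_apply)
      moreover have "\<psi> y \<noteq> 0" using s(3)[OF y(1)] q0 by auto
      ultimately show "h z = f z" by simp
    qed (use s in auto)
    with h(3) show "N f \<le> K * N (\<lambda>z. T f z - 0 * f z)" by simp
  next
    fix g assume "g \<in> X"
    then show "\<exists>f\<in>X. (\<lambda>z. T f z - 0 * f z) = g" using right_inverse by force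
  qed (use K in simp)
qed

end

end


section \<open>The spectrum of a weighted irrational rotation\<close>

lemma le_of_power_le:
  fixes x y D :: real
  assumes "0 \<le> x" "0 \<le> y" and le: "\<And>n::nat. x ^ n \<le> D * y ^ n"
  shows "x \<le> y"
proof (rule ccontr)
  assume "\<not> x \<le> y"
  then have xy: "y < x" by simp
  show False
  proof (cases "y = 0")
    case True
    then show ?thesis using le[of 1] xy by simp
  next
    case False
    then have y: "y > 0" using assms by simp
    then obtain n where "D < (x / y) ^ n" using real_arch_pow[of "x / y" D] xy by auto
    then show False using le[of n] y by (simp add: power_divide field_simps)
  qed
qed

text \<open>The monomials of positive degree sum to geometric sums with ratio \<open>l ^ k \<noteq> 1\<close>, which are
  bounded in \<open>n\<close>.\<close>

lemma polynomial_orbit_sum: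
  fixes l :: complex and c :: "nat \<Rightarrow> complex"
  assumes l: "norm l = 1" and irr: "\<And>n::nat. n > 0 \<Longrightarrow> l ^ n \<noteq> 1"
  shows "\<exists>D. \<forall>n w. norm w \<le> 1 \<longrightarrow>
    norm ((\<Sum>j<n. \<Sum>k\<le>m. c k * (l ^ j * w) ^ k) - of_nat n * c 0) \<le> D"
proof -
  define D where "D = (\<Sum>k\<in>{1..m}. norm (c k) * (2 / norm (l ^ k - 1)))"
  have "norm ((\<Sum>j<n. \<Sum>k\<le>m. c k * (l ^ j * w) ^ k) - of_nat n * c 0) \<le> D" if w: "norm w \<le> 1" for n w
  proof -
    have "{..m} = insert 0 {1..m}" by auto
    then have split: "(\<Sum>k\<le>m. c k * (l ^ j * w) ^ k) = c 0 + (\<Sum>k\<in>{1..m}. c k * (l ^ j * w) ^ k)" for j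
      by simp
    have "(\<Sum>j<n. \<Sum>k\<le>m. c k * (l ^ j * w) ^ k) - of_nat n * c 0 = (\<Sum>j<n. \<Sum>k\<in>{1..m}. c k *
        (l ^ j * w) ^ k)"
      unfolding split sum.distrib by simp
    also have "\<dots> = (\<Sum>k\<in>{1..m}. c k * w ^ k * (\<Sum>j<n. (l ^ k) ^ j))"
      by (subst sum.swap) (simp add: sum_distrib_left power_mult_distrib power_mult[symmetric] mult_ac)
    also have "norm \<dots> \<le> D"
      unfolding D_def
    proof (rule order_trans[OF norm_sum sum_mono])
      fix k assume k: "k \<in> {1..m}"
      then have ne: "l ^ k \<noteq> 1" using irr[of k] by auto
      have "norm ((l ^ k) ^ n - 1) \<le> 2"
        using norm_triangle_ineq4[of "(l ^ k) ^ n" 1] by (simp add: norm_power l)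
      then have "norm (\<Sum>j<n. (l ^ k) ^ j) \<le> 2 / norm (l ^ k - 1)"
        unfolding geometric_sum[OF ne] norm_divide by (intro divide_right_mono) auto
      moreover have "norm (c k * w ^ k) \<le> norm (c k)"
        unfolding norm_mult norm_power using w by (simp add: mult_left_le power_le_one)
      ultimately show "norm (c k * w ^ k * (\<Sum>j<n. (l ^ k) ^ j)) \<le> norm (c k) * (2 / norm (l ^ k - 1))"
        unfolding norm_mult[of "c k * w ^ k"] by (intro mult_mono) auto
    qed
    finally show ?thesis .
  qed
  then show ?thesis by blast
qed

context rotation_operator
begin

text \<open>Apply the powers of the multiplication operator to \<open>1\<close>, evaluate at \<open>z\<close> and compare growth
  rates: the constants disappear.\<close>

lemma multiplier_norm_bound:
  assumes h: "h holomorphic_on ball 0 1" and M: "0 \<le> M"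
    and le: "\<And>f. f \<in> X \<Longrightarrow> (\<lambda>z. h z * f z) \<in> X \<and> N (\<lambda>z. h z * f z) \<le> M * N f"
    and z: "z \<in> ball 0 1"
  shows "norm (h z) \<le> M"
proof -
  let ?one = "\<lambda>z. if z \<in> ball 0 1 then 1 else 0"
  have pow: "(\<lambda>z. h z ^ k * ?one z) \<in> X \<and> N (\<lambda>z. h z ^ k * ?one z) \<le> M ^ k * N ?one" for k
  proof (induction k)
    case 0
    show ?case using one_mem by simp
  next
    case (Suc k)
    have "N (\<lambda>z. h z * (h z ^ k * ?one z)) \<le> M * N (\<lambda>z. h z ^ k * ?one z)" using le Suc by blast
    also have "\<dots> \<le> M * (M ^ k * N ?one)" using Suc M by (intro mult_left_mono) auto
    finally show ?case using le[OF conjunct1[OF Suc]] by (simp add: mult.assoc)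
  qed
  obtain C where C: "\<forall>f\<in>X. norm (f z) \<le> C * N f" using evaluation by blast
  have "norm (h z) ^ k \<le> (\<bar>C\<bar> * N ?one) * M ^ k" for k
  proof -
    have "norm (h z) ^ k = norm (h z ^ k * ?one z)" using z by (simp add: norm_power)
    also have "\<dots> \<le> C * N (\<lambda>z. h z ^ k * ?one z)" using C pow[of k] by fast
    also have "\<dots> \<le> \<bar>C\<bar> * (M ^ k * N ?one)"
      using pow[of k] norm_nonneg by (intro mult_mono) auto
    finally show ?thesis by (simp add: mult_ac)
  qed
  then show ?thesis by (intro le_of_power_le[OF norm_ge_zero M])
qed

text \<open>Up to a rotation, which does not increase norms, \<open>T\<^sup>n\<close> is multiplication by the cocycle.\<close>

lemma cocycle_le_operator_norm:
  assumes M: "0 \<le> M" and le: "\<And>g. g \<in> X \<Longrightarrow> N ((T ^^ n) g) \<le> M * N g" and z: "z \<in> ball 0 1"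
  shows "norm (rotation_cocycle \<psi> l n z) \<le> M"
proof (rule multiplier_norm_bound[OF cocycle_holomorphic M _ z])
  fix f assume f: "f \<in> X"
  define w where "w = inverse (l ^ n)"
  have w: "norm w = 1" "w * (l ^ n) = 1" unfolding w_def using l l_nonzero by
      (auto simp: norm_inverse norm_power)
  let ?g = "\<lambda>z. if z \<in> ball 0 1 then f (w * z) else 0"
  have g: "?g \<in> X" "N ?g \<le> N f" using bergman_rotation[OF \<alpha> f w(1)] by blast+
  have eq: "(T ^^ n) ?g = (\<lambda>z. rotation_cocycle \<psi> l n z * f z)"
  proof
    fix z
    show "(T ^^ n) ?g z = rotation_cocycle \<psi> l n z * f z"
    proof (cases "z \<in> ball 0 1")
      case True
      have e: "w * (l ^ n * z) = z" using w(2) by (simp add: mult.assoc[symmetric])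
      have "?g (l ^ n * z) = f (w * (l ^ n * z))" using True by (simp add: rotate_mem)
      also have "\<dots> = f z" by (simp only: e)
      finally show ?thesis using T_power_apply[OF g(1) True, of n] by simp
    next
      case False
      show ?thesis
        by (simp only: outside[OF funpow_mem[OF T_bounded g(1)] False] outside[OF f False]
            mult_zero_right)
    qed
  qed
  have "N ((T ^^ n) ?g) \<le> M * N f"
    using le[OF g(1)] mult_left_mono[OF g(2) M] by linarith
  then show "(\<lambda>z. rotation_cocycle \<psi> l n z * f z) \<in> X \<and> N (\<lambda>z. rotation_cocycle \<psi> l n z * f z) \<le> M * N f"
    unfolding eq[symmetric] using funpow_mem[OF T_bounded g(1)] by blast
qed

lemma resolvent_outside_growth:
  assumes growth: "\<And>n z. z \<in> ball 0 1 \<Longrightarrow> norm (rotation_cocycle \<psi> l n z) \<le> D * r ^ n"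
    and r: "0 \<le> r" "r < norm c"
  shows "c \<notin> operator_spectrum X N T"
proof -
  have c0: "c \<noteq> 0" using r by auto
  have D: "0 \<le> D" using growth[of 0 0] by simp
  define A where "A f = (\<lambda>z. (1 / c) * T f z)" for f
  have TX: "\<And>f. f \<in> X \<Longrightarrow> T f \<in> X" by (rule bounded_operatorD(1)[OF T_bounded])
  have A: "bounded_operator X N A"
  proof -
    obtain K where K: "K > 0" "\<forall>f\<in>X. N (T f) \<le> K * N f" using bounded_operatorD(5)[OF T_bounded] by blast
    show ?thesis
      unfolding bounded_operator_def
    proof (intro conjI ballI allI exI[of _ "norm (1 / c) * K"])
      fix f assume f: "f \<in> X"
      show "A f \<in> X" unfolding A_def by (intro scale_mem TX f)
      have "N (A f) = norm (1 / c) * N (T f)" unfolding A_def by (rule norm_scale[OF TX[OF f]])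
      also have "\<dots> \<le> norm (1 / c) * (K * N f)" using K f by (intro mult_left_mono) auto
      finally show "N (A f) \<le> norm (1 / c) * K * N f" by (simp add: mult.assoc)
    qed (auto simp: A_def bounded_operatorD(2)[OF T_bounded] bounded_operatorD(3)[OF T_bounded]
        distrib_left mult.left_commute)
  qed
  have Apow: "(A ^^ n) f = (\<lambda>z. (1 / c) ^ n * (T ^^ n) f z)" if f: "f \<in> X" for f n
  proof (induction n)
    case (Suc n)
    have "A (\<lambda>z. (1 / c) ^ n * (T ^^ n) f z) = (\<lambda>z. (1 / c) * ((1 / c) ^ n * T ((T ^^ n) f) z))"
      unfolding A_def bounded_operatorD(3)[OF T_bounded funpow_mem[OF T_bounded f]] ..
    then show ?case by (simp only: funpow.simps o_apply Suc power_Suc mult.assoc)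
  qed simp
  have "inverse_bound (\<lambda>f z. f z - A f z) (D / (1 - r / norm c))"
  proof (rule neumann[OF A])
    show "0 \<le> r / norm c" "r / norm c < 1" using r c0 by (auto simp: field_simps)
    fix n f assume f: "f \<in> X"
    have "N ((A ^^ n) f) = norm ((1 / c) ^ n) * N ((T ^^ n) f)"
      unfolding Apow[OF f] by (rule norm_scale[OF funpow_mem[OF T_bounded f]])
    also have "N ((T ^^ n) f) \<le> D * r ^ n * N f"
      unfolding T_power[OF f] using growth D r
      by (intro conjunct2[OF rotated_multiplier] f cocycle_holomorphic) (auto simp: norm_power l)
    finally have "N ((A ^^ n) f) \<le> norm ((1 / c) ^ n) * (D * r ^ n * N f)" by (simp add: mult_left_mono)
    also have "\<dots> = D * (r / norm c) ^ n * N f" by (simp add: norm_power norm_divide power_divide)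
    finally show "N ((A ^^ n) f) \<le> D * (r / norm c) ^ n * N f" .
  qed (rule D)
  then have IA: "inverse_bound (\<lambda>f z. f z - A f z) (D / (1 - r / norm c))" (is "inverse_bound _ ?L") .
  have eq: "T f z - c * f z = - c * (f z - A f z)" for f z unfolding A_def right_diff_distrib using c0
      by simp
  have mem: "(\<lambda>z. f z - A f z) \<in> X" if "f \<in> X" for f by (intro diff_mem that bounded_operatorD(1)[OF A])
  show ?thesis
  proof (rule not_in_spectrumI)
    fix f assume f: "f \<in> X"
    have "N (\<lambda>z. T f z - c * f z) = norm (- c) * N (\<lambda>z. f z - A f z)"
      unfolding eq by (rule norm_scale[OF mem[OF f]])
    moreover have "N f \<le> ?L * N (\<lambda>z. f z - A f z)" by (rule inverse_bound_lower[OF IA f])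
    ultimately show "N f \<le> ?L / norm c * N (\<lambda>z. T f z - c * f z)" using c0 by simp
  next
    fix g assume g: "g \<in> X"
    obtain f where f: "f \<in> X" "(\<lambda>z. f z - A f z) = (\<lambda>z. - (1 / c) * g z)"
      using inverse_bound_surj[OF IA scale_mem[OF g]] by blast
    have "(\<lambda>z. T f z - c * f z) = g"
    proof
      fix z
      show "T f z - c * f z = g z" unfolding eq using fun_cong[OF f(2), of z] c0 by simp
    qed
    with f(1) show "\<exists>f\<in>X. (\<lambda>z. T f z - c * f z) = g" by blast
  next
    show "0 \<le> ?L / norm c" using D r by (auto intro!: divide_nonneg_nonneg simp: field_simps)
  qed
qed

text \<open>The last two hypotheses determine \<open>L\<close> as the exponential growth rate of the cocycle in the
  sup norm. The radius of a circle inside the disk that misses the spectrum is compared with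
  \<open>\<bar>\<psi> 0\<bar>\<close>, and each of the three cases is contradictory.\<close>

lemma irrational_spectrum:
  assumes irr: "\<And>n::nat. n > 0 \<Longrightarrow> l ^ n \<noteq> 1"
    and zero: "0 \<in> operator_spectrum X N T" and L: "0 \<le> L"
    and upper: "\<And>\<eta>. \<eta> > 0 \<Longrightarrow> \<exists>D r. 0 \<le> r \<and> r \<le> L + \<eta> \<and>
      (\<forall>n. \<forall>z\<in>ball 0 1. norm (rotation_cocycle \<psi> l n z) \<le> D * r ^ n)"
    and lower: "\<And>n M. (\<And>z. z \<in> ball 0 1 \<Longrightarrow> norm (rotation_cocycle \<psi> l n z) \<le> M) \<Longrightarrow> L ^ n \<le> M"
  shows "operator_spectrum X N T = {c. norm c \<le> L}"
proof (intro equalityI subsetI)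
  fix c assume c: "c \<in> operator_spectrum X N T"
  show "c \<in> {c. norm c \<le> L}"
  proof (rule ccontr)
    assume "c \<notin> {c. norm c \<le> L}"
    then have "L < norm c" by simp
    then have "(norm c - L) / 2 > 0" by simp
    from upper[OF this] obtain D r where *: "0 \<le> r \<and> r \<le> L + (norm c - L) / 2 \<and>
        (\<forall>n. \<forall>z\<in>ball 0 1. norm (rotation_cocycle \<psi> l n z) \<le> D * r ^ n)"
      by blast
    then have "r < norm c" using \<open>L < norm c\<close> by (simp add: field_simps)
    with * have "c \<notin> operator_spectrum X N T" by (intro resolvent_outside_growth[of D r]) simp_all
    with c show False by simp
  qed
next
  have inner: "c \<in> operator_spectrum X N T" if c: "0 < norm c" "norm c < L" for c
  proof (rule ccontr)
    assume res: "c \<notin> operator_spectrum X N T"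
    have circle: "d \<notin> operator_spectrum X N T" if "norm d = norm c" for d
      using irrational_spectrum_circular[OF irr, of d c] res that by auto
    then have "sphere 0 (norm c) \<inter> operator_spectrum X N T = {}" by auto
    from uniform_resolvent_bound[OF T_bounded compact_sphere this]
    obtain K where K0: "K > 0" and KS: "\<forall>d\<in>sphere 0 (norm c). inverse_bound (\<lambda>f z. T f z - d * f z) K"
      by blast
    have "inverse_bound (\<lambda>f z. T f z - d * f z) K" if "norm d = norm c" for d
      by (rule bspec[OF KS]) (simp add: that)
    note K = K0 this
    consider "norm (\<psi> 0) = norm c" | "norm (\<psi> 0) < norm c" | "norm c < norm (\<psi> 0)" by linarith
    then show False
    proof cases
      case 1
      then show ?thesis using circle spectrum_mem_psi_0 by blast
    next
      case 2
      have "L ^ n \<le> (K * norm c) * norm c ^ n" for n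
      proof (rule lower)
        fix z :: complex assume z: "z \<in> ball 0 1"
        have "norm (rotation_cocycle \<psi> l n z) \<le> K * norm c ^ Suc n"
        proof (rule cocycle_le_operator_norm[OF _ _ z])
          show "0 \<le> K * norm c ^ Suc n" using K(1) by simp
          show "N ((T ^^ n) g) \<le> K * norm c ^ Suc n * N g" if "g \<in> X" for g
            by (rule power_bound_of_small_diagonal[OF c(1) K 2 that])
        qed
        then show "norm (rotation_cocycle \<psi> l n z) \<le> K * norm c * norm c ^ n" by (simp add: mult.assoc)
      qed
      then have "L \<le> norm c" by (intro le_of_power_le[OF L norm_ge_zero])
      with c show ?thesis by simp
    next
      case 3
      then show ?thesis using invertible_of_large_diagonal[OF c(1) K 3] zero by simp
    qed
  qed
  fix c :: complex assume "c \<in> {c. norm c \<le> L}"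
  then have cL: "norm c \<le> L" by simp
  show "c \<in> operator_spectrum X N T"
  proof (cases "c = 0")
    case False
    have lim: "(\<lambda>n. of_real (1 - 1 / real (Suc (Suc n))) * c) \<longlonglongrightarrow> of_real (1 - 0) * c"
      by (intro tendsto_mult tendsto_const tendsto_of_real tendsto_diff LIMSEQ_Suc lim_1_over_n)
    have mem: "of_real (1 - 1 / real (Suc (Suc n))) * c \<in> operator_spectrum X N T" for n
    proof (rule inner)
      have b: "0 < 1 - 1 / real (Suc (Suc n))" "1 - 1 / real (Suc (Suc n)) < 1" by auto
      have n: "norm (of_real (1 - 1 / real (Suc (Suc n))) * c) = (1 - 1 / real (Suc (Suc n))) * norm c"
        unfolding norm_mult norm_of_real using b by simp
      show "0 < norm (of_real (1 - 1 / real (Suc (Suc n))) * c)" unfolding n using b False by simp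
      have "(1 - 1 / real (Suc (Suc n))) * norm c < 1 * norm c" using b False by
          (intro mult_strict_right_mono) auto
      then show "norm (of_real (1 - 1 / real (Suc (Suc n))) * c) < L" unfolding n using cL by simp
    qed
    have "of_real (1 - 0) * c \<in> operator_spectrum X N T"
      by (rule closed_sequentially[OF spectrum_closed[OF T_bounded] mem lim])
    then show ?thesis by simp
  qed (use zero in simp)
qed

end


section \<open>Reduction of elliptic automorphisms to rotations\<close>

text \<open>After conjugation the map fixes \<open>0\<close>. The Schwarz lemma for it and for its inverse makes its
  derivative at \<open>0\<close> unimodular, so it is a rotation.\<close>

lemma elliptic_normal_form:
  assumes \<phi>: "disk_automorphism \<phi>" and a: "norm a < 1" and fix_a: "\<phi> a = a"
  shows "norm (deriv \<phi> a) = 1"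
    and "\<And>z. norm z < 1 \<Longrightarrow> disk_swap a (\<phi> (disk_swap a z)) = deriv \<phi> a * z"
proof -
  let ?s = "disk_swap a"
  define F where "F z = ?s (\<phi> (?s z))" for z
  have hol: "\<phi> holomorphic_on ball 0 1" and bij: "bij_betw \<phi> (ball 0 1) (ball 0 1)"
    using \<phi> unfolding disk_automorphism_def by auto
  have sbij: "bij_betw ?s (ball 0 1) (ball 0 1)" by (rule bij_swap[OF a])
  have "bij_betw (?s \<circ> (\<phi> \<circ> ?s)) (ball 0 1) (ball 0 1)"
    by (rule bij_betw_trans[OF bij_betw_trans[OF sbij bij] sbij])
  then have Fbij: "bij_betw F (ball 0 1) (ball 0 1)" by (simp add: F_def[abs_def] o_def)
  have "(?s \<circ> (\<phi> \<circ> ?s)) holomorphic_on ball 0 1"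
  proof (intro holomorphic_on_compose_gen[of _ _ _ "ball 0 1"] swap_holomorphic[OF a] hol)
    show "(\<phi> \<circ> ?s) ` ball 0 1 \<subseteq> ball 0 1" "?s ` ball 0 1 \<subseteq> ball 0 1"
      using bij_betw_imp_surj_on[OF sbij] bij_betw_imp_surj_on[OF bij] by
          (auto simp: image_comp[symmetric])
  qed
  then have Fhol: "F holomorphic_on ball 0 1" by (simp add: F_def[abs_def] o_def)
  have F0: "F 0 = 0" by (simp add: F_def fix_a swap_center[OF a])
  have Fim: "F ` ball 0 1 = ball 0 1" and Finj: "inj_on F (ball 0 1)"
    using Fbij by (auto simp: bij_betw_def)
  obtain G where G: "G holomorphic_on F ` ball 0 1" "\<And>z. z \<in> ball 0 1 \<Longrightarrow> deriv F z * deriv G (F z) = 1"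
    "\<And>z. z \<in> ball 0 1 \<Longrightarrow> G (F z) = z"
    using holomorphic_has_inverse[OF Fhol open_ball Finj] by metis
  have Fn: "norm (F z) < 1" if "norm z < 1" for z 
  proof -
    have "F z \<in> F ` ball 0 1" using that by simp
    then show ?thesis unfolding Fim by simp
  qed
  have Gn: "norm (G z) < 1" if "norm z < 1" for z
  proof -
    have "z \<in> F ` ball 0 1" unfolding Fim using that by simp
    then obtain w where "w \<in> ball 0 1" "z = F w" by blast
    then show ?thesis using G(3)[of w] by simp
  qed
  have G0: "G 0 = 0" using G(3)[of 0] F0 by simp
  have dF: "norm (deriv F 0) \<le> 1"
    by (rule Schwarz_Lemma(2)[OF Fhol F0 Fn, of 0]) auto
  have dG: "norm (deriv G 0) \<le> 1"
    by (rule Schwarz_Lemma(2)[OF G(1)[unfolded Fim] G0 Gn, of 0]) auto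
  have "norm (deriv F 0) * norm (deriv G 0) = 1"
    using G(2)[of 0] F0 by (simp flip: norm_mult)
  moreover have "norm (deriv F 0) * norm (deriv G 0) \<le> norm (deriv F 0) * 1"
    using dG by (intro mult_left_mono) auto
  ultimately have "norm (deriv F 0) = 1" using dF by simp
  then obtain l where l: "\<And>z. norm z < 1 \<Longrightarrow> F z = l * z" "norm l = 1"
    using Schwarz_Lemma(3)[OF Fhol F0 Fn, of 0] by auto
  have \<phi>_eq: "\<phi> z = ?s (l * ?s z)" if z: "norm z < 1" for z
  proof -
    have sz: "norm (?s z) < 1" by (rule norm_swap_less[OF a z])
    have "\<phi> z \<in> ball 0 1" using bij_betw_imp_surj_on[OF bij] z by auto
    then have "\<phi> z = ?s (?s (\<phi> z))" using swap_swap[OF a, of "\<phi> z"] by simp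
    also have "?s (\<phi> z) = F (?s z)" unfolding F_def using swap_swap[OF a, of z] z by simp
    finally show ?thesis using l(1)[OF sz] by simp
  qed
  have "((\<lambda>z. ?s (l * ?s z)) has_field_derivative
      (- of_real (1 - (norm a)\<^sup>2) / (1 - cnj a * (l * ?s a))\<^sup>2) * (l * (- of_real (1 - (norm a)\<^sup>2) /
          (1 - cnj a * a)\<^sup>2))) (at a)"
  proof (rule DERIV_chain2[where f = ?s and g = "\<lambda>z. l * ?s z"])
    show "(?s has_field_derivative - of_real (1 - (norm a)\<^sup>2) / (1 - cnj a * (l * ?s a))\<^sup>2) (at
        (l * ?s a))"
      using a by (intro swap_derivative[OF a]) (simp add: swap_center[OF a])
    show "((\<lambda>z. l * ?s z) has_field_derivative l * (- of_real (1 - (norm a)\<^sup>2) / (1 - cnj a * a)\<^sup>2))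
        (at a)"
      using a by (intro DERIV_cmult swap_derivative[OF a]) simp
  qed
  moreover have "1 - cnj a * a = of_real (1 - (norm a)\<^sup>2)"
    by (simp only: of_real_diff of_real_1 complex_norm_square mult.commute)
  moreover have "(1 - (norm a)\<^sup>2) \<noteq> 0" using a by (simp add: abs_square_eq_1)
  ultimately have "((\<lambda>z. ?s (l * ?s z)) has_field_derivative l) (at a)"
    by (simp add: swap_center[OF a] power2_eq_square del: of_real_diff of_real_mult)
  then have "(\<phi> has_field_derivative l) (at a)"
    by (rule has_field_derivative_transform_within_open[where S = "ball 0 1"]) (use a \<phi>_eq in auto)
  then have "deriv \<phi> a = l" by (rule DERIV_imp_deriv)
  with l show "norm (deriv \<phi> a) = 1" "\<And>z. norm z < 1 \<Longrightarrow> ?s (\<phi> (?s z)) = deriv \<phi> a * z"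
    unfolding F_def by auto
qed

lemma (in evaluation_space) bounded_operator_compose:
  assumes A: "bounded_operator X N A" and B: "bounded_operator X N B"
    and C: "\<And>f. f \<in> X \<Longrightarrow> C f = A (B f)"
  shows "bounded_operator X N C"
proof -
  obtain K where K: "K > 0" "\<forall>f\<in>X. N (A f) \<le> K * N f" using bounded_operatorD(5)[OF A] by blast
  obtain L where L: "L > 0" "\<forall>f\<in>X. N (B f) \<le> L * N f" using bounded_operatorD(5)[OF B] by blast
  show ?thesis
    unfolding bounded_operator_def
  proof (intro conjI ballI allI exI[of _ "K * L"])
    fix f assume f: "f \<in> X"
    note Bf = bounded_operatorD(1)[OF B f]
    show "C f \<in> X" unfolding C[OF f] by (rule bounded_operatorD(1)[OF A Bf])
    have "N (C f) \<le> K * N (B f)" unfolding C[OF f] using K Bf by blast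
    also have "\<dots> \<le> K * (L * N f)" using K(1) L f by (intro mult_left_mono) auto
    finally show "N (C f) \<le> K * L * N f" by (simp add: mult.assoc)
    show "C (\<lambda>z. c * f z) = (\<lambda>z. c * C f z)" for c
      unfolding C[OF f] C[OF scale_mem[OF f]] bounded_operatorD(3)[OF B f] bounded_operatorD(3)[OF A Bf]
          ..
    fix g assume g: "g \<in> X"
    show "C (\<lambda>z. f z + g z) = (\<lambda>z. C f z + C g z)"
      unfolding C[OF f] C[OF g] C[OF add_mem[OF f g]] bounded_operatorD(2)[OF B f g]
        bounded_operatorD(2)[OF A Bf bounded_operatorD(1)[OF B g]] ..
  qed
qed

lemma (in evaluation_space) invertible_conjugate:
  assumes C: "bounded_operator X N C" "\<And>f. f \<in> X \<Longrightarrow> C (C f) = f"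
    and A: "invertible_operator X N A" and B: "\<And>f. f \<in> X \<Longrightarrow> B f = C (A (C f))"
  shows "invertible_operator X N B"
proof -
  note CX = bounded_operatorD(1)[OF C(1)]
  obtain S where A': "bounded_operator X N A" and S: "bounded_operator X N S"
    and SA: "\<And>f. f \<in> X \<Longrightarrow> S (A f) = f" and AS: "\<And>f. f \<in> X \<Longrightarrow> A (S f) = f"
    using A unfolding invertible_operator_def by blast
  note AX = bounded_operatorD(1)[OF A'] and SX = bounded_operatorD(1)[OF S]
  have AC: "bounded_operator X N (\<lambda>f. A (C f))" "bounded_operator X N (\<lambda>f. S (C f))"
    by (rule bounded_operator_compose[OF A' C(1)], simp) (rule bounded_operator_compose[OF S C(1)], simp)
  have "bounded_operator X N B" by (rule bounded_operator_compose[OF C(1) AC(1)]) (rule B)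
  moreover have "bounded_operator X N (\<lambda>f. C (S (C f)))" by
      (rule bounded_operator_compose[OF C(1) AC(2)]) simp
  moreover have "C (S (C (B f))) = f" if f: "f \<in> X" for f
    unfolding B[OF f] by (simp add: C(2) SA AX CX f)
  moreover have "B (C (S (C f))) = f" if f: "f \<in> X" for f
  proof -
    have "B (C (S (C f))) = C (A (C (C (S (C f)))))" by (intro B CX SX f)
    then show ?thesis by (simp add: C(2) AS SX CX f)
  qed
  ultimately show ?thesis unfolding invertible_operator_def by blast
qed

lemma (in evaluation_space) spectrum_conjugate:
  assumes C: "bounded_operator X N C" "\<And>f. f \<in> X \<Longrightarrow> C (C f) = f"
    and T: "bounded_operator X N T" and U: "\<And>f. f \<in> X \<Longrightarrow> U f = C (T (C f))"
  shows "operator_spectrum X N U = operator_spectrum X N T"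
proof -
  note CX = bounded_operatorD(1)[OF C(1)] and TX = bounded_operatorD(1)[OF T]
  have UX: "U f \<in> X" if "f \<in> X" for f unfolding U[OF that] by (intro CX TX that)
  have TU: "T f = C (U (C f))" if "f \<in> X" for f
    using that by (simp add: U CX C(2) TX)
  have 1: "(\<lambda>z. U f z - c * f z) = C (\<lambda>z. T (C f) z - c * C f z)" if f: "f \<in> X" for c f
    using bounded_operatorD(4)[OF C(1) TX[OF CX[OF f]] scale_mem[OF CX[OF f], of c]]
      bounded_operatorD(3)[OF C(1) CX[OF f], of c]
    by (simp add: U[OF f] C(2)[OF f])
  have 2: "(\<lambda>z. T f z - c * f z) = C (\<lambda>z. U (C f) z - c * C f z)" if f: "f \<in> X" for c f
    using bounded_operatorD(4)[OF C(1) UX[OF CX[OF f]] scale_mem[OF CX[OF f], of c]]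
      bounded_operatorD(3)[OF C(1) CX[OF f], of c]
    by (simp add: TU[OF f] C(2)[OF f])
  have "invertible_operator X N (\<lambda>f z. U f z - c * f z) \<longleftrightarrow> invertible_operator X N
      (\<lambda>f z. T f z - c * f z)" for c
    using invertible_conjugate[OF C, of "\<lambda>f z. T f z - c * f z" "\<lambda>f z. U f z - c * f z", OF _ _ 1]
      invertible_conjugate[OF C, of "\<lambda>f z. U f z - c * f z" "\<lambda>f z. T f z - c * f z", OF _ _ 2] by blast
  then show ?thesis unfolding operator_spectrum_def by simp
qed

text \<open>The factor of \<open>e\<close> is crude; what matters is that it does not depend on \<open>x\<close>, so that a limit
  \<open>e \<rightarrow> 0\<close> is uniform.\<close>

lemma prod_add_le:
  fixes x :: "nat \<Rightarrow> real"
  assumes x: "\<And>k. 0 \<le> x k" "\<And>k. x k \<le> B" and e: "0 \<le> e" "e \<le> 1"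
  shows "(\<Prod>k<n. x k + e) \<le> (\<Prod>k<n. x k) + e * (real n * (B + 1) ^ n)"
proof (induction n)
  case (Suc n)
  have B: "0 \<le> B" using x[of 0] by linarith
  have P: "(\<Prod>k<n. x k + e) \<le> (B + 1) ^ n"
    using prod_mono[of "{..<n}" "\<lambda>k. x k + e" "\<lambda>_. B + 1"] x e by (simp add: add_mono)
  have "(\<Prod>k<Suc n. x k + e) = (\<Prod>k<n. x k + e) * x n + e * (\<Prod>k<n. x k + e)"
    by (simp add: algebra_simps)
  also have "\<dots> \<le> ((\<Prod>k<n. x k) + e * (real n * (B + 1) ^ n)) * x n + e * (B + 1) ^ n"
    using Suc x e P by (intro add_mono mult_right_mono mult_left_mono) auto
  also have "\<dots> = (\<Prod>k<Suc n. x k) + e * (real n * (B + 1) ^ n * x n + (B + 1) ^ n)"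
    by (simp add: algebra_simps)
  also have "\<dots> \<le> (\<Prod>k<Suc n. x k) + e * (real n * (B + 1) ^ n * (B + 1) + (B + 1) ^ n * (B + 1))"
    using x[of n] e B by (intro add_left_mono mult_left_mono add_mono mult_left_mono)
        (auto simp: mult_le_cancel_left1)
  also have "\<dots> = (\<Prod>k<Suc n. x k) + e * (real (Suc n) * (B + 1) ^ Suc n)"
    by (simp add: algebra_simps)
  finally show ?case .
qed simp

text \<open>The weight \<open>g\<close> seen from its base point \<open>a\<close>: its cocycle along the rotation is taken for
  \<open>g \<circ> s\<close>, where \<open>s\<close> moves \<open>a\<close> to \<open>0\<close>.\<close>

locale conjugated_weight =
  fixes a :: complex and l :: complex and g :: "complex \<Rightarrow> complex"
  assumes a: "norm a < 1" and l: "norm l = 1" and g: "continuous_on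
      (cball 0 1) g" "g holomorphic_on ball 0 1"
begin

abbreviation s where "s \<equiv> disk_swap a"

lemma s_norm: "norm z \<le> 1 \<Longrightarrow> norm (s z) \<le> 1"
  using norm_swap_less[OF a, of z] norm_swap_eq[OF a, of z] by linarith

lemma gs: "continuous_on (cball 0 1) (\<lambda>z. g (s z))" "(\<lambda>z. g (s z)) holomorphic_on ball 0 1"
proof -
  show "continuous_on (cball 0 1) (\<lambda>z. g (s z))"
    by (rule continuous_on_compose2[OF g(1) swap_continuous[OF a]]) (auto simp: s_norm)
  have "(g \<circ> s) holomorphic_on ball 0 1"
    by (rule holomorphic_on_compose_gen[OF swap_holomorphic[OF a] g(2)])
        (auto simp: norm_swap_less[OF a])
  then show "(\<lambda>z. g (s z)) holomorphic_on ball 0 1" by (simp add: o_def)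
qed

text \<open>An outer majorant whose exponent is a polynomial after composition with \<open>s\<close>; its value at
  \<open>a\<close> is then the constant coefficient.\<close>

definition conjugated_majorant :: "real \<Rightarrow> (nat \<Rightarrow> complex) \<Rightarrow> nat \<Rightarrow> bool"
  where "conjugated_majorant \<epsilon> c m \<longleftrightarrow> (\<forall>w. norm w = 1 \<longrightarrow>
    norm (g (s w)) \<le> exp (Re (\<Sum>k\<le>m. c k * w ^ k)) \<and> exp (Re (\<Sum>k\<le>m. c k * w ^ k)) \<le> norm (g (s w)) + \<epsilon>)"

lemma conjugated_majorant_exists:
  assumes "\<epsilon> > 0"
  shows "\<exists>c m. conjugated_majorant \<epsilon> c m"
proof -
  have cont: "continuous_on (sphere 0 1) (\<lambda>z. norm (g (s z)))"
    by (intro continuous_on_norm continuous_on_subset[OF gs(1)]) auto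
  show ?thesis
  proof (rule polynomial_majorant[OF cont _ assms])
    fix c :: "nat \<Rightarrow> complex" and n
    assume "\<And>z. norm z = 1 \<Longrightarrow> norm (g (s z)) \<le> exp (Re (\<Sum>k\<le>n. c k * z ^ k))"
      "\<And>z. norm z = 1 \<Longrightarrow> exp (Re (\<Sum>k\<le>n. c k * z ^ k)) \<le> norm (g (s z)) + \<epsilon>"
    then have "conjugated_majorant \<epsilon> c n" unfolding conjugated_majorant_def by simp
    then show ?thesis by blast
  qed simp
qed

lemma outer_majorant_of_conjugated:
  assumes "conjugated_majorant \<epsilon> c m"
  shows "outer_majorant g \<epsilon> (\<lambda>z. \<Sum>k\<le>m. c k * s z ^ k)"
  unfolding outer_majorant_def
proof (intro conjI allI impI)
  show "continuous_on (cball 0 1) (\<lambda>z. \<Sum>k\<le>m. c k * s z ^ k)"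
    by (intro continuous_intros swap_continuous[OF a])
  show "(\<lambda>z. \<Sum>k\<le>m. c k * s z ^ k) holomorphic_on ball 0 1"
    by (intro holomorphic_intros swap_holomorphic[OF a])
  fix z :: complex assume z: "norm z = 1"
  have "s (s z) = z" by (rule swap_swap[OF a]) (simp add: z)
  moreover have "norm (g (s (s z))) \<le> exp (Re (\<Sum>k\<le>m. c k * s z ^ k)) \<and>
      exp (Re (\<Sum>k\<le>m. c k * s z ^ k)) \<le> norm (g (s (s z))) + \<epsilon>"
    by (rule assms[unfolded conjugated_majorant_def, rule_format, OF norm_swap_eq[OF a z]])
  ultimately show "norm (g z) \<le> exp (Re (\<Sum>k\<le>m. c k * s z ^ k))" "exp (Re (\<Sum>k\<le>m. c k * s z ^ k)) \<le> norm
      (g z) + \<epsilon>"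
    by simp_all
qed

lemma conjugated_majorant_inside:
  assumes "conjugated_majorant \<epsilon> c m" "norm w \<le> 1"
  shows "norm (g (s w)) \<le> exp (Re (\<Sum>k\<le>m. c k * w ^ k))"
proof -
  let ?q = "\<lambda>w. \<Sum>k\<le>m. c k * w ^ k"
  have "norm (g (s w) * exp (- ?q w)) \<le> 1"
  proof (rule boundary_maximum_principle[where f = "\<lambda>w. g (s w) * exp (- ?q w)"])
    show "continuous_on (cball 0 1) (\<lambda>w. g (s w) * exp (- ?q w))" by (intro continuous_intros gs)
    show "(\<lambda>w. g (s w) * exp (- ?q w)) holomorphic_on ball 0 1" by (intro holomorphic_intros gs)
    fix w :: complex assume "norm w = 1"
    then have "norm (g (s w)) \<le> exp (Re (?q w))" using assms(1) unfolding conjugated_majorant_def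
        by blast
    then have "norm (g (s w)) * exp (- Re (?q w)) \<le> exp (Re (?q w)) * exp (- Re (?q w))"
      by (intro mult_right_mono) auto
    then show "norm (g (s w) * exp (- ?q w)) \<le> 1"
      unfolding norm_mult norm_exp_eq_Re by (simp add: exp_minus)
  qed (rule assms(2))
  then have "norm (g (s w)) * exp (- Re (?q w)) \<le> 1"
    unfolding norm_mult norm_exp_eq_Re by (simp only: uminus_complex.sel)
  moreover have "x \<le> exp y" if "x * exp (- y) \<le> 1" for x y :: real
    using that by (simp add: exp_minus field_simps)
  ultimately show ?thesis by blast
qed

lemma cocycle_upper_bound:
  assumes maj: "conjugated_majorant \<epsilon> c m" and irr: "\<And>n::nat. n > 0 \<Longrightarrow> l ^ n \<noteq> 1"
  shows "\<exists>D. \<forall>n. \<forall>z\<in>ball 0 1. norm (rotation_cocycle (\<lambda>z. g (s z)) l n z) \<le> D * exp (Re (c 0)) ^ n"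
proof -
  obtain D where D: "\<And>n w. norm w \<le> 1 \<Longrightarrow>
      norm ((\<Sum>j<n. \<Sum>k\<le>m. c k * (l ^ j * w) ^ k) - of_nat n * c 0) \<le> D"
    using polynomial_orbit_sum[OF l irr] by metis
  have "norm (rotation_cocycle (\<lambda>z. g (s z)) l n z) \<le> exp D * exp (Re (c 0)) ^ n" if z: "norm z < 1"
      for n z
  proof -
    let ?q = "\<lambda>w. \<Sum>k\<le>m. c k * w ^ k"
    have "norm (rotation_cocycle (\<lambda>z. g (s z)) l n z) = (\<Prod>j<n. norm (g (s (l ^ j * z))))"
      by (simp add: rotation_cocycle_def prod_norm)
    also have "\<dots> \<le> (\<Prod>j<n. exp (Re (?q (l ^ j * z))))"
      using z l by (intro prod_mono conjI conjugated_majorant_inside[OF maj])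
          (auto simp: norm_mult norm_power)
    also have "\<dots> = exp (Re (\<Sum>j<n. ?q (l ^ j * z)))" by (simp add: exp_sum)
    also have "Re (\<Sum>j<n. ?q (l ^ j * z)) \<le> D + real n * Re (c 0)"
      using abs_Re_le_cmod[of "(\<Sum>j<n. ?q (l ^ j * z)) - of_nat n * c 0"] D[of z n] z by simp
    finally show ?thesis by (simp add: exp_add exp_of_nat_mult)
  qed
  then show ?thesis by (intro exI[of _ "exp D"]) auto
qed

text \<open>The product of \<open>exp\<close> of the polynomial along an orbit is \<open>exp (n c 0)\<close> at the origin; by the
  maximum principle this is at most its supremum on the circle, where it approximates the
  cocycle.\<close>

lemma cocycle_lower_bound:
  assumes lower: "\<And>\<epsilon> c m. conjugated_majorant \<epsilon> c m \<Longrightarrow> L \<le> exp (Re (c 0))" and L: "0 \<le> L"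
    and M: "\<And>z. z \<in> ball 0 1 \<Longrightarrow> norm (rotation_cocycle (\<lambda>z. g (s z)) l n z) \<le> M"
  shows "L ^ n \<le> M"
proof -
  have rot: "norm (l ^ k * w) = norm w" for k w by (simp add: norm_mult norm_power l)
  have "compact ((\<lambda>z. g (s z)) ` cball 0 1)" by (intro compact_continuous_image gs) auto
  then obtain B where "\<forall>y\<in>(\<lambda>z. g (s z)) ` cball 0 1. norm y \<le> B"
    using compact_imp_bounded bounded_iff by blast
  then have B: "norm (g (s w)) \<le> B" if "norm w \<le> 1" for w using that by auto
  have boundary: "(\<Prod>k<n. norm (g (s (l ^ k * w)))) \<le> M" if w: "norm w = 1" for w
  proof -
    have cont: "continuous_on (cball 0 1) (\<lambda>z. norm (rotation_cocycle (\<lambda>z. g (s z)) l n z))"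
      unfolding rotation_cocycle_def
      by (intro continuous_intros continuous_on_compose2[OF gs(1)]) (auto simp: rot)
    have "norm (rotation_cocycle (\<lambda>z. g (s z)) l n w) \<le> M"
    proof (rule continuous_le_on_closure[OF _ _ M])
      show "continuous_on (closure (ball 0 1)) (\<lambda>z. norm (rotation_cocycle (\<lambda>z. g (s z)) l n z))"
        using cont by simp
      show "w \<in> closure (ball 0 1)" using w by simp
    qed
    then show ?thesis by (simp add: rotation_cocycle_def prod_norm)
  qed
  have "L ^ n \<le> M + e * (real n * (B + 1) ^ n)" if e: "0 < e" "e \<le> 1" for e
  proof -
    obtain c m where maj: "conjugated_majorant e c m" using conjugated_majorant_exists[OF e(1)] by blast
    let ?q = "\<lambda>w. \<Sum>k\<le>m. c k * w ^ k"
    have q0: "?q 0 = c 0" by (simp add: power_0_left if_distrib cong: if_cong)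
    have "L ^ n \<le> exp (Re (c 0)) ^ n" using lower[OF maj] L by (intro power_mono)
    also have "\<dots> = norm (\<Prod>k<n. exp (?q (l ^ k * 0)))"
      by (simp only: mult_zero_right q0 prod_constant card_lessThan norm_power norm_exp_eq_Re)
    also have "\<dots> \<le> M + e * (real n * (B + 1) ^ n)"
    proof (rule boundary_maximum_principle[where f = "\<lambda>w. \<Prod>k<n. exp (?q (l ^ k * w))"])
      show "continuous_on (cball 0 1) (\<lambda>w. \<Prod>k<n. exp (?q (l ^ k * w)))" by (intro continuous_intros)
      show "(\<lambda>w. \<Prod>k<n. exp (?q (l ^ k * w))) holomorphic_on ball 0 1" by (intro holomorphic_intros)
      fix w :: complex assume w: "norm w = 1"
      have "norm (\<Prod>k<n. exp (?q (l ^ k * w))) = (\<Prod>k<n. exp (Re (?q (l ^ k * w))))"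
        by (simp add: prod_norm[symmetric] norm_exp_eq_Re)
      also have "\<dots> \<le> (\<Prod>k<n. norm (g (s (l ^ k * w))) + e)"
        using maj w unfolding conjugated_majorant_def by (intro prod_mono) (auto simp: rot)
      also have "\<dots> \<le> (\<Prod>k<n. norm (g (s (l ^ k * w)))) + e * (real n * (B + 1) ^ n)"
        using e w by (intro prod_add_le B) (auto simp: rot)
      finally show "norm (\<Prod>k<n. exp (?q (l ^ k * w))) \<le> M + e * (real n * (B + 1) ^ n)"
        using boundary[OF w] by simp
    qed simp
    finally show ?thesis .
  qed
  then have ev: "\<forall>\<^sub>F e in at_right 0. L ^ n \<le> M + e * (real n * (B + 1) ^ n)"
    using eventually_at_right_real[of 0 1] by (auto elim!: eventually_mono)
  have "((\<lambda>e. M + e * (real n * (B + 1) ^ n)) \<longlongrightarrow> M + 0 * (real n * (B + 1) ^ n)) (at_right 0)"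
    by (intro tendsto_intros)
  from tendsto_lowerbound[OF this ev] show ?thesis by simp
qed

end

lemma elliptic_iterate:
  assumes \<phi>: "disk_automorphism \<phi>" and a: "norm a < 1" and fix_a: "\<phi> a = a" and w: "norm w < 1"
  shows "(\<phi> ^^ k) (disk_swap a w) = disk_swap a (deriv \<phi> a ^ k * w)"
proof (induction k)
  case (Suc k)
  note nf = elliptic_normal_form[OF \<phi> a fix_a]
  have wk: "norm (deriv \<phi> a ^ k * w) < 1" using w nf(1) by (simp add: norm_mult norm_power)
  have "\<phi> (disk_swap a (deriv \<phi> a ^ k * w)) \<in> ball 0 1"
    using \<phi> norm_swap_less[OF a wk] bij_betwE[of \<phi> "ball 0 1" "ball 0 1"]
    unfolding disk_automorphism_def by simp
  then have "\<phi> (disk_swap a (deriv \<phi> a ^ k * w)) = disk_swap a (disk_swap a (\<phi> (disk_swap a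
      (deriv \<phi> a ^ k * w))))"
    by (intro swap_swap[OF a, symmetric]) simp
  also have "\<dots> = disk_swap a (deriv \<phi> a * (deriv \<phi> a ^ k * w))" unfolding nf(2)[OF wk] ..
  finally show ?case by (simp add: Suc mult.assoc)
qed simp

theorem theorem4p1p1:
  fixes \<alpha> :: real and \<phi> \<psi> :: "complex \<Rightarrow> complex" and a :: complex
  assumes "\<alpha> > -1"
    and "elliptic_automorphism \<phi>"
    and "a \<in> ball 0 1" and "\<phi> a = a"
    and "\<psi> \<in> H_infinity"
    and "\<exists>z\<in>ball 0 1. \<psi> z \<noteq> 0"
    and "\<not> invertible_operator (bergman_space \<alpha>) (bergman_norm \<alpha>) (weighted_composition \<psi> \<phi>)"
  shows "(\<forall>n0::nat. (\<exists>n::nat. n > 0 \<and> deriv \<phi> a ^ n = 1) \<and>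
             n0 = (LEAST n. n > 0 \<and> deriv \<phi> a ^ n = 1) \<longrightarrow>
           operator_spectrum (bergman_space \<alpha>) (bergman_norm \<alpha>) (weighted_composition \<psi> \<phi>) =
             closure {c. \<exists>z\<in>ball 0 1. c ^ n0 = (\<Prod>k = 0..<n0. \<psi> ((\<phi> ^^ k) z))})
    \<and> ((\<forall>n::nat. n > 0 \<longrightarrow> deriv \<phi> a ^ n \<noteq> 1) \<and> \<psi> \<in> disk_algebra \<longrightarrow>
         (\<forall>v. is_outer_part v \<psi> \<longrightarrow>
           operator_spectrum (bergman_space \<alpha>) (bergman_norm \<alpha>) (weighted_composition \<psi> \<phi>) =
             {c. norm c \<le> norm (v a)}))"
proof -
  note \<alpha> = assms(1)
  let ?X = "bergman_space \<alpha>" and ?N = "bergman_norm \<alpha>"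
  let ?s = "disk_swap a" and ?l = "deriv \<phi> a" and ?T = "weighted_composition \<psi> \<phi>"
  define \<psi>' where "\<psi>' = (\<lambda>z. \<psi> (?s z))"
  have \<phi>: "disk_automorphism \<phi>" using assms(2) unfolding elliptic_automorphism_def by blast
  have a: "norm a < 1" using assms(3) by simp
  note nf = elliptic_normal_form[OF \<phi> a assms(4)]
  have \<psi>hol: "\<psi> holomorphic_on ball 0 1" and \<psi>bd: "bounded (\<psi> ` ball 0 1)"
    using assms(5) unfolding H_infinity_def by auto
  have sball: "?s ` ball 0 1 = ball 0 1" using bij_betw_imp_surj_on[OF bij_swap[OF a]] .
  have "(\<psi> \<circ> ?s) holomorphic_on ball 0 1"
    by (rule holomorphic_on_compose_gen[OF swap_holomorphic[OF a] \<psi>hol]) (simp add: sball)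
  moreover have "\<psi>' ` ball 0 1 = \<psi> ` ball 0 1" unfolding \<psi>'_def image_comp[of \<psi> ?s, unfolded o_def,
      symmetric] sball ..
  ultimately interpret R: rotation_operator \<alpha> ?l \<psi>'
    using \<alpha> nf(1) \<psi>bd by unfold_locales (simp_all add: \<psi>'_def o_def)
  define C where "C f = (\<lambda>z. if z \<in> ball 0 1 then f (?s z) else 0)" for f :: "complex \<Rightarrow> complex"
  have C: "bounded_operator ?X ?N C"
    unfolding bounded_operator_def
  proof (intro conjI ballI allI exI[of _ "sqrt (((1 + norm a) / (1 - norm a)) powr (2 + \<alpha>))"])
    fix f assume "f \<in> ?X"
    from bergman_swap[OF a \<alpha> this] show "C f \<in> ?X"
      "?N (C f) \<le> sqrt (((1 + norm a) / (1 - norm a)) powr (2 + \<alpha>)) * ?N f" unfolding C_def by blast+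
  qed (auto simp: C_def)
  have CC: "C (C f) = f" if "f \<in> ?X" for f
    unfolding C_def using R.outside[OF that] by (auto simp: fun_eq_iff norm_swap_less[OF a] swap_swap[OF
        a])
  have TC: "?T f = C (R.T (C f))" if f: "f \<in> ?X" for f
  proof
    fix z
    show "?T f z = C (R.T (C f)) z"
    proof (cases "z \<in> ball 0 1")
      case True
      then have z: "norm z < 1" by simp
      have sz: "norm (?s z) < 1" by (rule norm_swap_less[OF a z])
      have "\<phi> z \<in> ball 0 1" 
        using \<phi> True bij_betwE[of \<phi> "ball 0 1" "ball 0 1"] unfolding disk_automorphism_def by simp
      then have p: "norm (\<phi> z) < 1" by simp
      have ss: "?s (?s z) = z" by (rule swap_swap[OF a less_imp_le[OF z]])
      have "?l * ?s z = ?s (\<phi> z)" using nf(2)[OF sz] ss by simp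
      moreover have "?s (?s (\<phi> z)) = \<phi> z" by (rule swap_swap[OF a less_imp_le[OF p]])
      ultimately show ?thesis
        using z sz ss norm_swap_less[OF a p] by (simp add: C_def weighted_composition_def \<psi>'_def)
    qed (simp add: C_def weighted_composition_def)
  qed
  have spec: "operator_spectrum ?X ?N ?T = operator_spectrum ?X ?N R.T"
    by (rule R.spectrum_conjugate[where C = C and T = R.T and U = ?T, OF C CC R.T_bounded TC])
  have "0 \<in> operator_spectrum ?X ?N ?T"
    using assms(7) unfolding operator_spectrum_def by simp
  then have zero: "0 \<in> operator_spectrum ?X ?N R.T" by (simp only: spec)
  show ?thesis
  proof (intro conjI allI impI)
    fix n0 :: nat
    assume "(\<exists>n::nat. n > 0 \<and> ?l ^ n = 1) \<and> n0 = (LEAST n. n > 0 \<and> ?l ^ n = 1)"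
    then have ex: "\<exists>n::nat. n > 0 \<and> ?l ^ n = 1" and n0: "n0 = (LEAST n. n > 0 \<and> ?l ^ n = 1)" by blast+
    have "n0 > 0 \<and> ?l ^ n0 = 1" unfolding n0 by (rule LeastI_ex[OF ex])
    moreover have "?l ^ k \<noteq> 1" if "0 < k" "k < n0" for k
      using not_less_Least[of k "\<lambda>n. n > 0 \<and> ?l ^ n = 1"] that unfolding n0 by blast
    ultimately have "operator_spectrum ?X ?N R.T = closure {c. c ^ n0
        \<in> rotation_cocycle \<psi>' ?l n0 ` ball 0 1}"
      by (intro R.rational_spectrum) auto
    also have "rotation_cocycle \<psi>' ?l n0 ` ball 0 1 = (\<lambda>z. \<Prod>k = 0..<n0. \<psi> ((\<phi> ^^ k) z)) ` ball 0 1"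
    proof -
      have "rotation_cocycle \<psi>' ?l n0 w = (\<Prod>k = 0..<n0. \<psi> ((\<phi> ^^ k) (?s w)))" if "w \<in> ball 0 1" for w
        using that elliptic_iterate[OF \<phi> a assms(4), of w]
        by (simp add: rotation_cocycle_def \<psi>'_def atLeast0LessThan)
      then have "rotation_cocycle \<psi>' ?l n0 ` ball 0 1 = (\<lambda>z. \<Prod>k = 0..<n0. \<psi> ((\<phi> ^^ k) z)) `
          (?s ` ball 0 1)"
        unfolding image_image by (intro image_cong) auto
      then show ?thesis unfolding sball .
    qed
    finally show "operator_spectrum ?X ?N ?T = closure {c. \<exists>z\<in>ball 0 1. c ^ n0 = (\<Prod>k = 0..<n0. \<psi>
        ((\<phi> ^^ k) z))}"
      unfolding spec by (simp add: image_iff)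
  next
    fix v
    assume irrA: "(\<forall>n::nat. n > 0 \<longrightarrow> ?l ^ n \<noteq> 1) \<and> \<psi> \<in> disk_algebra" and v: "is_outer_part v \<psi>"
    then have irr: "\<And>n::nat. n > 0 \<Longrightarrow> ?l ^ n \<noteq> 1" by blast
    obtain g where g: "continuous_on (cball 0 1) g" "\<And>z. z \<in> ball 0 1 \<Longrightarrow> g z = \<psi> z"
      using irrA unfolding disk_algebra_def by blast
    have ghol: "g holomorphic_on ball 0 1" using holomorphic_transform[OF \<psi>hol] g(2) by metis
    interpret W: conjugated_weight a ?l g by unfold_locales (use a nf(1) g(1) ghol in auto)
    have cocycle: "rotation_cocycle \<psi>' ?l n z = rotation_cocycle (\<lambda>z. g (?s z)) ?l n z" if "z
        \<in> ball 0 1" for n z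
      unfolding rotation_cocycle_def \<psi>'_def
    proof (rule prod.cong[OF refl])
      fix k
      have "norm (?l ^ k * z) < 1" using that R.rotate_mem by simp
      from norm_swap_less[OF a this] show "\<psi> (?s (?l ^ k * z)) = g (?s (?l ^ k * z))" by (simp add: g(2))
    qed
    have maj: "\<exists>p. outer_majorant g \<epsilon> p" if "\<epsilon> > 0" for \<epsilon>
      using W.conjugated_majorant_exists[OF that] W.outer_majorant_of_conjugated by blast
    have center: "(\<Sum>k\<le>m. c k * ?s a ^ k) = c 0" for c :: "nat \<Rightarrow> complex" and m
      by (simp add: swap_center[OF a] power_0_left if_distrib cong: if_cong)
    have "operator_spectrum ?X ?N R.T = {c. norm c \<le> norm (v a)}"
    proof (rule R.irrational_spectrum[OF irr zero norm_ge_zero])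
      fix \<eta> :: real assume \<eta>: "\<eta> > 0"
      obtain \<epsilon>0 where e0: "\<epsilon>0 > 0"
        "\<forall>\<epsilon> p. 0 < \<epsilon> \<longrightarrow> \<epsilon> \<le> \<epsilon>0 \<longrightarrow> outer_majorant g \<epsilon> p \<longrightarrow> exp (Re (p a)) \<le> norm (v a) + \<eta>"
        using majorant_limit[OF g v maj a \<eta>] by blast
      obtain c m where cm: "W.conjugated_majorant \<epsilon>0 c m" using W.conjugated_majorant_exists[OF e0(1)]
          by blast
      have "exp (Re (\<Sum>k\<le>m. c k * ?s a ^ k)) \<le> norm (v a) + \<eta>"
        using e0 W.outer_majorant_of_conjugated[OF cm] by blast
      then have r: "exp (Re (c 0)) \<le> norm (v a) + \<eta>" unfolding center .
      obtain D where D: "\<forall>n. \<forall>z\<in>ball 0 1. norm (rotation_cocycle (\<lambda>z. g (?s z)) ?l n z) \<le> D * exp (Re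
          (c 0)) ^ n"
        using W.cocycle_upper_bound[OF cm irr] by blast
      show "\<exists>D r. 0 \<le> r \<and> r \<le> norm (v a) + \<eta> \<and>
          (\<forall>n. \<forall>z\<in>ball 0 1. norm (rotation_cocycle \<psi>' ?l n z) \<le> D * r ^ n)"
        by (intro exI[of _ D] exI[of _ "exp (Re (c 0))"] conjI) (use r D cocycle in auto)
    next
      fix n M assume M: "\<And>z. z \<in> ball 0 1 \<Longrightarrow> norm (rotation_cocycle \<psi>' ?l n z) \<le> M"
      show "norm (v a) ^ n \<le> M"
      proof (rule W.cocycle_lower_bound)
        fix \<epsilon> c m assume cm: "W.conjugated_majorant \<epsilon> c m"
        show "norm (v a) \<le> exp (Re (c 0))"
          using outer_part_le_majorant[OF g v W.outer_majorant_of_conjugated[OF cm] a] unfolding center .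
      qed (use M cocycle in auto)
    qed
    then show "operator_spectrum ?X ?N ?T = {c. norm c \<le> norm (v a)}" unfolding spec .
  qed
qed

end
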